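(* Let $M$ be a (rational or real) cohomology algebra which carries a polarized Hodge structure, and assume that $M\cong A\otimes B$ as graded algebras, where $A$ and $B$ are (rational or real, accordingly) cohomology algebras. If either $A^1=0$ or $B^1=0$, then $A$ and $B$ are of even dimension and there are polarized Hodge structures on $A$ and $B$, inducing that of $M$.
   Context: Let $F=\mathbb{Q}$ (rational case) or $F=\mathbb{R}$ (real case). A rational (resp. real) cohomology algebra is a finite dimensional graded associative unital $F$-algebra $A=\oplus_i A^i$ such that: the product $\cup$ is graded commutative; $A^i=0$ for $i<0$ and $A^0=F\cdot 1_A$; for some integer $m$, called the dimension of $A$, $A^m\cong F$ and the pairing $A^k\otimes A^{m-k}\to A^m$ given by the product is perfect for every $k$. The tensor product $A\otimes B$ is the graded tensor product of graded-commutative algebras over $F$. Write $A_{\mathbb{R}}=A\otimes_F\mathbb{R}$ and $A_{\mathbb{C}}=A\otimes_F\mathbb{C}$. A rational (resp. real) Hodge structure of weight $k$ on an $F$-vector space $V$ is a decomposition $V_{\mathbb{C}}=\oplus_{p+q=k}V^{p,q}$ into complex subspaces with $\overline{V^{p,q}}=V^{q,p}$. A Hodge structure on a cohomology algebra $A$ is a Hodge structure of weight $k$ on each $A^k$ such that $A^{p,q}\cup A^{p',q'}\subset A^{p+p',q+q'}$. "Hodge structures on $A$ and $B$ inducing that of $M$" means that, under $M\cong A\otimes B$, the Hodge structure of $M$ is the tensor product one: $M^{p,q}=\oplus A^{p_1,q_1}\otimes B^{p_2,q_2}$ over $p_1+p_2=p$, $q_1+q_2=q$. Let $\dim A=2n$.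 A polarization of a Hodge structure on $A$ is a class $\omega\in A^{1,1}\cap A^2_{\mathbb{R}}$ such that: (Lefschetz property) for every $0\le k\le n$, $\cup\omega^{n-k}:A^k_{\mathbb{R}}\to A^{2n-k}_{\mathbb{R}}$ is an isomorphism; (second Riemann bilinear relations) for $k\le n$, with $q_\omega$ on $A^k_{\mathbb{C}}$ the bilinear form defined by $\omega^{n-k}\cup\alpha\cup\beta=q_\omega(\alpha,\beta)\,\omega^n$, $h_\omega(\alpha,\beta)=i^kq_\omega(\alpha,\overline{\beta})$, and $A^{p,q}_{prim}=A^{p,q}\cap\ker(\cup\omega^{n+1-k}:A^k_{\mathbb{C}}\to A^{2n-k+2}_{\mathbb{C}})$, the form $(-1)^{k(k-1)/2}i^{p-q-k}h_\omega$ is positive definite on $A^{p,q}_{prim}$ whenever $p+q=k$. A polarized Hodge structure is a Hodge structure which admits such a class $\omega$ (which is allowed to be real even if $F=\mathbb{Q}$). *)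

theory Defs
  imports Complex_Main "HOL-Library.Poly_Mapping"
begin

text \<open>
  The ground field is the field of rationals or the field of reals, given together with its
  embedding into the reals. The types \<^typ>\<open>rat\<close> and \<^typ>\<open>real\<close> are instances, and up to
  isomorphism they are the only ones.
\<close>

class rational_or_real_field = field_char_0 +
  fixes to_real :: "'a \<Rightarrow> real"
  assumes to_real_add: "to_real (x + y) = to_real x + to_real y"
    and to_real_mult: "to_real (x * y) = to_real x * to_real y"
    and to_real_one: "to_real 1 = 1"
    and range_to_real: "range to_real = \<rat> \<or> range to_real = UNIV"

instantiation rat :: rational_or_real_field
begin
definition to_real_rat :: "rat \<Rightarrow> real" where "to_real_rat = of_rat"
instance
  by standard (auto simp: to_real_rat_def of_rat_add of_rat_mult Rats_def)
end

instantiation real :: rational_or_real_field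
begin
definition to_real_real :: "real \<Rightarrow> real" where "to_real_real = id"
instance
  by standard (auto simp: to_real_real_def)
end

definition to_complex :: "'f::rational_or_real_field \<Rightarrow> complex" where
  "to_complex r = complex_of_real (to_real r)"


section \<open>Direct sums and tensor products of vector spaces\<close>

text \<open>For subspaces \<open>W i\<close>: \<open>V\<close> is the internal direct sum of the \<open>W i\<close> with \<open>i \<in> I\<close>.\<close>

definition internal_direct_sum :: "('i \<Rightarrow> 'v::ab_group_add set) \<Rightarrow> 'i set \<Rightarrow> 'v set \<Rightarrow> bool" where
  "internal_direct_sum W I V \<longleftrightarrow>
     (\<forall>i\<in>I. W i \<subseteq> V) \<and>
     (\<forall>x\<in>V. \<exists>!f. (\<forall>i\<in>I. f i \<in> W i) \<and> (\<forall>i. i \<notin> I \<longrightarrow> f i = 0) \<and>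
                  finite {i. f i \<noteq> 0} \<and> x = (\<Sum>i | f i \<noteq> 0. f i))"

text \<open>
  The tensor product of \<open>V\<close> and \<open>W\<close> is the quotient of the free vector space on \<open>V \<times> W\<close>, here
  the type of finitely supported functions \<open>V \<times> W \<Rightarrow>\<^sub>0 F\<close>, by the span of the bilinearity
  relations. The map \<open>t\<close> exhibits \<open>T\<close> as this tensor product, with \<open>t v w\<close> in the role of the
  pure tensor of \<open>v\<close> and \<open>w\<close>, if the linear extension of \<open>t\<close> to the free vector space induces
  an isomorphism from the quotient to \<open>T\<close>, i.e. is surjective with kernel that span.
\<close>

definition free_scale :: "'f::field \<Rightarrow> ('b \<Rightarrow>\<^sub>0 'f) \<Rightarrow> ('b \<Rightarrow>\<^sub>0 'f)" where
  "free_scale r = Poly_Mapping.map (\<lambda>s. r * s)"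

abbreviation free_gen :: "'b \<Rightarrow> ('b \<Rightarrow>\<^sub>0 'f::field)" where
  "free_gen b \<equiv> Poly_Mapping.single b 1"

definition bilinearity_relations ::
  "('f::field \<Rightarrow> 'v::ab_group_add \<Rightarrow> 'v) \<Rightarrow> ('f \<Rightarrow> 'w::ab_group_add \<Rightarrow> 'w) \<Rightarrow> ('v \<times> 'w \<Rightarrow>\<^sub>0 'f) set" where
  "bilinearity_relations sV sW =
     {free_gen (v + v', w) - free_gen (v, w) - free_gen (v', w) | v v' w. True} \<union>
     {free_gen (v, w + w') - free_gen (v, w) - free_gen (v, w') | v w w'. True} \<union>
     {free_gen (sV r v, w) - free_scale r (free_gen (v, w)) | r v w. True} \<union>
     {free_gen (v, sW r w) - free_scale r (free_gen (v, w)) | r v w. True}"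

definition linear_extension ::
  "('f::field \<Rightarrow> 't::ab_group_add \<Rightarrow> 't) \<Rightarrow> ('b \<Rightarrow> 't) \<Rightarrow> ('b \<Rightarrow>\<^sub>0 'f) \<Rightarrow> 't" where
  "linear_extension sT g x = (\<Sum>b\<in>Poly_Mapping.keys x. sT (Poly_Mapping.lookup x b) (g b))"

definition is_tensor_product ::
  "('f::field \<Rightarrow> 'v::ab_group_add \<Rightarrow> 'v) \<Rightarrow> ('f \<Rightarrow> 'w::ab_group_add \<Rightarrow> 'w) \<Rightarrow>
   ('f \<Rightarrow> 't::ab_group_add \<Rightarrow> 't) \<Rightarrow> ('v \<Rightarrow> 'w \<Rightarrow> 't) \<Rightarrow> bool" where
  "is_tensor_product sV sW sT t \<longleftrightarrow>
     surj (linear_extension sT (\<lambda>(v, w). t v w)) \<and>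
     {x. linear_extension sT (\<lambda>(v, w). t v w) x = 0} =
       module.span free_scale (bilinearity_relations sV sW)"


section \<open>Cohomology algebras\<close>

definition perfect_pairing ::
  "('f::field \<Rightarrow> 'a::ring_1 \<Rightarrow> 'a) \<Rightarrow> 'a set \<Rightarrow> 'a set \<Rightarrow> 'a set \<Rightarrow> bool" where
  \<comment> \<open>The product \<open>U \<otimes> V \<rightarrow> W\<close> induces isomorphisms \<open>U \<cong> Hom(V, W)\<close> and \<open>V \<cong> Hom(U, W)\<close>;
     elements of \<open>Hom(V, W)\<close> are given by endomorphisms of the whole space mapping \<open>V\<close> into
     \<open>W\<close>, regarded only on \<open>V\<close>.\<close>
  "perfect_pairing s U V W \<longleftrightarrow>
     (\<forall>f. Vector_Spaces.linear s s f \<and> f ` V \<subseteq> W \<longrightarrow> (\<exists>!x. x \<in> U \<and> (\<forall>y\<in>V. f y = x * y))) \<and>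
     (\<forall>f. Vector_Spaces.linear s s f \<and> f ` U \<subseteq> W \<longrightarrow> (\<exists>!y. y \<in> V \<and> (\<forall>x\<in>U. f x = x * y)))"

text \<open>
  The number \<open>m\<close> is the dimension of the algebra. The requirement \<open>0 \<noteq> 1\<close> of the class
  \<^class>\<open>ring_1\<close> is no restriction, as \<open>G m\<close> is one-dimensional.
\<close>

locale cohomology_algebra = vector_space scale
  for scale :: "'f::rational_or_real_field \<Rightarrow> 'a::ring_1 \<Rightarrow> 'a" +
  fixes G :: "int \<Rightarrow> 'a set" and m :: int
  assumes scale_mult_left: "scale r x * y = scale r (x * y)"
    and scale_mult_right: "x * scale r y = scale r (x * y)"
    and finite_dimensional: "\<exists>B. finite B \<and> span B = UNIV"
    and subspace_graded: "subspace (G i)"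
    and direct_sum_graded: "internal_direct_sum G UNIV UNIV"
    and mult_graded: "x \<in> G i \<Longrightarrow> y \<in> G j \<Longrightarrow> x * y \<in> G (i + j)"
    and graded_commutative:
      "x \<in> G i \<Longrightarrow> y \<in> G j \<Longrightarrow> x * y = (if odd (i * j) then - (y * x) else y * x)"
    and graded_negative: "i < 0 \<Longrightarrow> G i = {0}"
    and graded_zero: "G 0 = range (\<lambda>r. scale r 1)"
    and graded_top: "\<exists>\<phi>. Vector_Spaces.linear (*) scale \<phi> \<and> bij_betw \<phi> UNIV (G m)"
    and poincare_duality: "perfect_pairing scale (G k) (G (m - k)) (G m)"

text \<open>
  The map \<open>t\<close> stands for \<open>(a, b) \<mapsto> \<phi> (a \<otimes> b)\<close>, where \<open>\<phi>\<close> is an isomorphism of graded algebras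
  from the graded tensor product of \<open>A\<close> and \<open>B\<close> to \<open>M\<close>.
\<close>

definition is_graded_tensor_product ::
  "('f::field \<Rightarrow> 'a::ring_1 \<Rightarrow> 'a) \<Rightarrow> (int \<Rightarrow> 'a set) \<Rightarrow>
   ('f \<Rightarrow> 'b::ring_1 \<Rightarrow> 'b) \<Rightarrow> (int \<Rightarrow> 'b set) \<Rightarrow>
   ('f \<Rightarrow> 'm::ring_1 \<Rightarrow> 'm) \<Rightarrow> (int \<Rightarrow> 'm set) \<Rightarrow> ('a \<Rightarrow> 'b \<Rightarrow> 'm) \<Rightarrow> bool" where
  "is_graded_tensor_product sA GA sB GB sM GM t \<longleftrightarrow>
     is_tensor_product sA sB sM t \<and>
     t 1 1 = 1 \<and>
     (\<forall>i j. \<forall>a. \<forall>b\<in>GB i. \<forall>a'\<in>GA j. \<forall>b'.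
        t a b * t a' b' = (if odd (i * j) then - t (a * a') (b * b') else t (a * a') (b * b'))) \<and>
     (\<forall>k. GM k = module.span sM {t a b | a b i j. a \<in> GA i \<and> b \<in> GB j \<and> i + j = k})"


section \<open>Complexification\<close>

text \<open>
  The complex algebra \<open>A\<^sub>C\<close> together with the map \<open>c\<close>, in the role of \<open>a \<mapsto> a \<otimes> 1\<close>, is
  the extension of scalars of the \<open>F\<close>-algebra \<open>A\<close> to the complex numbers.
\<close>

definition is_complexification ::
  "('f::rational_or_real_field \<Rightarrow> 'a::ring_1 \<Rightarrow> 'a) \<Rightarrow>
   (complex \<Rightarrow> 'ac::ring_1 \<Rightarrow> 'ac) \<Rightarrow> ('a \<Rightarrow> 'ac) \<Rightarrow> bool" where
  "is_complexification s sC c \<longleftrightarrow>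
     vector_space sC \<and>
     (\<forall>z x y. sC z x * y = sC z (x * y) \<and> x * sC z y = sC z (x * y)) \<and>
     c 1 = 1 \<and> (\<forall>a b. c (a * b) = c a * c b) \<and>
     is_tensor_product s (\<lambda>r z. to_complex r * z) (\<lambda>r. sC (to_complex r)) (\<lambda>a z. sC z (c a))"

definition complex_part :: "(complex \<Rightarrow> 'ac::ring_1 \<Rightarrow> 'ac) \<Rightarrow> ('a \<Rightarrow> 'ac) \<Rightarrow> 'a set \<Rightarrow> 'ac set" where
  \<comment> \<open>For an \<open>F\<close>-subspace \<open>V\<close> of \<open>A\<close>, the subspace \<open>V\<^sub>C\<close> of \<open>A\<^sub>C\<close>.\<close>
  "complex_part sC c V = module.span sC (c ` V)"

definition real_part :: "(complex \<Rightarrow> 'ac::ring_1 \<Rightarrow> 'ac) \<Rightarrow> ('a \<Rightarrow> 'ac) \<Rightarrow> 'a set \<Rightarrow> 'ac set" where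
  \<comment> \<open>The extension of scalars of \<open>V\<close> to the reals, as a real subspace of \<open>V\<^sub>C\<close>.\<close>
  "real_part sC c V = module.span (\<lambda>r. sC (complex_of_real r)) (c ` V)"

definition conjugation :: "(complex \<Rightarrow> 'ac::ring_1 \<Rightarrow> 'ac) \<Rightarrow> ('a \<Rightarrow> 'ac) \<Rightarrow> 'ac \<Rightarrow> 'ac" where
  "conjugation sC c =
     (THE \<sigma>. (\<forall>x y. \<sigma> (x + y) = \<sigma> x + \<sigma> y) \<and> (\<forall>z a. \<sigma> (sC z (c a)) = sC (cnj z) (c a)))"

definition complexified_bilinear ::
  "(complex \<Rightarrow> 'ac::ring_1 \<Rightarrow> 'ac) \<Rightarrow> ('a \<Rightarrow> 'ac) \<Rightarrow>
   (complex \<Rightarrow> 'bc::ring_1 \<Rightarrow> 'bc) \<Rightarrow> ('b \<Rightarrow> 'bc) \<Rightarrow>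
   (complex \<Rightarrow> 'mc::ring_1 \<Rightarrow> 'mc) \<Rightarrow> ('m \<Rightarrow> 'mc) \<Rightarrow>
   ('a \<Rightarrow> 'b \<Rightarrow> 'm) \<Rightarrow> 'ac \<Rightarrow> 'bc \<Rightarrow> 'mc" where
  \<comment> \<open>The complex bilinear extension of \<open>t\<close>.\<close>
  "complexified_bilinear sAC cA sBC cB sMC cM t =
     (THE T. (\<forall>y. Vector_Spaces.linear sAC sMC (\<lambda>x. T x y)) \<and>
             (\<forall>x. Vector_Spaces.linear sBC sMC (\<lambda>y. T x y)) \<and>
             (\<forall>a b. T (cA a) (cB b) = cM (t a b)))"


section \<open>Hodge structures\<close>

definition hodge_structure_of_weight ::
  "(complex \<Rightarrow> 'ac::ring_1 \<Rightarrow> 'ac) \<Rightarrow> ('a \<Rightarrow> 'ac) \<Rightarrow> 'a set \<Rightarrow> int \<Rightarrow> (int \<Rightarrow> int \<Rightarrow> 'ac set) \<Rightarrow> bool" where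
  \<comment> \<open>Only the \<open>H p q\<close> with \<open>p + q = k\<close> matter.\<close>
  "hodge_structure_of_weight sC c V k H \<longleftrightarrow>
     (\<forall>p q. p + q = k \<longrightarrow> module.subspace sC (H p q)) \<and>
     internal_direct_sum (\<lambda>(p, q). H p q) {(p, q). p + q = k} (complex_part sC c V) \<and>
     (\<forall>p q. p + q = k \<longrightarrow> conjugation sC c ` H p q = H q p)"

definition hodge_structure ::
  "(complex \<Rightarrow> 'ac::ring_1 \<Rightarrow> 'ac) \<Rightarrow> ('a \<Rightarrow> 'ac) \<Rightarrow> (int \<Rightarrow> 'a set) \<Rightarrow> (int \<Rightarrow> int \<Rightarrow> 'ac set) \<Rightarrow> bool" where
  "hodge_structure sC c G H \<longleftrightarrow>
     (\<forall>k. hodge_structure_of_weight sC c (G k) k H) \<and>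
     (\<forall>p q p' q'. \<forall>x\<in>H p q. \<forall>y\<in>H p' q'. x * y \<in> H (p + p') (q + q'))"

definition q_form ::
  "(complex \<Rightarrow> 'ac::ring_1 \<Rightarrow> 'ac) \<Rightarrow> nat \<Rightarrow> 'ac \<Rightarrow> nat \<Rightarrow> 'ac \<Rightarrow> 'ac \<Rightarrow> complex" where
  "q_form sC n \<omega> k \<alpha> \<beta> = (THE z. \<omega> ^ (n - k) * \<alpha> * \<beta> = sC z (\<omega> ^ n))"

definition h_form ::
  "(complex \<Rightarrow> 'ac::ring_1 \<Rightarrow> 'ac) \<Rightarrow> ('a \<Rightarrow> 'ac) \<Rightarrow> nat \<Rightarrow> 'ac \<Rightarrow> nat \<Rightarrow> 'ac \<Rightarrow> 'ac \<Rightarrow> complex" where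
  "h_form sC c n \<omega> k \<alpha> \<beta> = \<i> ^ k * q_form sC n \<omega> k \<alpha> (conjugation sC c \<beta>)"

definition primitive_part ::
  "(int \<Rightarrow> int \<Rightarrow> 'ac::ring_1 set) \<Rightarrow> nat \<Rightarrow> 'ac \<Rightarrow> nat \<Rightarrow> int \<Rightarrow> int \<Rightarrow> 'ac set" where
  "primitive_part H n \<omega> k p q = {\<alpha> \<in> H p q. \<alpha> * \<omega> ^ (n + 1 - k) = 0}"

definition polarization ::
  "(complex \<Rightarrow> 'ac::ring_1 \<Rightarrow> 'ac) \<Rightarrow> ('a \<Rightarrow> 'ac) \<Rightarrow> (int \<Rightarrow> 'a set) \<Rightarrow> nat \<Rightarrow>
   (int \<Rightarrow> int \<Rightarrow> 'ac set) \<Rightarrow> 'ac \<Rightarrow> bool" where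
  "polarization sC c G n H \<omega> \<longleftrightarrow>
     \<omega> \<in> H 1 1 \<inter> real_part sC c (G 2) \<and>
     (\<forall>k\<le>n. bij_betw (\<lambda>x. x * \<omega> ^ (n - k))
               (real_part sC c (G (int k))) (real_part sC c (G (2 * int n - int k)))) \<and>
     (\<forall>k\<le>n. \<forall>p q. p + q = int k \<longrightarrow>
        (\<forall>\<alpha>\<in>primitive_part H n \<omega> k p q. \<alpha> \<noteq> 0 \<longrightarrow>
           (let z = (-1) ^ (k * (k - 1) div 2) * \<i> powi (p - q - int k) * h_form sC c n \<omega> k \<alpha> \<alpha>
            in z \<in> \<real> \<and> Re z > 0)))"

definition polarized_hodge_structure ::
  "(complex \<Rightarrow> 'ac::ring_1 \<Rightarrow> 'ac) \<Rightarrow> ('a \<Rightarrow> 'ac) \<Rightarrow> (int \<Rightarrow> 'a set) \<Rightarrow> int \<Rightarrow>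
   (int \<Rightarrow> int \<Rightarrow> 'ac set) \<Rightarrow> bool" where
  "polarized_hodge_structure sC c G m H \<longleftrightarrow>
     hodge_structure sC c G H \<and> (\<exists>n \<omega>. m = 2 * int n \<and> polarization sC c G n H \<omega>)"

text \<open>
  With \<open>T\<close> the complexified isomorphism, \<open>M\<^sup>p\<^sup>,\<^sup>q\<close> is the direct sum of the images of the
  tensor products of \<open>A\<^sup>p\<^sup>1\<^sup>,\<^sup>q\<^sup>1\<close> and \<open>B\<^sup>p\<^sup>2\<^sup>,\<^sup>q\<^sup>2\<close>.
\<close>

definition is_tensor_hodge_structure ::
  "(complex \<Rightarrow> 'mc::ring_1 \<Rightarrow> 'mc) \<Rightarrow> ('ac \<Rightarrow> 'bc \<Rightarrow> 'mc) \<Rightarrow>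
   (int \<Rightarrow> int \<Rightarrow> 'ac set) \<Rightarrow> (int \<Rightarrow> int \<Rightarrow> 'bc set) \<Rightarrow> (int \<Rightarrow> int \<Rightarrow> 'mc set) \<Rightarrow> bool" where
  "is_tensor_hodge_structure sMC T HA HB HM \<longleftrightarrow>
     (\<forall>p q. internal_direct_sum
        (\<lambda>(p1, q1, p2, q2). module.span sMC {T x y | x y. x \<in> HA p1 q1 \<and> y \<in> HB p2 q2})
        {(p1, q1, p2, q2). p1 + p2 = p \<and> q1 + q2 = q}
        (HM p q))"

end

(*
  A Hodge structure on M is encoded by the derivation D of the complexification of M that is
  multiplication by p - q on the (p, q)-part. Since the product of the degree 1 parts of A and B
  vanishes, the polarization is w = wA + wB with wA of degree 2 in A and wB of degree 2 in B.
  Expanding powers of w by the binomial theorem shows that the dimensions of A and B are even, that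
  wA and wB satisfy hard Lefschetz, and that the Riemann relations pass from w to wA and wB.
  Comparing components in the top power of wA gives D wA = 0. Hence the components of D that lower
  the degree in A commute with wA; such maps vanish by hard Lefschetz (the argument of Blanchard and
  Meier). So D preserves A and likewise B, and its eigenspaces are the required Hodge structures.
*)

theory Submission
  imports Defs
begin

section \<open>Tensor products and direct sums\<close>

text \<open>\<open>D\<close> packs a Hodge decomposition into one linear map: it is a derivation
  because \<open>p - q\<close> is additive under products, it kills \<open>w\<close> because
  \<open>w\<close> has type (1,1), and in a fixed degree its eigenvalues separate the Hodge pieces.
  Hence a \<open>D\<close>-stable subspace of one degree is the sum of its intersections with these
  pieces, and the point is to show that \<open>D\<close> maps A into A and B into B. The obstacle is
  that D(A^k) may have components in A^(k-j) tensor B^j with j > 0. An element of degree k killed by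
  wA^(r-k+1), where dim A = 2r, has zero component there, because that power of wA is already
  injective on A^(k-j). The condition on degree 1 is what leaves M^2 = A^2 + B^2, so that
  \<open>w\<close> has no mixed term. The passage between powers of \<open>w\<close> and of wA rests
  on one fact: with wA^(r+1) = 0 and wB^(r'+1) = 0, a binomial expansion at the critical exponent
  reduces to a single term. Both factors are realized as graded subalgebras of the complexification
  of M, so that exchanging them turns every statement on A into one on B.\<close>

definition bilinear_map ::
  "('f::field \<Rightarrow> 'v::ab_group_add \<Rightarrow> 'v) \<Rightarrow> ('f \<Rightarrow> 'w::ab_group_add \<Rightarrow> 'w) \<Rightarrow>
   ('f \<Rightarrow> 'u::ab_group_add \<Rightarrow> 'u) \<Rightarrow> ('v \<Rightarrow> 'w \<Rightarrow> 'u) \<Rightarrow> bool" where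
  "bilinear_map sV sW sU g \<longleftrightarrow>
     (\<forall>w. Vector_Spaces.linear sV sU (\<lambda>v. g v w)) \<and> (\<forall>v. Vector_Spaces.linear sW sU (g v))"

lemma
  assumes "bilinear_map sV sW sU g"
  shows bilinear_map_left: "Vector_Spaces.linear sV sU (\<lambda>v. g v w)"
    and bilinear_map_right: "Vector_Spaces.linear sW sU (\<lambda>w. g v w)"
  using assms by (simp_all add: bilinear_map_def)

lemma linearI:
  assumes "vector_space s1" "vector_space s2"
    and "\<And>x y. f (x + y) = f x + f y" "\<And>r x. f (s1 r x) = s2 r (f x)"
  shows "Vector_Spaces.linear s1 s2 f"
  using assms by (simp add: Vector_Spaces.linear_iff)

lemma
  assumes "Vector_Spaces.linear s1 s2 f"
  shows linear_dom: "vector_space s1"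
    and linear_cod: "vector_space s2"
    and linear_add: "f (x + y) = f x + f y"
    and linear_scale: "f (s1 r x) = s2 r (f x)"
    and linear_0: "f 0 = 0"
    and linear_minus: "f (- x) = - f x"
    and linear_diff: "f (x - y) = f x - f y"
    and linear_sum: "f (sum g A) = (\<Sum>i\<in>A. f (g i))"
proof -
  interpret Vector_Spaces.linear s1 s2 f by fact
  show "vector_space s1" "vector_space s2" "f (x + y) = f x + f y" "f (s1 r x) = s2 r (f x)"
    "f 0 = 0" "f (- x) = - f x" "f (x - y) = f x - f y" "f (sum g A) = (\<Sum>i\<in>A. f (g i))"
    by (fact vs1.vector_space_axioms vs2.vector_space_axioms add scale zero neg diff sum)+
qed

lemma linear_eq_on_span:
  assumes "Vector_Spaces.linear s1 s2 f" "Vector_Spaces.linear s1 s2 g"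
    and "x \<in> module.span s1 S" "\<And>y. y \<in> S \<Longrightarrow> f y = g y"
  shows "f x = g x"
proof -
  interpret f: Vector_Spaces.linear s1 s2 f by fact
  interpret g: Vector_Spaces.linear s1 s2 g by fact
  show ?thesis
    using assms(3)
    by (induction rule: f.vs1.span_induct_alt)
      (simp_all add: f.zero g.zero f.add g.add f.scale g.scale assms(4))
qed

lemma linear_image_span_subset:
  assumes "Vector_Spaces.linear s1 s2 f" "module.subspace s2 U"
    and "x \<in> module.span s1 S" "\<And>y. y \<in> S \<Longrightarrow> f y \<in> U"
  shows "f x \<in> U"
proof -
  interpret f: Vector_Spaces.linear s1 s2 f by fact
  show ?thesis
    using assms(3)
    by (induction rule: f.vs1.span_induct_alt)
      (simp_all add: f.zero f.add f.scale assms f.vs2.subspace_0 f.vs2.subspace_add f.vs2.subspace_scale)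
qed

lemma linear_compose:
  assumes "Vector_Spaces.linear s1 s2 f" "Vector_Spaces.linear s2 s3 g"
  shows "Vector_Spaces.linear s1 s3 (\<lambda>x. g (f x))"
  using assms by (simp add: Vector_Spaces.linear_iff)

lemma lookup_free_scale: "Poly_Mapping.lookup (free_scale r x) b = r * Poly_Mapping.lookup x b"
  by (simp add: free_scale_def Poly_Mapping.map.rep_eq when_def)

lemma vector_space_free: "vector_space (free_scale :: 'f::field \<Rightarrow> ('b \<Rightarrow>\<^sub>0 'f) \<Rightarrow> _)"
  by unfold_locales
    (rule poly_mapping_eqI; simp add: lookup_free_scale lookup_add algebra_simps)+

lemma linear_extension_superset:
  assumes "vector_space sT" "finite K" "Poly_Mapping.keys x \<subseteq> K"
  shows "linear_extension sT g x = (\<Sum>b\<in>K. sT (Poly_Mapping.lookup x b) (g b))"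
proof -
  interpret vector_space sT by fact
  show ?thesis
    unfolding linear_extension_def
    by (rule sum.mono_neutral_left) (use assms in \<open>auto simp: in_keys_iff\<close>)
qed

lemma linear_linear_extension:
  fixes sT :: "'f::field \<Rightarrow> 't::ab_group_add \<Rightarrow> 't" and g :: "'b \<Rightarrow> 't"
  assumes "vector_space sT"
  shows "Vector_Spaces.linear free_scale sT (linear_extension sT g)"
proof (rule linearI[OF vector_space_free assms])
  interpret vector_space sT by fact
  fix x y :: "'b \<Rightarrow>\<^sub>0 'f" and r
  let ?K = "Poly_Mapping.keys x \<union> Poly_Mapping.keys y"
  have *: "Poly_Mapping.keys (x + y) \<subseteq> ?K" by (rule keys_add)
  show "linear_extension sT g (x + y) = linear_extension sT g x + linear_extension sT g y"
    by (simp add: linear_extension_superset[OF assms, of ?K] * lookup_add scale_left_distrib sum.distrib)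
  have "Poly_Mapping.keys (free_scale r x) \<subseteq> Poly_Mapping.keys x"
    by (auto simp: in_keys_iff lookup_free_scale)
  then show "linear_extension sT g (free_scale r x) = sT r (linear_extension sT g x)"
    by (simp add: linear_extension_superset[OF assms, of "Poly_Mapping.keys x"] lookup_free_scale
        scale_sum_right)
qed

lemma linear_extension_gen:
  assumes "vector_space sT"
  shows "linear_extension sT g (free_gen b) = g b"
proof -
  interpret vector_space sT by fact
  show ?thesis by (simp add: linear_extension_def)
qed

lemma linear_extension_relations:
  assumes "bilinear_map sV sW sU g" "x \<in> bilinearity_relations sV sW"
  shows "linear_extension sU (\<lambda>(v, w). g v w) x = 0"
proof -
  have U: "vector_space sU"
    using assms(1) linear_cod unfolding bilinear_map_def by blast
  note L = linear_linear_extension[OF U, of "\<lambda>(v, w). g v w"]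
  note g = assms(1)[unfolded bilinear_map_def, THEN conjunct1, rule_format]
    assms(1)[unfolded bilinear_map_def, THEN conjunct2, rule_format]
  show ?thesis
    using assms(2) unfolding bilinearity_relations_def
    by (auto simp: linear_diff[OF L] linear_scale[OF L] linear_extension_gen[OF U]
        linear_add[OF g(1)] linear_add[OF g(2)] linear_scale[OF g(1)] linear_scale[OF g(2)])
qed

lemma tensor_product_bilinear:
  assumes "is_tensor_product sV sW sT t" "vector_space sV" "vector_space sW" "vector_space sT"
  shows "bilinear_map sV sW sT t"
proof -
  interpret free: vector_space "free_scale :: 'a \<Rightarrow> ('b \<times> 'c \<Rightarrow>\<^sub>0 'a) \<Rightarrow> _"
    by (rule vector_space_free)
  let ?t = "\<lambda>(v, w). t v w"
  note L = linear_linear_extension[OF assms(4), of ?t]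
  have rel: "linear_extension sT ?t x = 0" if "x \<in> bilinearity_relations sV sW" for x
    using assms(1) free.span_base[OF that] unfolding is_tensor_product_def by blast
  have "t (v + v') w = t v w + t v' w" for v v' w
  proof -
    have "free_gen (v + v', w) - free_gen (v, w) - free_gen (v', w) \<in> bilinearity_relations sV sW"
      unfolding bilinearity_relations_def by blast
    from rel[OF this] show ?thesis
      unfolding linear_diff[OF L] linear_extension_gen[OF assms(4)] by (simp add: algebra_simps)
  qed
  moreover have "t v (w + w') = t v w + t v w'" for v w w'
  proof -
    have "free_gen (v, w + w') - free_gen (v, w) - free_gen (v, w') \<in> bilinearity_relations sV sW"
      unfolding bilinearity_relations_def by blast
    from rel[OF this] show ?thesis
      unfolding linear_diff[OF L] linear_extension_gen[OF assms(4)] by (simp add: algebra_simps)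
  qed
  moreover have "t (sV r v) w = sT r (t v w)" for r v w
  proof -
    have "free_gen (sV r v, w) - free_scale r (free_gen (v, w)) \<in> bilinearity_relations sV sW"
      unfolding bilinearity_relations_def by blast
    from rel[OF this] show ?thesis
      unfolding linear_diff[OF L] linear_scale[OF L] linear_extension_gen[OF assms(4)] by simp
  qed
  moreover have "t v (sW r w) = sT r (t v w)" for r v w
  proof -
    have "free_gen (v, sW r w) - free_scale r (free_gen (v, w)) \<in> bilinearity_relations sV sW"
      unfolding bilinearity_relations_def by blast
    from rel[OF this] show ?thesis
      unfolding linear_diff[OF L] linear_scale[OF L] linear_extension_gen[OF assms(4)] by simp
  qed
  ultimately show ?thesis
    unfolding bilinear_map_def using assms by (auto intro!: linearI)
qed

lemma tensor_product_span:
  assumes "is_tensor_product sV sW sT t" "vector_space sT"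
  shows "x \<in> module.span sT {t v w | v w. True}"
proof -
  interpret vector_space sT by fact
  obtain y where "linear_extension sT (\<lambda>(v, w). t v w) y = x"
    using assms(1) unfolding is_tensor_product_def by (metis surjE)
  then have "x = (\<Sum>(v, w)\<in>Poly_Mapping.keys y. sT (Poly_Mapping.lookup y (v, w)) (t v w))"
    unfolding linear_extension_def by (simp add: split_beta)
  also have "\<dots> \<in> span {t v w | v w. True}"
    by (rule span_sum) (clarify, rule span_scale, rule span_base, blast)
  finally show ?thesis .
qed

text \<open>Each tensor is lifted to the free vector space and the linear extension of
  \<open>g\<close> is applied. Two lifts differ by an element of the span of the bilinearity
  relations, on which that extension vanishes, so the choice of lift is immaterial.\<close>

lemma tensor_product_universal:
  assumes "is_tensor_product sV sW sT t" "vector_space sT" "bilinear_map sV sW sU g"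
  obtains h where "Vector_Spaces.linear sT sU h" "\<And>v w. h (t v w) = g v w"
proof -
  have U: "vector_space sU"
    using assms(3) linear_cod unfolding bilinear_map_def by blast
  let ?t = "linear_extension sT (\<lambda>(v, w). t v w)" and ?g = "linear_extension sU (\<lambda>(v, w). g v w)"
  note Lt = linear_linear_extension[OF assms(2), of "\<lambda>(v, w). t v w"]
  note Lg = linear_linear_extension[OF U, of "\<lambda>(v, w). g v w"]
  define pre where "pre x = (SOME y. ?t y = x)" for x
  have pre: "?t (pre x) = x" for x
    unfolding pre_def by (rule someI_ex) (use assms(1) is_tensor_product_def surjD in metis)
  have wd: "?g y = ?g z" if "?t y = ?t z" for y z
  proof -
    have "?t (y - z) = 0" using that by (simp add: linear_diff[OF Lt])
    then have "y - z \<in> module.span free_scale (bilinearity_relations sV sW)"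
      using assms(1) unfolding is_tensor_product_def by blast
    moreover have "module.subspace sU {0}"
      using U by (simp add: module.subspace_single_0 module_iff_vector_space)
    ultimately have "?g (y - z) \<in> {0}"
      using linear_image_span_subset[OF Lg] linear_extension_relations[OF assms(3)] by blast
    then show ?thesis by (simp add: linear_diff[OF Lg])
  qed
  show ?thesis
  proof
    show "Vector_Spaces.linear sT sU (\<lambda>x. ?g (pre x))"
    proof (rule linearI[OF assms(2) U])
      show "?g (pre (x + y)) = ?g (pre x) + ?g (pre y)" for x y
        by (subst linear_add[OF Lg, symmetric], rule wd) (simp add: linear_add[OF Lt] pre)
      show "?g (pre (sT r x)) = sU r (?g (pre x))" for r x
        by (subst linear_scale[OF Lg, symmetric], rule wd) (simp add: linear_scale[OF Lt] pre)
    qed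
    show "?g (pre (t v w)) = g v w" for v w
    proof -
      have "?g (pre (t v w)) = ?g (free_gen (v, w))"
        by (rule wd) (simp add: pre linear_extension_gen[OF assms(2)])
      then show ?thesis by (simp add: linear_extension_gen[OF U])
    qed
  qed
qed

section \<open>Components with respect to an internal direct sum\<close>

definition is_decomposition :: "('i \<Rightarrow> 'v::ab_group_add set) \<Rightarrow> 'i set \<Rightarrow> ('i \<Rightarrow> 'v) \<Rightarrow> 'v \<Rightarrow> bool" where
  "is_decomposition W I f x \<longleftrightarrow> (\<forall>i\<in>I. f i \<in> W i) \<and> (\<forall>i. i \<notin> I \<longrightarrow> f i = 0) \<and>
     finite {i. f i \<noteq> 0} \<and> x = (\<Sum>i | f i \<noteq> 0. f i)"

definition component :: "('i \<Rightarrow> 'v::ab_group_add set) \<Rightarrow> 'i set \<Rightarrow> 'v \<Rightarrow> 'i \<Rightarrow> 'v" where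
  "component W I x = (THE f. is_decomposition W I f x)"

lemma internal_direct_sum_iff:
  "internal_direct_sum W I V \<longleftrightarrow> (\<forall>i\<in>I. W i \<subseteq> V) \<and> (\<forall>x\<in>V. \<exists>!f. is_decomposition W I f x)"
  unfolding internal_direct_sum_def is_decomposition_def ..

text \<open>Directness is left to \<open>direct_sum\<close>, so that this locale can be used while
  directness is still to be proved.\<close>

locale subspace_family = vector_space s
  for s :: "'f::field \<Rightarrow> 'v::ab_group_add \<Rightarrow> 'v" +
  fixes W :: "'i \<Rightarrow> 'v set" and I :: "'i set"
  assumes subspace_family: "i \<in> I \<Longrightarrow> subspace (W i)"
begin

lemma is_decompositionI:
  assumes "finite K" "\<And>i. i \<in> I \<Longrightarrow> f i \<in> W i" "\<And>i. i \<notin> I \<Longrightarrow> f i = 0"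
    "\<And>i. i \<notin> K \<Longrightarrow> f i = 0" "x = (\<Sum>i\<in>K. f i)"
  shows "is_decomposition W I f x"
proof -
  have "{i. f i \<noteq> 0} \<subseteq> K" using assms(4) by blast
  moreover from this have "(\<Sum>i | f i \<noteq> 0. f i) = (\<Sum>i\<in>K. f i)"
    using assms(1) by (intro sum.mono_neutral_left) auto
  ultimately show ?thesis
    unfolding is_decomposition_def using assms finite_subset[OF _ assms(1)] by simp
qed

lemma is_decomposition_eq_sum:
  assumes "is_decomposition W I f x" "finite K" "\<And>i. i \<notin> K \<Longrightarrow> f i = 0"
  shows "x = (\<Sum>i\<in>K. f i)"
proof -
  have "(\<Sum>i | f i \<noteq> 0. f i) = (\<Sum>i\<in>K. f i)"
    using assms(2,3) by (intro sum.mono_neutral_left) auto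
  then show ?thesis using assms(1) unfolding is_decomposition_def by simp
qed

lemma is_decomposition_add:
  assumes "is_decomposition W I f x" "is_decomposition W I g y"
  shows "is_decomposition W I (\<lambda>i. f i + g i) (x + y)"
proof -
  define K where "K = {i. f i \<noteq> 0} \<union> {i. g i \<noteq> 0}"
  have K: "finite K"
    using assms unfolding K_def is_decomposition_def by blast
  show ?thesis
  proof (rule is_decompositionI[OF K])
    show "x + y = (\<Sum>i\<in>K. f i + g i)"
      using is_decomposition_eq_sum[OF assms(1) K] is_decomposition_eq_sum[OF assms(2) K]
      by (simp add: K_def sum.distrib)
    show "f i + g i \<in> W i" if "i \<in> I" for i
      using assms that subspace_add[OF subspace_family] unfolding is_decomposition_def by blast
    show "f i + g i = 0" if "i \<notin> I" for i
      using assms that unfolding is_decomposition_def by simp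
  qed (simp add: K_def)
qed

lemma is_decomposition_scale:
  assumes "is_decomposition W I f x"
  shows "is_decomposition W I (\<lambda>i. s r (f i)) (s r x)"
proof -
  define K where "K = {i. f i \<noteq> 0}"
  have K: "finite K"
    using assms unfolding K_def is_decomposition_def by blast
  show ?thesis
  proof (rule is_decompositionI[OF K])
    show "s r x = (\<Sum>i\<in>K. s r (f i))"
      using is_decomposition_eq_sum[OF assms K] by (simp add: K_def scale_sum_right)
    show "s r (f i) \<in> W i" if "i \<in> I" for i
      using assms that subspace_scale[OF subspace_family] unfolding is_decomposition_def by blast
    show "s r (f i) = 0" if "i \<notin> I" for i
      using assms that unfolding is_decomposition_def by simp
  qed (simp add: K_def)
qed

lemma is_decomposition_single:
  assumes "i \<in> I" "x \<in> W i"
  shows "is_decomposition W I (\<lambda>j. if j = i then x else 0) x"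
  by (rule is_decompositionI[of "{i}"])
    (use assms subspace_0[OF subspace_family] in auto)

lemma is_decomposition_zero: "is_decomposition W I (\<lambda>_. 0) 0"
  by (rule is_decompositionI[of "{}"]) (use subspace_0[OF subspace_family] in auto)

lemma is_decomposition_exists_sum:
  assumes "\<And>k. k \<in> K \<Longrightarrow> \<exists>f. is_decomposition W I f (x k)"
  shows "\<exists>f. is_decomposition W I f (\<Sum>k\<in>K. x k)"
  using assms
proof (induction K rule: infinite_finite_induct)
  case (insert k K)
  then show ?case by simp (blast intro: is_decomposition_add)
qed (auto intro: is_decomposition_zero)

text \<open>Uniqueness is asked only for decompositions of 0, since the difference of two
  decompositions of \<open>x\<close> is one of these.\<close>

lemma internal_direct_sumI:
  assumes "\<And>i. i \<in> I \<Longrightarrow> W i \<subseteq> V" "\<And>x. x \<in> V \<Longrightarrow> \<exists>f. is_decomposition W I f x"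
    "\<And>f i. is_decomposition W I f 0 \<Longrightarrow> f i = 0"
  shows "internal_direct_sum W I V"
proof -
  have "f = g" if "is_decomposition W I f x" "is_decomposition W I g x" for f g x
  proof
    fix i
    have "is_decomposition W I (\<lambda>i. f i + s (- 1) (g i)) (x + s (- 1) x)"
      by (intro is_decomposition_add is_decomposition_scale that)
    then have "f i + s (- 1) (g i) = 0"
      using assms(3)[of "\<lambda>i. f i + s (- 1) (g i)" i] by simp
    then show "f i = g i" by simp
  qed
  then show ?thesis
    unfolding internal_direct_sum_iff by (metis assms(1,2))
qed

end

locale direct_sum = subspace_family s W I
  for s :: "'f::field \<Rightarrow> 'v::ab_group_add \<Rightarrow> 'v" and W :: "'i \<Rightarrow> 'v set" and I +
  fixes V :: "'v set"
  assumes subspace_V: "subspace V"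
    and internal: "internal_direct_sum W I V"
begin

lemma W_subset: "i \<in> I \<Longrightarrow> W i \<subseteq> V"
  using internal unfolding internal_direct_sum_iff by blast

lemma is_decomposition_component: "x \<in> V \<Longrightarrow> is_decomposition W I (component W I x) x"
  unfolding component_def
  by (rule theI'[of "\<lambda>f. is_decomposition W I f x"]) (use internal in \<open>simp add: internal_direct_sum_iff\<close>)

lemma component_eqI: "x \<in> V \<Longrightarrow> is_decomposition W I f x \<Longrightarrow> component W I x = f"
  unfolding component_def
  by (rule the1_equality) (use internal in \<open>simp_all add: internal_direct_sum_iff\<close>)

lemma component_add:
  assumes "x \<in> V" "y \<in> V"
  shows "component W I (x + y) i = component W I x i + component W I y i"
  by (subst component_eqI[OF subspace_add[OF subspace_V assms]
        is_decomposition_add[OF is_decomposition_component[OF assms(1)] is_decomposition_component[OF assms(2)]]]) simp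

lemma component_scale:
  assumes "x \<in> V"
  shows "component W I (s r x) i = s r (component W I x i)"
  by (subst component_eqI[OF subspace_scale[OF subspace_V assms]
        is_decomposition_scale[OF is_decomposition_component[OF assms]]]) simp

lemma component_of:
  assumes "i \<in> I" "x \<in> W i"
  shows "component W I x j = (if j = i then x else 0)"
  using component_eqI[OF subsetD[OF W_subset[OF assms(1)] assms(2)] is_decomposition_single[OF assms]]
  by simp

lemma component_mem: "x \<in> V \<Longrightarrow> i \<in> I \<Longrightarrow> component W I x i \<in> W i"
  by (rule is_decomposition_component[unfolded is_decomposition_def, THEN conjunct1, rule_format])

lemma component_outside: "x \<in> V \<Longrightarrow> i \<notin> I \<Longrightarrow> component W I x i = 0"
  by (rule is_decomposition_component[unfolded is_decomposition_def, THEN conjunct2, THEN conjunct1, rule_format])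

lemma finite_component: "x \<in> V \<Longrightarrow> finite {i. component W I x i \<noteq> 0}"
  by (rule is_decomposition_component[unfolded is_decomposition_def, THEN conjunct2, THEN conjunct2, THEN conjunct1])

lemma sum_component: "x \<in> V \<Longrightarrow> x = (\<Sum>i | component W I x i \<noteq> 0. component W I x i)"
  by (rule is_decomposition_component[unfolded is_decomposition_def, THEN conjunct2, THEN conjunct2, THEN conjunct2])

lemma sum_component_superset:
  "x \<in> V \<Longrightarrow> finite K \<Longrightarrow> (\<And>i. i \<notin> K \<Longrightarrow> component W I x i = 0) \<Longrightarrow> x = (\<Sum>i\<in>K. component W I x i)"
  by (rule is_decomposition_eq_sum[OF is_decomposition_component])

lemma is_decomposition_unique_zero: "is_decomposition W I f 0 \<Longrightarrow> f i = 0"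
  using component_eqI[OF subspace_0[OF subspace_V], of f]
    component_eqI[OF subspace_0[OF subspace_V] is_decomposition_zero] by (simp add: fun_eq_iff)

lemma direct_sum_induct [consumes 1, case_names zero add mem]:
  assumes "x \<in> V" "P 0" "\<And>x y. P x \<Longrightarrow> P y \<Longrightarrow> P (x + y)" "\<And>i x. i \<in> I \<Longrightarrow> x \<in> W i \<Longrightarrow> P x"
  shows "P x"
proof -
  have "P (component W I x i)" for i
  proof (cases "i \<in> I")
    case True
    show ?thesis by (rule assms(4)[OF True component_mem[OF assms(1) True]])
  next
    case False
    then show ?thesis using assms(2) by (simp add: component_outside[OF assms(1)])
  qed
  then have "P (\<Sum>i\<in>K. component W I x i)" for K
    by (induction K rule: infinite_finite_induct) (auto intro: assms(2,3))
  from this[of "{i. component W I x i \<noteq> 0}"] show ?thesis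
    unfolding sum_component[OF assms(1), symmetric] .
qed

end

section \<open>Complexification\<close>

lemma to_complex_add [simp]: "to_complex (x + y) = to_complex x + to_complex y"
  by (simp add: to_complex_def to_real_add)

lemma to_complex_mult [simp]: "to_complex (x * y) = to_complex x * to_complex y"
  by (simp add: to_complex_def to_real_mult)

lemma to_complex_1 [simp]: "to_complex 1 = 1"
  by (simp add: to_complex_def to_real_one)

lemma cnj_to_complex [simp]: "cnj (to_complex x) = to_complex x"
  by (simp add: to_complex_def)

lemma vector_space_restrict:
  assumes "vector_space sU"
  shows "vector_space (\<lambda>r. sU (to_complex r))"
proof -
  interpret vector_space sU by fact
  show ?thesis
    by unfold_locales (simp_all add: scale_right_distrib scale_left_distrib)
qed

lemma vector_space_complex: "vector_space ((*) :: complex \<Rightarrow> complex \<Rightarrow> complex)"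
  by unfold_locales (simp_all add: algebra_simps)

lemma linear_restrict:
  assumes "Vector_Spaces.linear s1 s2 f"
  shows "Vector_Spaces.linear (\<lambda>r. s1 (to_complex r)) (\<lambda>r. s2 (to_complex r)) f"
  by (rule linearI[OF vector_space_restrict[OF linear_dom[OF assms]] vector_space_restrict[OF linear_cod[OF assms]]])
    (simp_all add: linear_add[OF assms] linear_scale[OF assms])

locale complexification = F: vector_space s
  for s :: "'f::rational_or_real_field \<Rightarrow> 'a::ring_1 \<Rightarrow> 'a" +
  fixes sC :: "complex \<Rightarrow> 'ac::ring_1 \<Rightarrow> 'ac" and c :: "'a \<Rightarrow> 'ac"
  assumes complexification: "is_complexification s sC c"
begin

lemma vector_space_sC: "vector_space sC"
  using complexification unfolding is_complexification_def by (elim conjE)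

sublocale C: vector_space sC by (rule vector_space_sC)

lemma mult_scale: "sC z x * y = sC z (x * y)" "x * sC z y = sC z (x * y)"
  using complexification unfolding is_complexification_def by simp_all

lemma c_1: "c 1 = 1" and c_mult: "c (a * b) = c a * c b"
  using complexification unfolding is_complexification_def by simp_all

lemma tensor:
  "is_tensor_product s (\<lambda>r z. to_complex r * z) (\<lambda>r :: 'f. sC (to_complex r)) (\<lambda>a z. sC z (c a))"
  using complexification unfolding is_complexification_def by (elim conjE)

lemma linear_c: "Vector_Spaces.linear s (\<lambda>r :: 'f. sC (to_complex r)) c"
proof -
  have "bilinear_map s (\<lambda>r z. to_complex r * z) (\<lambda>r :: 'f. sC (to_complex r)) (\<lambda>a z. sC z (c a))"
    by (rule tensor_product_bilinear[OF tensor F.vector_space_axioms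
          vector_space_restrict[OF vector_space_complex] vector_space_restrict[OF vector_space_sC]])
  then have "Vector_Spaces.linear s (\<lambda>r :: 'f. sC (to_complex r)) (\<lambda>a. sC 1 (c a))"
    unfolding bilinear_map_def by (elim conjE allE)
  then show ?thesis by simp
qed

text \<open>The twist \<open>\<tau>\<close> is the identity for complex linear extensions and \<^const>\<open>cnj\<close> for the conjugation.\<close>

lemma semilinear_extension:
  assumes f: "Vector_Spaces.linear s (\<lambda>r :: 'f. sU (to_complex r)) f" and U: "vector_space sU"
    and \<tau>: "\<And>z w. \<tau> (z + w) = \<tau> z + \<tau> w" "\<And>z w. \<tau> (z * w) = \<tau> z * \<tau> w"
      "\<And>r :: 'f. \<tau> (to_complex r) = to_complex r"
  obtains h where "\<And>x y. h (x + y) = h x + h y" "\<And>z x. h (sC z x) = sU (\<tau> z) (h x)"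
    "\<And>a. h (c a) = f a"
proof -
  interpret U: vector_space sU by fact
  have "bilinear_map s (\<lambda>r z. to_complex r * z) (\<lambda>r :: 'f. sU (to_complex r)) (\<lambda>a z. sU (\<tau> z) (f a))"
    unfolding bilinear_map_def
    by (auto intro!: linearI F.vector_space_axioms vector_space_restrict[OF vector_space_complex]
        vector_space_restrict[OF U]
        simp: linear_add[OF f] linear_scale[OF f] U.scale_right_distrib U.scale_left_distrib \<tau> ac_simps)
  then obtain h where h: "Vector_Spaces.linear (\<lambda>r :: 'f. sC (to_complex r)) (\<lambda>r :: 'f. sU (to_complex r)) h"
    and hc: "\<And>a z. h (sC z (c a)) = sU (\<tau> z) (f a)"
    by (rule tensor_product_universal[OF tensor vector_space_restrict[OF vector_space_sC]]) (rule that)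
  have \<tau>1: "\<tau> 1 = 1" using \<tau>(3)[of 1] by simp
  show ?thesis
  proof
    show "h (x + y) = h x + h y" for x y by (rule linear_add[OF h])
    show "h (c a) = f a" for a using hc[of 1 a] by (simp add: \<tau>1)
    \<comment> \<open>For fixed \<open>z\<close> both sides of the claim are linear over the small
      field in \<open>x\<close>, even if \<open>\<tau>\<close> is not the identity, so comparing
      them on the tensors \<open>sC w (c a)\<close> is enough.\<close>
    have L1: "Vector_Spaces.linear (\<lambda>r :: 'f. sC (to_complex r)) (\<lambda>r :: 'f. sU (to_complex r)) (\<lambda>x. h (sC z x))" for z
      by (rule linearI[OF linear_dom[OF h] linear_cod[OF h]])
        (simp_all add: C.scale_right_distrib linear_add[OF h] flip: linear_scale[OF h], simp add: mult.commute)
    have L2: "Vector_Spaces.linear (\<lambda>r :: 'f. sC (to_complex r)) (\<lambda>r :: 'f. sU (to_complex r)) (\<lambda>x. sU (\<tau> z) (h x))" for z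
      by (rule linearI[OF linear_dom[OF h] linear_cod[OF h]])
        (simp_all add: U.scale_right_distrib linear_add[OF h] linear_scale[OF h] mult.commute)
    show "h (sC z x) = sU (\<tau> z) (h x)" for z x
    proof (rule linear_eq_on_span[OF L1 L2 tensor_product_span[OF tensor linear_dom[OF h]]])
      fix y assume "y \<in> {sC w (c a) |a w. True}"
      then obtain a w where y: "y = sC w (c a)" by blast
      show "h (sC z y) = sU (\<tau> z) (h y)" unfolding y hc by (simp add: hc \<tau>)
    qed
  qed
qed

lemma complex_linear_extension:
  assumes "Vector_Spaces.linear s (\<lambda>r :: 'f. sU (to_complex r)) f" "vector_space sU"
  obtains h where "Vector_Spaces.linear sC sU h" "\<And>a. h (c a) = f a"
proof -
  obtain h where "\<And>x y. h (x + y) = h x + h y" "\<And>z x. h (sC z x) = sU z (h x)"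
    "\<And>a. h (c a) = f a"
    by (rule semilinear_extension[OF assms, of "\<lambda>z. z"]) (simp, simp, simp, rule that)
  then show ?thesis by (intro that[of h] linearI[OF vector_space_sC assms(2)])
qed

lemma span_range_c: "x \<in> C.span (range c)"
proof -
  interpret R: vector_space "\<lambda>r :: 'f. sC (to_complex r)"
    by (rule vector_space_restrict[OF vector_space_sC])
  have "R.subspace (C.span (range c))"
    by (intro R.subspaceI) (simp_all add: C.span_zero C.span_add C.span_scale)
  moreover have "{sC z (c a) |a z. True} \<subseteq> C.span (range c)"
    by clarify (rule C.span_scale, rule C.span_base, rule rangeI)
  ultimately have "R.span {sC z (c a) |a z. True} \<subseteq> C.span (range c)"
    by (rule R.span_minimal[rotated])
  then show ?thesis
    by (rule subsetD) (rule tensor_product_span[OF tensor vector_space_restrict[OF vector_space_sC]])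
qed

text \<open>A nonzero \<open>a\<close> has a linear functional with value 1 at \<open>a\<close>; its
  complex extension has value 1 at \<open>c a\<close>.\<close>

lemma c_eq_0:
  assumes "c a = 0"
  shows "a = 0"
proof (rule ccontr)
  assume "a \<noteq> 0"
  have pair: "vector_space_pair s ((*) :: 'f \<Rightarrow> 'f \<Rightarrow> 'f)"
    by unfold_locales (simp_all add: algebra_simps)
  have "F.independent {a}" using \<open>a \<noteq> 0\<close> by (simp add: F.independent_insert)
  from vector_space_pair.linear_independent_extend[OF pair this, of "\<lambda>_. 1"]
  obtain g where g: "Vector_Spaces.linear s (*) g" "g a = 1" by auto
  have "Vector_Spaces.linear s (\<lambda>r. (*) (to_complex r)) (\<lambda>a. to_complex (g a))"
    by (rule linearI[OF F.vector_space_axioms vector_space_restrict[OF vector_space_complex]])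
      (simp_all add: linear_add[OF g(1)] linear_scale[OF g(1)])
  then obtain h where h: "Vector_Spaces.linear sC (*) h" "\<And>a. h (c a) = to_complex (g a)"
    by (rule complex_linear_extension[OF _ vector_space_complex]) (rule that)
  show False using h(2)[of a] assms g(2) linear_0[OF h(1)] by simp
qed

abbreviation "\<sigma> \<equiv> conjugation sC c"

text \<open>The elements \<open>sC z (c a)\<close> generate additively. Asking only for additivity
  makes the criterion apply to conjugate-linear maps as well.\<close>

lemma additive_eq:
  assumes "\<And>x y. f (x + y) = f x + f y" "\<And>x y. g (x + y) = g x + g y"
    and "\<And>z a. f (sC z (c a)) = g (sC z (c a))"
  shows "f x = (g x :: 'b::ab_group_add)"
  using span_range_c[of x]
proof (induction rule: C.span_induct_alt)
  case base
  have "f 0 = f 0 + f 0" "g 0 = g 0 + g 0" by (simp_all flip: assms(1,2))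
  then show ?case by simp
next
  case (step z x y)
  then show ?case using assms by auto
qed

text \<open>Resolves the definite description in \<open>conjugation\<close>: existence is the
  semilinear extension of \<open>c\<close> with twist \<open>cnj\<close>, uniqueness is
  \<open>additive_eq\<close>.\<close>

lemma
  shows conj_add: "\<sigma> (x + y) = \<sigma> x + \<sigma> y"
    and conj_scale: "\<sigma> (sC z x) = sC (cnj z) (\<sigma> x)"
    and conj_c: "\<sigma> (c a) = c a"
proof -
  obtain h where h: "\<And>x y. h (x + y) = h x + h y" "\<And>z x. h (sC z x) = sC (cnj z) (h x)" "\<And>a. h (c a) = c a"
    by (rule semilinear_extension[OF linear_c vector_space_sC, of cnj]) (simp, simp, simp, rule that)
  have "\<sigma> = h"
    unfolding conjugation_def
  proof (rule the_equality)
    show "(\<forall>x y. h (x + y) = h x + h y) \<and> (\<forall>z a. h (sC z (c a)) = sC (cnj z) (c a))"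
      by (simp add: h)
    show "k = h" if "(\<forall>x y. k (x + y) = k x + k y) \<and> (\<forall>z a. k (sC z (c a)) = sC (cnj z) (c a))" for k
      using additive_eq[of k h] that by (auto simp: h)
  qed
  then show "\<sigma> (x + y) = \<sigma> x + \<sigma> y" "\<sigma> (sC z x) = sC (cnj z) (\<sigma> x)" "\<sigma> (c a) = c a"
    by (simp_all add: h)
qed

lemma conj_0: "\<sigma> 0 = 0"
  using conj_add[of 0 0] by simp

lemma conj_conj: "\<sigma> (\<sigma> x) = x"
  by (rule additive_eq) (simp_all add: conj_add conj_scale conj_c)

lemma conj_mult: "\<sigma> (x * y) = \<sigma> x * \<sigma> y"
proof -
  have *: "\<sigma> (c a * y) = c a * \<sigma> y" for a
    by (rule additive_eq)
      (simp_all add: conj_add distrib_left mult_scale conj_scale conj_c flip: c_mult)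
  show ?thesis
    by (rule additive_eq[of "\<lambda>x. \<sigma> (x * y)" "\<lambda>x. \<sigma> x * \<sigma> y"])
      (simp_all add: * conj_add distrib_right mult_scale conj_scale conj_c)
qed

abbreviation cp :: "'a set \<Rightarrow> 'ac set" where "cp \<equiv> complex_part sC c"

lemma subspace_cp: "C.subspace (cp V)"
  unfolding complex_part_def by (rule C.subspace_span)

lemma c_in_cp: "a \<in> V \<Longrightarrow> c a \<in> cp V"
  unfolding complex_part_def by (rule C.span_base) (rule imageI)

lemma conj_cp:
  assumes "x \<in> cp V"
  shows "\<sigma> x \<in> cp V"
  using assms unfolding complex_part_def
proof (induction rule: C.span_induct_alt)
  case base
  then show ?case by (simp only: conj_0 C.span_zero)
next
  case (step z x y)
  then show ?case
    by (auto simp: conj_add conj_scale conj_c intro!: C.span_add C.span_scale intro: C.span_base)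
qed

lemma real_part_eq: "real_part sC c V = {x \<in> cp V. \<sigma> x = x}"
proof -
  interpret R: vector_space "\<lambda>r. sC (complex_of_real r)"
    by unfold_locales (simp_all add: C.scale_right_distrib C.scale_left_distrib)
  have "x \<in> cp V \<and> \<sigma> x = x" if "x \<in> R.span (c ` V)" for x
    using that
  proof (induction rule: R.span_induct_alt)
    case base
    then show ?case by (simp add: conj_0 C.subspace_0[OF subspace_cp])
  next
    case (step r x y)
    then show ?case
      by (auto simp: conj_add conj_scale conj_c
          intro!: C.subspace_add[OF subspace_cp] C.subspace_scale[OF subspace_cp] c_in_cp)
  qed
  moreover have "x \<in> R.span (c ` V)" if "x \<in> cp V" "\<sigma> x = x" for x
  proof -
    have "x + \<sigma> x \<in> R.span (c ` V)"
      using that(1) unfolding complex_part_def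
    proof (induction rule: C.span_induct_alt)
      case base
      then show ?case by (simp add: conj_0 R.span_zero)
    next
      case (step z x y)
      then obtain a where a: "x = c a" "a \<in> V" by blast
      have "sC z x + y + \<sigma> (sC z x + y) = sC (complex_of_real (2 * Re z)) x + (y + \<sigma> y)"
        unfolding complex_add_cnj[symmetric] C.scale_left_distrib
        by (simp add: a conj_add conj_scale conj_c)
      also have "\<dots> \<in> R.span (c ` V)"
        by (intro R.span_add step.IH R.span_scale R.span_base step.hyps)
      finally show ?case .
    qed
    then have "sC (complex_of_real (1/2)) (x + x) \<in> R.span (c ` V)"
      unfolding that(2) by (rule R.span_scale)
    also have "sC (complex_of_real (1/2)) (x + x) = x"
      by (simp add: C.scale_right_distrib flip: C.scale_left_distrib)
    finally show ?thesis .
  qed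
  ultimately show ?thesis unfolding real_part_def by blast
qed

lemma cp_eq_0: "cp {0} = {0}"
  unfolding complex_part_def by (simp add: linear_0[OF linear_c])

end

section \<open>The complexified cohomology algebra and its degree projections\<close>

locale complex_cohomology_algebra = cohomology_algebra s G m + complexification s sC c
  for s :: "'f::rational_or_real_field \<Rightarrow> 'a::ring_1 \<Rightarrow> 'a" and G :: "int \<Rightarrow> 'a set" and m :: int
    and sC :: "complex \<Rightarrow> 'ac::ring_1 \<Rightarrow> 'ac" and c :: "'a \<Rightarrow> 'ac"
begin

text \<open>Duality represents the zero map on \<open>G (m - i)\<close> by a unique element of
  \<open>G i\<close>. As \<open>G (m - i)\<close> is zero, every element of \<open>G i\<close>
  represents it.\<close>

lemma G_outside:
  assumes "i > m"
  shows "G i = {0}"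
proof -
  have "x = 0" if "x \<in> G i" for x
  proof -
    have "Vector_Spaces.linear s s (\<lambda>_. 0)"
      by (rule linearI[OF vector_space_axioms vector_space_axioms]) simp_all
    moreover have "(\<lambda>_. 0) ` G (m - i) \<subseteq> G m"
      using subspace_0[OF subspace_graded] by (simp add: image_subset_iff)
    ultimately have "\<exists>!x. x \<in> G i \<and> (\<forall>y\<in>G (m - i). 0 = x * y)"
      using poincare_duality[of i, unfolded perfect_pairing_def, THEN conjunct1, rule_format, of "\<lambda>_. 0"]
      by (elim meta_mp) (rule conjI)
    moreover have "G (m - i) = {0}" using assms by (intro graded_negative) simp
    ultimately have "\<exists>!x. x \<in> G i" by simp
    then show ?thesis using that subspace_0[OF subspace_graded[of i]] by (metis (full_types))
  qed
  then show ?thesis using subspace_0[OF subspace_graded[of i]] by blast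
qed

lemma G_top: "\<exists>e. e \<noteq> 0 \<and> G m = range (\<lambda>r. s r e)"
proof -
  obtain f where f: "Vector_Spaces.linear (*) s f" "bij_betw f UNIV (G m)"
    using graded_top by blast
  have *: "f r = s r (f 1)" for r using linear_scale[OF f(1), of r 1] by simp
  have "inj f" using f(2) by (rule bij_betw_imp_inj_on)
  then have "f 1 \<noteq> 0" using linear_0[OF f(1)] by (metis injD zero_neq_one)
  moreover have "G m = range (\<lambda>r. s r (f 1))"
    using bij_betw_imp_surj_on[OF f(2)] * by (metis (no_types, lifting) image_cong)
  ultimately show ?thesis by blast
qed

lemma dim_nonneg: "0 \<le> m"
proof (rule ccontr)
  obtain e where "e \<noteq> 0" "e \<in> G m" using G_top by (metis rangeI scale_one)
  moreover assume "\<not> 0 \<le> m"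
  ultimately show False using graded_negative[of m] by simp
qed

sublocale grading: direct_sum s G UNIV UNIV
  by unfold_locales (simp_all add: subspace_graded direct_sum_graded)

lemma linear_component: "Vector_Spaces.linear s s (\<lambda>x. component G UNIV x i)"
  by (rule linearI[OF vector_space_axioms vector_space_axioms])
    (simp_all add: grading.component_add grading.component_scale)

text \<open>Complexified degree projections. With \<open>proj_cp\<close>, \<open>proj_in_cp\<close>
  and \<open>sum_proj\<close> they provide what a direct sum decomposition into the
  \<open>cp (G i)\<close> would give.\<close>

definition proj :: "int \<Rightarrow> 'ac \<Rightarrow> 'ac" where
  "proj i = (SOME h. Vector_Spaces.linear sC sC h \<and> (\<forall>a. h (c a) = c (component G UNIV a i)))"

lemma linear_proj: "Vector_Spaces.linear sC sC (proj i)"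
  and proj_c: "proj i (c a) = c (component G UNIV a i)"
proof -
  obtain h where "Vector_Spaces.linear sC sC h" "\<And>a. h (c a) = c (component G UNIV a i)"
    by (rule complex_linear_extension[OF linear_compose[OF linear_component linear_c] vector_space_sC])
      (rule that)
  then have "\<exists>h. Vector_Spaces.linear sC sC h \<and> (\<forall>a. h (c a) = c (component G UNIV a i))" by auto
  from someI_ex[OF this] show "Vector_Spaces.linear sC sC (proj i)"
    "proj i (c a) = c (component G UNIV a i)" unfolding proj_def by simp_all
qed

lemma proj_cp:
  assumes "x \<in> cp (G j)"
  shows "proj i x = (if i = j then x else 0)"
proof -
  have L: "Vector_Spaces.linear sC sC (\<lambda>x. if i = j then x else 0)"
    by (rule linearI[OF vector_space_sC vector_space_sC]) simp_all
  show ?thesis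
  proof (rule linear_eq_on_span[OF linear_proj L assms[unfolded complex_part_def]])
    fix y assume "y \<in> c ` G j"
    then obtain a where "y = c a" "a \<in> G j" by blast
    then show "proj i y = (if i = j then y else 0)"
      by (simp add: proj_c grading.component_of linear_0[OF linear_c])
  qed
qed

lemma proj_in_cp: "proj i x \<in> cp (G i)"
proof (rule linear_image_span_subset[OF linear_proj subspace_cp span_range_c])
  fix y assume "y \<in> range c"
  then show "proj i y \<in> cp (G i)"
    using c_in_cp[OF grading.component_mem] by (auto simp: proj_c)
qed

lemma sum_proj: "x = (\<Sum>i\<in>{0..m}. proj i x)"
proof -
  have L: "Vector_Spaces.linear sC sC (\<lambda>x. \<Sum>i\<in>{0..m}. proj i x)"
    by (rule linearI[OF vector_space_sC vector_space_sC])
      (simp_all add: linear_add[OF linear_proj] linear_scale[OF linear_proj] sum.distrib C.scale_sum_right)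
  have id: "Vector_Spaces.linear sC sC (\<lambda>x. x)" by (rule C.linear_ident)
  show ?thesis
  proof (rule linear_eq_on_span[OF id L span_range_c])
    fix y assume "y \<in> range c"
    then obtain a where y: "y = c a" by blast
    have "component G UNIV a i = 0" if "i \<notin> {0..m}" for i
      using grading.component_mem[of a i] graded_negative[of i] G_outside[of i] that by auto
    then have "a = (\<Sum>i\<in>{0..m}. component G UNIV a i)"
      by (intro grading.sum_component_superset) simp_all
    then have "c a = (\<Sum>i\<in>{0..m}. c (component G UNIV a i))"
      by (metis (no_types) linear_sum[OF linear_c])
    then show "y = (\<Sum>i\<in>{0..m}. proj i y)" unfolding y proj_c .
  qed
qed

lemma linear_mult_left: "Vector_Spaces.linear sC sC (\<lambda>x. u * x)"
  by (rule linearI[OF vector_space_sC vector_space_sC]) (simp_all add: distrib_left mult_scale)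

lemma linear_mult_right: "Vector_Spaces.linear sC sC (\<lambda>x. x * u)"
  by (rule linearI[OF vector_space_sC vector_space_sC]) (simp_all add: distrib_right mult_scale)

lemma cp_mult:
  assumes "x \<in> cp (G i)" "y \<in> cp (G j)"
  shows "x * y \<in> cp (G (i + j))"
proof (rule linear_image_span_subset[OF linear_mult_right subspace_cp assms(1)[unfolded complex_part_def]])
  fix x assume "x \<in> c ` G i"
  then obtain a where a: "x = c a" "a \<in> G i" by blast
  show "x * y \<in> cp (G (i + j))"
  proof (rule linear_image_span_subset[OF linear_mult_left subspace_cp assms(2)[unfolded complex_part_def]])
    fix y assume "y \<in> c ` G j"
    then obtain b where b: "y = c b" "b \<in> G j" by blast
    show "x * y \<in> cp (G (i + j))"
      unfolding a(1) b(1) c_mult[symmetric] by (rule c_in_cp[OF mult_graded[OF a(2) b(2)]])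
  qed
qed

lemma cp_commute:
  assumes "x \<in> cp (G i)" "y \<in> cp (G j)"
  shows "x * y = (if odd (i * j) then - (y * x) else y * x)"
proof -
  \<comment> \<open>Written as a scalar, the sign leaves both sides linear in each variable, so that
    the identity can be reduced to elements of the original algebra.\<close>
  define \<epsilon> :: complex where "\<epsilon> = (if odd (i * j) then - 1 else 1)"
  have L: "Vector_Spaces.linear sC sC (\<lambda>x. sC \<epsilon> (x * u))"
    "Vector_Spaces.linear sC sC (\<lambda>x. sC \<epsilon> (u * x))" for u
    by (rule linear_compose[OF linear_mult_right C.linear_scale_self]
        linear_compose[OF linear_mult_left C.linear_scale_self])+
  have "x * y = sC \<epsilon> (y * x)"
  proof (rule linear_eq_on_span[OF linear_mult_right L(2) assms(1)[unfolded complex_part_def]])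
    fix x assume "x \<in> c ` G i"
    then obtain a where a: "x = c a" "a \<in> G i" by blast
    show "x * y = sC \<epsilon> (y * x)"
    proof (rule linear_eq_on_span[OF linear_mult_left L(1) assms(2)[unfolded complex_part_def]])
      fix y assume "y \<in> c ` G j"
      then obtain b where b: "y = c b" "b \<in> G j" by blast
      have "c (- u) = - c u" for u by (rule linear_minus[OF linear_c])
      then show "x * y = sC \<epsilon> (y * x)"
        using graded_commutative[OF a(2) b(2)] unfolding a(1) b(1) c_mult[symmetric] \<epsilon>_def
        by (simp split: if_splits)
    qed
  qed
  then show ?thesis by (simp add: \<epsilon>_def)
qed

lemma cp_line: "cp (range (\<lambda>r. s r e)) = range (\<lambda>z. sC z (c e))"
proof
  show "cp (range (\<lambda>r. s r e)) \<subseteq> range (\<lambda>z. sC z (c e))"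
    unfolding complex_part_def C.span_singleton[symmetric]
  proof (rule C.span_minimal[OF _ C.subspace_span], clarify)
    fix r show "c (s r e) \<in> C.span {c e}"
      unfolding linear_scale[OF linear_c] by (rule C.span_scale, rule C.span_base) simp
  qed
  have "e \<in> range (\<lambda>r. s r e)" by (rule range_eqI[of _ _ 1]) simp
  then show "range (\<lambda>z. sC z (c e)) \<subseteq> cp (range (\<lambda>r. s r e))"
    by (auto intro!: C.subspace_scale[OF subspace_cp] c_in_cp)
qed

lemma cp_0: "cp (G 0) = range (\<lambda>z. sC z 1)"
  unfolding graded_zero cp_line c_1 ..

lemma cp_outside: "i < 0 \<or> i > m \<Longrightarrow> cp (G i) = {0}"
  using graded_negative[of i] G_outside[of i] cp_eq_0 by auto

lemma cp_top: "\<exists>e. e \<noteq> 0 \<and> cp (G m) = range (\<lambda>z. sC z e)"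
  using G_top c_eq_0 cp_line by metis

end

section \<open>The complexified tensor product\<close>

locale complex_tensor_product =
  A: complex_cohomology_algebra sA GA dA sAC cA +
  B: complex_cohomology_algebra sB GB dB sBC cB +
  M: complex_cohomology_algebra sM GM dM sMC cM
  for sA :: "'f::rational_or_real_field \<Rightarrow> 'a::ring_1 \<Rightarrow> 'a" and GA dA
    and sAC :: "complex \<Rightarrow> 'ac::ring_1 \<Rightarrow> 'ac" and cA
    and sB :: "'f \<Rightarrow> 'b::ring_1 \<Rightarrow> 'b" and GB dB
    and sBC :: "complex \<Rightarrow> 'bc::ring_1 \<Rightarrow> 'bc" and cB
    and sM :: "'f \<Rightarrow> 'm::ring_1 \<Rightarrow> 'm" and GM dM
    and sMC :: "complex \<Rightarrow> 'mc::ring_1 \<Rightarrow> 'mc" and cM +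
  fixes t :: "'a \<Rightarrow> 'b \<Rightarrow> 'm"
  assumes graded_tensor: "is_graded_tensor_product sA GA sB GB sM GM t"
begin

abbreviation "T \<equiv> complexified_bilinear sAC cA sBC cB sMC cM t"

lemma tensor_t: "is_tensor_product sA sB sM t"
  using graded_tensor unfolding is_graded_tensor_product_def by (elim conjE)

lemma t_1: "t 1 1 = 1"
  using graded_tensor unfolding is_graded_tensor_product_def by (elim conjE)

lemma t_mult:
  assumes "b \<in> GB i" "a' \<in> GA j"
  shows "t a b * t a' b' = (if odd (i * j) then - t (a * a') (b * b') else t (a * a') (b * b'))"
  using graded_tensor assms unfolding is_graded_tensor_product_def by (elim conjE) blast

lemma GM_eq: "GM k = M.span {t a b | a b i j. a \<in> GA i \<and> b \<in> GB j \<and> i + j = k}"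
  using graded_tensor unfolding is_graded_tensor_product_def by (elim conjE allE)

lemma
  shows t_linear_left: "Vector_Spaces.linear sA sM (\<lambda>a. t a b)"
    and t_linear_right: "Vector_Spaces.linear sB sM (\<lambda>b. t a b)"
  using tensor_product_bilinear[OF tensor_t A.vector_space_axioms B.vector_space_axioms M.vector_space_axioms]
  by (rule bilinear_map_left bilinear_map_right)+

lemma bilinear_map_eq:
  assumes "bilinear_map sAC sBC sU f" "bilinear_map sAC sBC sU g"
    and "\<And>a b. f (cA a) (cB b) = g (cA a) (cB b)"
  shows "f x y = g x y"
proof -
  have f: "Vector_Spaces.linear sAC sU (\<lambda>x. f x y)" "Vector_Spaces.linear sBC sU (\<lambda>y. f x y)" for x y
    by (rule bilinear_map_left[OF assms(1)] bilinear_map_right[OF assms(1)])+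
  have g: "Vector_Spaces.linear sAC sU (\<lambda>x. g x y)" "Vector_Spaces.linear sBC sU (\<lambda>y. g x y)" for x y
    by (rule bilinear_map_left[OF assms(2)] bilinear_map_right[OF assms(2)])+
  show ?thesis
  proof (rule linear_eq_on_span[OF f(1) g(1) A.span_range_c])
    fix x assume "x \<in> range cA"
    then obtain a where x: "x = cA a" by blast
    show "f x y = g x y"
    proof (rule linear_eq_on_span[OF f(2) g(2) B.span_range_c])
      fix y assume "y \<in> range cB"
      then show "f x y = g x y" unfolding x using assms(3) by (elim rangeE) simp
    qed
  qed
qed

text \<open>For fixed \<open>b\<close> the map is extended from A to its complexification; the
  result is still linear in \<open>b\<close>, because two linear maps agreeing on
  \<open>range cA\<close> are equal. Then it is extended in the second variable.\<close>

lemma exists_T: "\<exists>T. bilinear_map sAC sBC sMC T \<and> (\<forall>a b. T (cA a) (cB b) = cM (t a b))"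
proof -
  have "\<forall>b. \<exists>h. Vector_Spaces.linear sAC sMC h \<and> (\<forall>a. h (cA a) = cM (t a b))"
  proof
    fix b
    obtain h where "Vector_Spaces.linear sAC sMC h" "\<And>a. h (cA a) = cM (t a b)"
      by (rule A.complex_linear_extension[OF linear_compose[OF t_linear_left M.linear_c] M.vector_space_sC])
        (rule that)
    then show "\<exists>h. Vector_Spaces.linear sAC sMC h \<and> (\<forall>a. h (cA a) = cM (t a b))" by auto
  qed
  from choice[OF this] obtain T1 where "\<forall>b. Vector_Spaces.linear sAC sMC (T1 b) \<and> (\<forall>a. T1 b (cA a) = cM (t a b))"
    by (elim exE)
  then have T1: "Vector_Spaces.linear sAC sMC (T1 b)" "T1 b (cA a) = cM (t a b)" for a b by auto
  have T1_linear: "Vector_Spaces.linear sB (\<lambda>r. sMC (to_complex r)) (\<lambda>b. T1 b x)" for x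
  proof (rule linearI[OF B.vector_space_axioms vector_space_restrict[OF M.vector_space_sC]])
    fix b b' and r :: 'f
    have add: "Vector_Spaces.linear sAC sMC (\<lambda>x. T1 b x + T1 b' x)"
      by (rule linearI[OF A.vector_space_sC M.vector_space_sC])
        (simp_all add: linear_add[OF T1(1)] linear_scale[OF T1(1)] M.C.scale_right_distrib)
    show "T1 (b + b') x = T1 b x + T1 b' x"
      by (rule linear_eq_on_span[OF T1(1) add A.span_range_c])
        (auto simp: T1(2) linear_add[OF t_linear_right] linear_add[OF M.linear_c])
    have scale: "Vector_Spaces.linear sAC sMC (\<lambda>x. sMC (to_complex r) (T1 b x))"
      by (rule linear_compose[OF T1(1) M.C.linear_scale_self])
    show "T1 (sB r b) x = sMC (to_complex r) (T1 b x)"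
      by (rule linear_eq_on_span[OF T1(1) scale A.span_range_c])
        (auto simp: T1(2) linear_scale[OF t_linear_right] linear_scale[OF M.linear_c])
  qed
  have "\<forall>x. \<exists>h. Vector_Spaces.linear sBC sMC h \<and> (\<forall>b. h (cB b) = T1 b x)"
  proof
    fix x
    obtain h where "Vector_Spaces.linear sBC sMC h" "\<And>b. h (cB b) = T1 b x"
      by (rule B.complex_linear_extension[OF T1_linear M.vector_space_sC]) (rule that)
    then show "\<exists>h. Vector_Spaces.linear sBC sMC h \<and> (\<forall>b. h (cB b) = T1 b x)" by auto
  qed
  from choice[OF this] obtain T2 where "\<forall>x. Vector_Spaces.linear sBC sMC (T2 x) \<and> (\<forall>b. T2 x (cB b) = T1 b x)"
    by (elim exE)
  then have T2: "Vector_Spaces.linear sBC sMC (T2 x)" "T2 x (cB b) = T1 b x" for x b by auto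
  have "Vector_Spaces.linear sAC sMC (\<lambda>x. T2 x y)" for y
  proof (rule linearI[OF A.vector_space_sC M.vector_space_sC])
    fix x x' and r :: complex
    have add: "Vector_Spaces.linear sBC sMC (\<lambda>y. T2 x y + T2 x' y)"
      by (rule linearI[OF B.vector_space_sC M.vector_space_sC])
        (simp_all add: linear_add[OF T2(1)] linear_scale[OF T2(1)] M.C.scale_right_distrib)
    show "T2 (x + x') y = T2 x y + T2 x' y"
      by (rule linear_eq_on_span[OF T2(1) add B.span_range_c]) (auto simp: T2(2) linear_add[OF T1(1)])
    have scale: "Vector_Spaces.linear sBC sMC (\<lambda>y. sMC r (T2 x y))"
      by (rule linear_compose[OF T2(1) M.C.linear_scale_self])
    show "T2 (sAC r x) y = sMC r (T2 x y)"
      by (rule linear_eq_on_span[OF T2(1) scale B.span_range_c]) (auto simp: T2(2) linear_scale[OF T1(1)])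
  qed
  then have "bilinear_map sAC sBC sMC T2" unfolding bilinear_map_def using T2(1) by simp
  moreover have "\<forall>a b. T2 (cA a) (cB b) = cM (t a b)" by (simp add: T1(2) T2(2))
  ultimately show ?thesis by (intro exI[of _ T2] conjI)
qed

lemma bilinear_T: "bilinear_map sAC sBC sMC T" and T_c: "T (cA a) (cB b) = cM (t a b)"
proof -
  obtain T' where T': "bilinear_map sAC sBC sMC T'" "\<And>a b. T' (cA a) (cB b) = cM (t a b)"
    using exists_T by (elim exE conjE) auto
  have "T = T'"
    unfolding complexified_bilinear_def
  proof (rule the_equality)
    show "(\<forall>y. Vector_Spaces.linear sAC sMC (\<lambda>x. T' x y)) \<and> (\<forall>x. Vector_Spaces.linear sBC sMC (T' x)) \<and>
      (\<forall>a b. T' (cA a) (cB b) = cM (t a b))"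
      using T' unfolding bilinear_map_def by simp
    fix S assume S: "(\<forall>y. Vector_Spaces.linear sAC sMC (\<lambda>x. S x y)) \<and> (\<forall>x. Vector_Spaces.linear sBC sMC (S x)) \<and>
      (\<forall>a b. S (cA a) (cB b) = cM (t a b))"
    then have "bilinear_map sAC sBC sMC S" unfolding bilinear_map_def by simp
    then show "S = T'" using bilinear_map_eq[OF _ T'(1)] S T'(2) by (intro ext) simp
  qed
  then show "bilinear_map sAC sBC sMC T" "T (cA a) (cB b) = cM (t a b)" using T' by simp_all
qed

lemma
  shows T_linear_left: "Vector_Spaces.linear sAC sMC (\<lambda>x. T x y)"
    and T_linear_right: "Vector_Spaces.linear sBC sMC (\<lambda>y. T x y)"
  by (rule bilinear_map_left[OF bilinear_T] bilinear_map_right[OF bilinear_T])+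

lemma bilinear_map_compose:
  assumes "Vector_Spaces.linear sAC sAC f" "Vector_Spaces.linear sBC sBC g"
  shows "bilinear_map sAC sBC sMC (\<lambda>x y. T (f x) (g y))"
  unfolding bilinear_map_def
  using linear_compose[OF assms(1) T_linear_left] linear_compose[OF assms(2) T_linear_right] by simp

text \<open>Thus \<open>T\<close> makes the complexification of M the complex tensor product of
  those of A and B. The universal property of \<open>t\<close> gives \<open>h0\<close> on M, which
  is then extended complex linearly.\<close>

lemma universal:
  assumes k: "bilinear_map sAC sBC sU k"
  obtains h where "Vector_Spaces.linear sMC sU h" "\<And>x y. h (T x y) = k x y"
proof -
  have kl: "Vector_Spaces.linear sAC sU (\<lambda>x. k x y)" "Vector_Spaces.linear sBC sU (\<lambda>y. k x y)" for x y
    by (rule bilinear_map_left[OF k] bilinear_map_right[OF k])+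
  note U = linear_cod[OF kl(1)]
  have "bilinear_map sA sB (\<lambda>r. sU (to_complex r)) (\<lambda>a b. k (cA a) (cB b))"
    unfolding bilinear_map_def
    using linear_compose[OF A.linear_c linear_restrict[OF kl(1)]]
      linear_compose[OF B.linear_c linear_restrict[OF kl(2)]] by simp
  then obtain h0 where h0: "Vector_Spaces.linear sM (\<lambda>r. sU (to_complex r)) h0"
    "\<And>a b. h0 (t a b) = k (cA a) (cB b)"
    by (rule tensor_product_universal[OF tensor_t M.vector_space_axioms]) (rule that)
  obtain h where h: "Vector_Spaces.linear sMC sU h" "\<And>x. h (cM x) = h0 x"
    by (rule M.complex_linear_extension[OF h0(1) U]) (rule that)
  have "h (T x y) = k x y" for x y
  proof (rule bilinear_map_eq[OF _ k])
    show "bilinear_map sAC sBC sU (\<lambda>x y. h (T x y))"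
      unfolding bilinear_map_def
      using linear_compose[OF T_linear_left h(1)] linear_compose[OF T_linear_right h(1)] by simp
    show "h (T (cA a) (cB b)) = k (cA a) (cB b)" for a b by (simp add: T_c h(2) h0(2))
  qed
  then show ?thesis by (rule that[OF h(1)])
qed

lemma cp_GM: "M.cp (GM k) = M.C.span {T x y | x y i j. x \<in> A.cp (GA i) \<and> y \<in> B.cp (GB j) \<and> i + j = k}"
    (is "_ = M.C.span ?S")
proof
  interpret R: vector_space "\<lambda>r :: 'f. sMC (to_complex r)"
    by (rule vector_space_restrict[OF M.vector_space_sC])
  have sub: "R.subspace (M.C.span ?S)"
    by (intro R.subspaceI) (simp_all add: M.C.span_zero M.C.span_add M.C.span_scale)
  have "cM x \<in> M.C.span ?S" if "x \<in> GM k" for x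
  proof (rule linear_image_span_subset[OF M.linear_c sub that[unfolded GM_eq]])
    fix y assume "y \<in> {t a b | a b i j. a \<in> GA i \<and> b \<in> GB j \<and> i + j = k}"
    then obtain a b i j where y: "y = t a b" "a \<in> GA i" "b \<in> GB j" "i + j = k" by blast
    have "T (cA a) (cB b) \<in> ?S" using A.c_in_cp[OF y(2)] B.c_in_cp[OF y(3)] y(4) by blast
    then show "cM y \<in> M.C.span ?S" unfolding y(1) T_c[symmetric] by (rule M.C.span_base)
  qed
  then show "M.cp (GM k) \<subseteq> M.C.span ?S"
    unfolding complex_part_def by (intro M.C.span_minimal[OF _ M.C.subspace_span]) auto
  have "T x y \<in> M.cp (GM k)" if "x \<in> A.cp (GA i)" "y \<in> B.cp (GB j)" "i + j = k" for x y i j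
  proof (rule linear_image_span_subset[OF T_linear_left M.subspace_cp that(1)[unfolded complex_part_def]])
    fix x assume "x \<in> cA ` GA i"
    then obtain a where a: "x = cA a" "a \<in> GA i" by blast
    show "T x y \<in> M.cp (GM k)"
    proof (rule linear_image_span_subset[OF T_linear_right M.subspace_cp that(2)[unfolded complex_part_def]])
      fix y assume "y \<in> cB ` GB j"
      then obtain b where b: "y = cB b" "b \<in> GB j" by blast
      have "t a b \<in> GM k" unfolding GM_eq by (rule M.span_base) (use a(2) b(2) that(3) in blast)
      then show "T x y \<in> M.cp (GM k)" unfolding a(1) b(1) T_c by (rule M.c_in_cp)
    qed
  qed
  then show "M.C.span ?S \<subseteq> M.cp (GM k)"
    by (intro M.C.span_minimal[OF _ M.subspace_cp]) auto
qed

lemma T_in_cp: "x \<in> A.cp (GA i) \<Longrightarrow> y \<in> B.cp (GB j) \<Longrightarrow> T x y \<in> M.cp (GM (i + j))"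
  unfolding cp_GM by (rule M.C.span_base) blast

lemma span_T_homogeneous:
  "z \<in> M.C.span {T x y | x y i j. x \<in> A.cp (GA i) \<and> y \<in> B.cp (GB j)}" (is "z \<in> M.C.span ?S")
proof -
  have "M.proj k z \<in> M.C.span ?S" for k
  proof -
    have "M.cp (GM k) \<subseteq> M.C.span ?S" unfolding cp_GM by (rule M.C.span_mono) blast
    then show ?thesis using M.proj_in_cp by blast
  qed
  then have "(\<Sum>k\<in>{0..dM}. M.proj k z) \<in> M.C.span ?S" by (rule M.C.span_sum)
  then show ?thesis unfolding M.sum_proj[of z, symmetric] .
qed

lemma T_1: "T 1 1 = 1"
  using T_c[of 1 1] unfolding A.c_1 B.c_1 t_1 M.c_1 .

lemma T_mult:
  assumes "y \<in> B.cp (GB i)" "x' \<in> A.cp (GA j)"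
  shows "T x y * T x' y' = (if odd (i * j) then - T (x * x') (y * y') else T (x * x') (y * y'))"
proof -
  \<comment> \<open>The sign is again a scalar. Since it depends on the degrees of \<open>y\<close>
    and \<open>x'\<close>, these two are reduced to the original algebras within their degree, while
    \<open>x\<close> and \<open>y'\<close> are arbitrary.\<close>
  define \<epsilon> :: complex where "\<epsilon> = (if odd (i * j) then - 1 else 1)"
  have "T x y * T x' y' = sMC \<epsilon> (T (x * x') (y * y'))"
  proof (rule linear_eq_on_span[OF linear_compose[OF T_linear_left M.linear_mult_right]
        linear_compose[OF linear_compose[OF A.linear_mult_right T_linear_left] M.C.linear_scale_self] A.span_range_c])
    fix x assume "x \<in> range cA"
    then obtain a where a: "x = cA a" by blast
    show "T x y * T x' y' = sMC \<epsilon> (T (x * x') (y * y'))"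
    proof (rule linear_eq_on_span[OF linear_compose[OF T_linear_right M.linear_mult_right]
          linear_compose[OF linear_compose[OF B.linear_mult_right T_linear_right] M.C.linear_scale_self]
          assms(1)[unfolded complex_part_def]])
      fix y assume "y \<in> cB ` GB i"
      then obtain b where b: "y = cB b" "b \<in> GB i" by blast
      show "T x y * T x' y' = sMC \<epsilon> (T (x * x') (y * y'))"
      proof (rule linear_eq_on_span[OF linear_compose[OF T_linear_left M.linear_mult_left]
            linear_compose[OF linear_compose[OF A.linear_mult_left T_linear_left] M.C.linear_scale_self]
            assms(2)[unfolded complex_part_def]])
        fix x' assume "x' \<in> cA ` GA j"
        then obtain a' where a': "x' = cA a'" "a' \<in> GA j" by blast
        show "T x y * T x' y' = sMC \<epsilon> (T (x * x') (y * y'))"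
        proof (rule linear_eq_on_span[OF linear_compose[OF T_linear_right M.linear_mult_left]
              linear_compose[OF linear_compose[OF B.linear_mult_left T_linear_right] M.C.linear_scale_self] B.span_range_c])
          fix y' assume "y' \<in> range cB"
          then obtain b' where b': "y' = cB b'" by blast
          have "T x y * T x' y' = cM (t a b * t a' b')"
            unfolding a(1) b(1) a'(1) b' T_c M.c_mult ..
          also have "\<dots> = sMC \<epsilon> (cM (t (a * a') (b * b')))"
            unfolding t_mult[OF b(2) a'(2)] \<epsilon>_def by (simp add: linear_minus[OF M.linear_c])
          finally show "T x y * T x' y' = sMC \<epsilon> (T (x * x') (y * y'))"
            unfolding a(1) b(1) a'(1) b' A.c_mult[symmetric] B.c_mult[symmetric] T_c .
        qed
      qed
    qed
  qed
  then show ?thesis by (simp add: \<epsilon>_def)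
qed

lemma conj_T: "M.\<sigma> (T x y) = T (A.\<sigma> x) (B.\<sigma> y)"
proof -
  have *: "M.\<sigma> (T (cA a) y) = T (cA a) (B.\<sigma> y)" for a y
    by (rule B.additive_eq)
      (simp_all add: linear_add[OF T_linear_right] linear_scale[OF T_linear_right] M.conj_add M.conj_scale
        B.conj_add B.conj_scale T_c M.conj_c B.conj_c)
  show ?thesis
    by (rule A.additive_eq[of "\<lambda>x. M.\<sigma> (T x y)" "\<lambda>x. T (A.\<sigma> x) (B.\<sigma> y)"])
      (simp_all add: linear_add[OF T_linear_left] linear_scale[OF T_linear_left] M.conj_add M.conj_scale
        A.conj_add A.conj_scale * A.conj_c)
qed

text \<open>With a functional \<open>g\<close> such that \<open>g y = 1\<close>, contraction of the
  second factor sends \<open>T x y\<close> to \<open>x\<close>.\<close>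

lemma T_eq_0:
  assumes "T x y = 0"
  shows "x = 0 \<or> y = 0"
proof (rule disjCI)
  assume "y \<noteq> 0"
  then have "B.C.independent {y}" by (simp add: B.C.independent_insert)
  moreover have "vector_space_pair sBC ((*) :: complex \<Rightarrow> complex \<Rightarrow> complex)"
    by (intro vector_space_pair.intro B.vector_space_sC vector_space_complex)
  ultimately have "\<exists>g. Vector_Spaces.linear sBC (*) g \<and> (\<forall>x\<in>{y}. g x = (1 :: complex))"
    by (intro vector_space_pair.linear_independent_extend)
  then obtain g where g: "Vector_Spaces.linear sBC (*) g" "g y = 1" by auto
  have "bilinear_map sAC sBC sAC (\<lambda>x y. sAC (g y) x)"
    unfolding bilinear_map_def
    by (auto intro!: linearI A.vector_space_sC B.vector_space_sC
        simp: A.C.scale_right_distrib A.C.scale_left_distrib linear_add[OF g(1)] linear_scale[OF g(1)] mult.commute)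
  then obtain h where h: "Vector_Spaces.linear sMC sAC h" "\<And>x y. h (T x y) = sAC (g y) x"
    by (rule universal) (rule that)
  show "x = 0" using h(2)[of x y] assms g(2) linear_0[OF h(1)] by simp
qed

end

section \<open>Lefschetz operators on a bigraded algebra\<close>

lemma binomial_commuting:
  fixes x y :: "'a::ring_1"
  assumes "x * y = y * x"
  shows "(x + y) ^ n = (\<Sum>k\<le>n. of_nat (n choose k) * (x ^ k * y ^ (n - k)))"
proof (induction n)
  case (Suc n)
  let ?f = "\<lambda>k. of_nat (n choose k) * (x ^ k * y ^ (Suc n - k))"
  have c: "z * (of_nat m * u) = of_nat m * (z * u)" for m and z u :: 'a
    by (metis mult.assoc mult_of_nat_commute)
  have yx: "y * (x ^ k * z) = x ^ k * (y * z)" for k z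
    by (metis assms power_commuting_commutes mult.assoc)
  have "(x + y) ^ Suc n = (\<Sum>k\<le>n. of_nat (n choose k) * (x ^ Suc k * y ^ (n - k)))
      + (\<Sum>k\<le>n. of_nat (n choose k) * (x ^ k * (y * y ^ (n - k))))"
    unfolding power_Suc Suc.IH distrib_right sum_distrib_left
    by (simp only: c yx mult.assoc power_Suc sum.distrib)
  also have "(\<Sum>k\<le>n. of_nat (n choose k) * (x ^ k * (y * y ^ (n - k)))) = (\<Sum>k\<le>n. ?f k)"
    by (intro sum.cong) (auto simp: Suc_diff_le)
  also have "\<dots> = (\<Sum>k\<le>Suc n. ?f k)" by (simp add: binomial_eq_0)
  also have "\<dots> = ?f 0 + (\<Sum>k\<le>n. ?f (Suc k))" by (rule sum.atMost_Suc_shift)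
  finally have "(x + y) ^ Suc n = y ^ Suc n + (\<Sum>k\<le>n. of_nat (Suc n choose Suc k) * (x ^ Suc k * y ^ (n - k)))"
    by (simp add: sum.distrib[symmetric] distrib_right del: power_Suc)
  also have "\<dots> = (\<Sum>k\<le>Suc n. of_nat (Suc n choose k) * (x ^ k * y ^ (Suc n - k)))"
    unfolding sum.atMost_Suc_shift by simp
  finally show ?case .
qed simp

lemma power_mult_eq_0:
  fixes x z :: "'a::ring_1"
  assumes "x ^ m * z = 0" "m \<le> k"
  shows "x ^ k * z = 0"
proof -
  have "x ^ k = x ^ (k - m) * x ^ m" using assms(2) by (simp flip: power_add)
  then show ?thesis using assms(1) by (simp add: mult.assoc)
qed

lemma binomial_term_eq_0:
  fixes x y z :: "'a::ring_1"
  assumes "x * y = y * x" "x ^ Suc U * z = 0" "y ^ Suc V * z = 0" "k > U \<or> l > V"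
  shows "x ^ k * y ^ l * z = 0"
proof (cases "l > V")
  case True
  then show ?thesis
    using power_mult_eq_0[OF assms(3), of l] by (simp add: mult.assoc Suc_le_eq)
next
  case False
  have "x ^ k * y ^ l = y ^ l * x ^ k"
    using assms(1) by (metis power_commuting_commutes)
  then show ?thesis
    using power_mult_eq_0[OF assms(2), of k] False assms(4) by (simp add: mult.assoc Suc_le_eq)
qed

text \<open>In each term the two exponents add up to more than \<open>U + V\<close>, so one of them
  exceeds its bound.\<close>

lemma binomial_mult_eq_0:
  fixes x y z :: "'a::ring_1"
  assumes "x * y = y * x" "x ^ Suc U * z = 0" "y ^ Suc V * z = 0" "N > U + V"
  shows "(x + y) ^ N * z = 0"
proof -
  have "x ^ k * (y ^ (N - k) * z) = 0" if "k \<le> N" for k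
    using binomial_term_eq_0[OF assms(1-3), of k "N - k"] that assms(4)
    by (simp add: mult.assoc) linarith
  then show ?thesis
    unfolding binomial_commuting[OF assms(1)] sum_distrib_right by (simp add: mult.assoc)
qed

text \<open>At the critical exponent \<open>U + V\<close>, a term other than \<open>k = U\<close>
  has one exponent above its bound. This single surviving term is what relates powers of
  \<open>wA + wB\<close> to powers of \<open>wA\<close> and \<open>wB\<close>.\<close>

lemma binomial_mult_eq_single:
  fixes x y z :: "'a::ring_1"
  assumes "x * y = y * x" "x ^ Suc U * z = 0" "y ^ Suc V * z = 0"
  shows "(x + y) ^ (U + V) * z = of_nat ((U + V) choose U) * (x ^ U * y ^ V * z)"
proof -
  have "(x + y) ^ (U + V) * z =
      (\<Sum>k\<le>U + V. of_nat ((U + V) choose k) * (x ^ k * y ^ (U + V - k) * z))"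
    unfolding binomial_commuting[OF assms(1)] sum_distrib_right by (simp add: mult.assoc)
  also have "\<dots> = (\<Sum>k\<in>{U}. of_nat ((U + V) choose k) * (x ^ k * y ^ (U + V - k) * z))"
  proof (rule sum.mono_neutral_right)
    show "\<forall>k\<in>{..U + V} - {U}. of_nat ((U + V) choose k) * (x ^ k * y ^ (U + V - k) * z) = 0"
    proof
      fix k assume "k \<in> {..U + V} - {U}"
      then have "k > U \<or> U + V - k > V" by auto
      from binomial_term_eq_0[OF assms this]
      show "of_nat ((U + V) choose k) * (x ^ k * y ^ (U + V - k) * z) = 0" by simp
    qed
  qed auto
  finally show ?thesis by simp
qed

text \<open>Both factors are graded subspaces of one ring, which makes their roles interchangeable.
  The assumptions \<open>inj_A\<close> and \<open>inj_B\<close> express that tensoring over a field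
  preserves injectivity; the even degree of \<open>u\<close> avoids signs when \<open>u\<close> in B
  is moved past an element of A.\<close>

locale bigraded_algebra = vector_space s
  for s :: "complex \<Rightarrow> 'm::ring_1 \<Rightarrow> 'm" +
  fixes A B :: "int \<Rightarrow> 'm set" and dA dB :: int and pr :: "int \<Rightarrow> int \<Rightarrow> 'm \<Rightarrow> 'm"
    and wA wB :: 'm
  assumes mult_scale_left: "s z x * y = s z (x * y)"
    and mult_scale_right: "x * s z y = s z (x * y)"
    and subspace_A: "subspace (A i)"
    and subspace_B: "subspace (B i)"
    and mult_A: "x \<in> A i \<Longrightarrow> y \<in> A j \<Longrightarrow> x * y \<in> A (i + j)"
    and mult_B: "x \<in> B i \<Longrightarrow> y \<in> B j \<Longrightarrow> x * y \<in> B (i + j)"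
    and A_0: "A 0 = range (\<lambda>z. s z 1)"
    and B_0: "B 0 = range (\<lambda>z. s z 1)"
    and A_outside: "i < 0 \<or> i > dA \<Longrightarrow> A i = {0}"
    and B_outside: "i < 0 \<or> i > dB \<Longrightarrow> B i = {0}"
    and A_top: "\<exists>e. A dA = range (\<lambda>z. s z e)"
    and B_top: "\<exists>e. B dB = range (\<lambda>z. s z e)"
    and A_commute: "x \<in> A i \<Longrightarrow> y \<in> A j \<Longrightarrow> even i \<Longrightarrow> x * y = y * x"
    and B_commute: "x \<in> B i \<Longrightarrow> y \<in> B j \<Longrightarrow> even i \<Longrightarrow> x * y = y * x"
    and AB_commute: "x \<in> A i \<Longrightarrow> y \<in> B j \<Longrightarrow> x * y = (if odd (i * j) then - (y * x) else y * x)"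
    and spanning: "x \<in> span {a * b | a b i j. a \<in> A i \<and> b \<in> B j}"
    and linear_pr: "Vector_Spaces.linear s s (pr i j)"
    and pr_mult: "a \<in> A i' \<Longrightarrow> b \<in> B j' \<Longrightarrow> pr i j (a * b) = (if i' = i \<and> j' = j then a * b else 0)"
    and no_zero_divisors: "a \<in> A i \<Longrightarrow> b \<in> B j \<Longrightarrow> a * b = 0 \<Longrightarrow> a = 0 \<or> b = 0"
    and inj_A: "u \<in> A k \<Longrightarrow> even k \<Longrightarrow> (\<And>a. a \<in> A i \<Longrightarrow> u * a = 0 \<Longrightarrow> a = 0) \<Longrightarrow>
        v \<in> span {a * b | a b. a \<in> A i \<and> b \<in> B j} \<Longrightarrow> u * v = 0 \<Longrightarrow> v = 0"
    and inj_B: "u \<in> B k \<Longrightarrow> even k \<Longrightarrow> (\<And>b. b \<in> B j \<Longrightarrow> u * b = 0 \<Longrightarrow> b = 0) \<Longrightarrow>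
        v \<in> span {a * b | a b. a \<in> A i \<and> b \<in> B j} \<Longrightarrow> u * v = 0 \<Longrightarrow> v = 0"
    and wA: "wA \<in> A 2"
    and wB: "wB \<in> B 2"
    and A1_B1: "A 1 = {0} \<or> B 1 = {0}"
begin

definition W :: "int \<Rightarrow> int \<Rightarrow> 'm set" where
  "W i j = span {a * b | a b. a \<in> A i \<and> b \<in> B j}"

definition M :: "int \<Rightarrow> 'm set" where
  "M k = span {a * b | a b i j. a \<in> A i \<and> b \<in> B j \<and> i + j = k}"

lemma swap_products: "{b * a | b a. b \<in> B j \<and> a \<in> A i} \<subseteq> span {a * b | a b. a \<in> A i \<and> b \<in> B j}"
proof clarify
  fix a b assume ab: "a \<in> A i" "b \<in> B j"
  then have "a * b \<in> span {a * b | a b. a \<in> A i \<and> b \<in> B j}" by (blast intro: span_base)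
  moreover have "b * a = a * b \<or> b * a = - (a * b)"
    using AB_commute[OF ab] by (auto split: if_splits)
  ultimately show "b * a \<in> span {a * b | a b. a \<in> A i \<and> b \<in> B j}" by (elim disjE) (simp_all only: span_neg)
qed

lemma swap_products': "{a * b | a b. a \<in> A i \<and> b \<in> B j} \<subseteq> span {b * a | b a. b \<in> B j \<and> a \<in> A i}"
proof clarify
  fix a b assume ab: "a \<in> A i" "b \<in> B j"
  then have "b * a \<in> span {b * a | b a. b \<in> B j \<and> a \<in> A i}" by (blast intro: span_base)
  moreover have "a * b = b * a \<or> a * b = - (b * a)"
    using AB_commute[OF ab] by (auto split: if_splits)
  ultimately show "a * b \<in> span {b * a | b a. b \<in> B j \<and> a \<in> A i}" by (elim disjE) (simp_all only: span_neg)
qed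

lemma swap_W: "span {b * a | b a. b \<in> B j \<and> a \<in> A i} = W i j"
  unfolding W_def by (rule span_eq[THEN iffD2, OF conjI[OF swap_products swap_products']])

text \<open>Exchanging the factors changes a product only by a sign, so all spans of products agree.
  Every result on A thereby has its counterpart on B.\<close>

lemma swap: "bigraded_algebra s B A dB dA (\<lambda>i j. pr j i) wB wA"
proof unfold_locales
  show "x \<in> span {a * b | a b i j. a \<in> B i \<and> b \<in> A j}" for x
  proof -
    have "{a * b | a b i j. a \<in> A i \<and> b \<in> B j} \<subseteq> span {a * b | a b i j. a \<in> B i \<and> b \<in> A j}"
    proof clarify
      fix a b i j assume "a \<in> A i" "b \<in> B j"
      then have "a * b \<in> span {b * a | b a. b \<in> B j \<and> a \<in> A i}" using swap_products' by blast
      moreover have "{b * a | b a. b \<in> B j \<and> a \<in> A i} \<subseteq> {a * b | a b i j. a \<in> B i \<and> b \<in> A j}"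
        by blast
      ultimately show "a * b \<in> span {a * b | a b i j. a \<in> B i \<and> b \<in> A j}"
        using span_mono by blast
    qed
    then show ?thesis using spanning span_minimal[OF _ subspace_span] by blast
  qed
  show "pr j i (b * a) = (if j' = i \<and> i' = j then b * a else 0)" if "b \<in> B j'" "a \<in> A i'" for a b i' j' i j
  proof -
    have "b * a = a * b \<or> b * a = - (a * b)"
      using AB_commute[OF that(2,1)] by (auto split: if_splits)
    then show ?thesis
      using pr_mult[OF that(2,1), of j i] by (auto simp: linear_minus[OF linear_pr])
  qed
  show "x * y = (if odd (i * j) then - (y * x) else y * x)" if "x \<in> B i" "y \<in> A j" for x y i j
    using AB_commute[OF that(2,1)] by (auto simp: mult.commute)
  show "b = 0 \<or> a = 0" if "b \<in> B i" "a \<in> A j" "b * a = 0" for a b i j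
    using AB_commute[OF that(2,1)] no_zero_divisors[OF that(2,1)] that(3) by (auto split: if_splits)
  show "z = 0" if "u \<in> B k" "even k" "\<And>a. a \<in> B i \<Longrightarrow> u * a = 0 \<Longrightarrow> a = 0"
    "z \<in> span {a * b |a b. a \<in> B i \<and> b \<in> A j}" "u * z = 0" for u k i j z
    using inj_B[OF that(1,2,3) _ that(5)] that(4) unfolding swap_W W_def by blast
  show "z = 0" if "u \<in> A k" "even k" "\<And>a. a \<in> A j \<Longrightarrow> u * a = 0 \<Longrightarrow> a = 0"
    "z \<in> span {a * b |a b. a \<in> B i \<and> b \<in> A j}" "u * z = 0" for u k i j z
    using inj_A[OF that(1,2,3) _ that(5)] that(4) unfolding swap_W W_def by blast
  show "B 1 = {0} \<or> A 1 = {0}" using A1_B1 by (elim disjE) simp_all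
qed (fact mult_scale_left mult_scale_right subspace_A subspace_B mult_A mult_B A_0 B_0 A_outside
    B_outside A_top B_top A_commute B_commute linear_add[OF linear_pr]
    linear_scale[OF linear_pr] wA wB)+

lemma swap_M: "bigraded_algebra.M s B A k = M k"
proof -
  interpret sw: bigraded_algebra s B A dB dA "\<lambda>i j. pr j i" wB wA by (rule swap)
  have "{a * b | a b i j. a \<in> A i \<and> b \<in> B j \<and> i + j = k} \<subseteq> sw.M k"
  proof clarify
    fix a b i j assume ab: "a \<in> A i" "b \<in> B j" and k: "k = i + j"
    have "a * b \<in> span {b * a | b a. b \<in> B j \<and> a \<in> A i}" using swap_products' ab by blast
    moreover have "{b * a | b a. b \<in> B j \<and> a \<in> A i} \<subseteq> {a * b | a b i' j'. a \<in> B i' \<and> b \<in> A j' \<and> i' + j' = i + j}"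
    proof clarify
      fix b a assume "b \<in> B j" "a \<in> A i"
      then show "\<exists>a' b' i' j'. b * a = a' * b' \<and> a' \<in> B i' \<and> b' \<in> A j' \<and> i' + j' = i + j"
        by (intro exI[of _ b] exI[of _ a] exI[of _ j] exI[of _ i]) simp
    qed
    ultimately show "a * b \<in> sw.M (i + j)"
      unfolding sw.M_def using span_mono by blast
  qed
  moreover have "{a * b | a b i j. a \<in> B i \<and> b \<in> A j \<and> i + j = k} \<subseteq> M k"
  proof clarify
    fix a b i j assume ab: "b \<in> B i" "a \<in> A j" and k: "k = i + j"
    have "b * a \<in> span {a * b | a b. a \<in> A j \<and> b \<in> B i}" using swap_products ab by blast
    moreover have "{a * b | a b. a \<in> A j \<and> b \<in> B i} \<subseteq> {a * b | a b i' j'. a \<in> A i' \<and> b \<in> B j' \<and> i' + j' = i + j}"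
    proof clarify
      fix a b assume "a \<in> A j" "b \<in> B i"
      then show "\<exists>a' b' i' j'. a * b = a' * b' \<and> a' \<in> A i' \<and> b' \<in> B j' \<and> i' + j' = i + j"
        by (intro exI[of _ a] exI[of _ b] exI[of _ j] exI[of _ i]) simp
    qed
    ultimately show "b * a \<in> M (i + j)"
      unfolding M_def using span_mono by blast
  qed
  ultimately show ?thesis
    unfolding sw.M_def M_def by (simp add: span_eq)
qed

lemma of_nat_mult_eq_scale: "of_nat k * x = s (of_nat k) x"
  by (induction k) (simp_all add: distrib_right scale_left_distrib)

lemma one_A: "1 \<in> A 0"
  unfolding A_0 by (rule range_eqI[of _ _ 1]) simp

lemma one_B: "1 \<in> B 0"
  unfolding B_0 by (rule range_eqI[of _ _ 1]) simp

lemma dA_nonneg: "0 \<le> dA"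
  using A_outside[of 0] one_A by force

lemma dB_nonneg: "0 \<le> dB"
  using B_outside[of 0] one_B by force

lemma power_A: "u \<in> A k \<Longrightarrow> u ^ e \<in> A (k * int e)"
proof (induction e)
  case (Suc e)
  then show ?case using mult_A[of u k "u ^ e" "k * int e"] by (simp add: algebra_simps)
qed (simp add: one_A)

lemma power_B: "u \<in> B k \<Longrightarrow> u ^ e \<in> B (k * int e)"
proof (induction e)
  case (Suc e)
  then show ?case using mult_B[of u k "u ^ e" "k * int e"] by (simp add: algebra_simps)
qed (simp add: one_B)

lemma product_in_W: "a \<in> A i \<Longrightarrow> b \<in> B j \<Longrightarrow> a * b \<in> W i j"
  unfolding W_def by (rule span_base) blast

lemma product_in_M: "a \<in> A i \<Longrightarrow> b \<in> B j \<Longrightarrow> i + j = k \<Longrightarrow> a * b \<in> M k"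
  unfolding M_def by (rule span_base) blast

lemma A_subset_M: "a \<in> A k \<Longrightarrow> a \<in> M k"
  using product_in_M[OF _ one_B, of a k k] by simp

lemma subspace_W: "subspace (W i j)"
  unfolding W_def by (rule subspace_span)

lemma linear_mult_left: "Vector_Spaces.linear s s (\<lambda>x. u * x)"
  by (rule linearI[OF vector_space_axioms vector_space_axioms]) (simp_all add: distrib_left mult_scale_right)

lemma linear_mult_right: "Vector_Spaces.linear s s (\<lambda>x. x * u)"
  by (rule linearI[OF vector_space_axioms vector_space_axioms]) (simp_all add: distrib_right mult_scale_left)

lemma wA_central: "wA * x = x * wA"
proof (rule linear_eq_on_span[OF linear_mult_left linear_mult_right spanning])
  fix y assume "y \<in> {a * b |a b i j. a \<in> A i \<and> b \<in> B j}"
  then obtain a b i j where y: "y = a * b" "a \<in> A i" "b \<in> B j" by blast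
  have "wA * a = a * wA" by (rule A_commute[OF wA y(2)]) simp
  moreover have "wA * b = b * wA" using AB_commute[OF wA y(3)] by simp
  ultimately show "wA * y = y * wA" unfolding y(1) by (metis mult.assoc)
qed

lemma wB_central: "wB * x = x * wB"
proof -
  interpret sw: bigraded_algebra s B A dB dA "\<lambda>i j. pr j i" wB wA by (rule swap)
  show ?thesis by (rule sw.wA_central)
qed

lemma power_wA_central: "wA ^ e * x = x * wA ^ e"
  by (rule power_commuting_commutes) (rule wA_central)

lemma power_wB_central: "wB ^ e * x = x * wB ^ e"
  by (rule power_commuting_commutes) (rule wB_central)

lemma power_wA: "wA ^ e \<in> A (2 * int e)"
  using power_A[OF wA] .

lemma power_wB: "wB ^ e \<in> B (2 * int e)"
  using power_B[OF wB] .

lemma power_wA_eq_0: "dA < 2 * int e \<Longrightarrow> wA ^ e = 0"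
  using power_wA[of e] A_outside[of "2 * int e"] by simp

lemma power_wB_eq_0: "dB < 2 * int e \<Longrightarrow> wB ^ e = 0"
  using power_wB[of e] B_outside[of "2 * int e"] by simp

text \<open>The powers of \<open>wA\<close> and \<open>wB\<close> vanish beyond \<open>U\<close> and
  \<open>V\<close>, the halves of the dimensions rounded down. If the dimensions were odd, both
  would be, and then \<open>U + V < n\<close> would force the power \<open>n\<close> of
  \<open>wA + wB\<close> to vanish.\<close>

lemma even_dimensions:
  assumes "dA + dB = 2 * int n" "(wA + wB) ^ n \<noteq> 0"
  shows "even dA \<and> even dB"
proof (rule ccontr)
  define U V where "U = nat (dA div 2)" and "V = nat (dB div 2)"
  have "wA ^ Suc U * 1 = 0" "wB ^ Suc V * 1 = 0"
    using dA_nonneg dB_nonneg by (simp_all only: mult_1_right) (rule power_wA_eq_0 power_wB_eq_0; simp add: U_def V_def)+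
  note 0 = this
  assume "\<not> (even dA \<and> even dB)"
  moreover have "int U = dA div 2" "int V = dB div 2"
    using dA_nonneg dB_nonneg by (simp_all add: U_def V_def)
  ultimately have "n > U + V" using assms(1) by presburger
  with 0 have "(wA + wB) ^ n * 1 = 0" by (intro binomial_mult_eq_0[OF wA_central])
  then show False using assms(2) by simp
qed

lemma W_i_0: "W i 0 \<subseteq> A i"
  unfolding W_def
proof (rule span_minimal[OF _ subspace_A], clarify)
  fix a b assume a: "a \<in> A i" and "b \<in> B 0"
  then obtain z where "b = s z 1" unfolding B_0 by blast
  then show "a * b \<in> A i" using subspace_scale[OF subspace_A a] by (simp add: mult_scale_right)
qed

lemma pr_in_W: "pr i j x \<in> W i j"
proof (rule linear_image_span_subset[OF linear_pr subspace_W spanning])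
  fix y assume "y \<in> {a * b |a b i j. a \<in> A i \<and> b \<in> B j}"
  then obtain a b i' j' where y: "y = a * b" "a \<in> A i'" "b \<in> B j'" by blast
  show "pr i j y \<in> W i j"
    using product_in_W[of a i b j] y subspace_0[OF subspace_W] by (auto simp: pr_mult)
qed

text \<open>Multiplication by \<open>wA ^ e\<close> is homogeneous of bidegree
  \<open>(2 * e, 0)\<close>.\<close>

lemma pr_power_wA: "pr (i + 2 * int e) j (wA ^ e * x) = wA ^ e * pr i j x"
proof (rule linear_eq_on_span[OF linear_compose[OF linear_mult_left linear_pr]
      linear_compose[OF linear_pr linear_mult_left] spanning])
  fix y assume "y \<in> {a * b |a b i j. a \<in> A i \<and> b \<in> B j}"
  then obtain a b i' j' where y: "y = a * b" "a \<in> A i'" "b \<in> B j'" by blast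
  have "wA ^ e * a \<in> A (2 * int e + i')" by (rule mult_A[OF power_wA y(2)])
  from pr_mult[OF this y(3), of "i + 2 * int e" j]
  show "pr (i + 2 * int e) j (wA ^ e * y) = wA ^ e * pr i j y"
    unfolding y(1) by (auto simp: pr_mult[OF y(2,3)] mult.assoc)
qed

lemma M_eq_sum_pr:
  assumes "x \<in> M k"
  shows "x = (\<Sum>j\<in>{0..dB}. pr (k - j) j x)"
proof -
  have L: "Vector_Spaces.linear s s (\<lambda>x. \<Sum>j\<in>{0..dB}. pr (k - j) j x)"
    by (rule linearI[OF vector_space_axioms vector_space_axioms])
      (simp_all add: linear_add[OF linear_pr] linear_scale[OF linear_pr] sum.distrib scale_sum_right)
  show ?thesis
  proof (rule linear_eq_on_span[OF linear_ident L assms[unfolded M_def]])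
    fix y assume "y \<in> {a * b |a b i j. a \<in> A i \<and> b \<in> B j \<and> i + j = k}"
    then obtain a b i j where y: "y = a * b" "a \<in> A i" "b \<in> B j" "i + j = k" by blast
    have *: "pr (k - j') j' y = (if j' = j then y else 0)" for j'
      unfolding y(1) pr_mult[OF y(2,3)] using y(4) by auto
    show "y = (\<Sum>j\<in>{0..dB}. pr (k - j) j y)"
    proof (cases "j \<in> {0..dB}")
      case False
      then have "y = 0" using B_outside[of j] y(1,3) by auto
      then show ?thesis by (simp add: linear_0[OF linear_pr])
    qed (simp add: * )
  qed
qed

text \<open>Only the component with \<open>j = 0\<close> survives, and \<open>B 0\<close> consists
  of scalars.\<close>

lemma M_subset_A:
  assumes "x \<in> M k" "\<And>j. j > 0 \<Longrightarrow> pr (k - j) j x = 0"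
  shows "x \<in> A k"
proof -
  have "(\<Sum>j\<in>{0..dB}. pr (k - j) j x) = (\<Sum>j\<in>{0}. pr (k - j) j x)"
    by (rule sum.mono_neutral_right) (use assms(2) dB_nonneg in auto)
  then have "x = pr k 0 x" using M_eq_sum_pr[OF assms(1)] by simp
  then show ?thesis using pr_in_W[of k 0 x] W_i_0 by auto
qed

text \<open>This is where \<open>A1_B1\<close> enters: among the products of total degree 2, those
  from \<open>A 1\<close> and \<open>B 1\<close> are zero, and the remaining ones have a scalar
  factor or vanish for degree reasons.\<close>

lemma M_2:
  assumes "x \<in> M 2"
  shows "\<exists>a\<in>A 2. \<exists>b\<in>B 2. x = a + b"
proof -
  let ?S = "{a + b | a b. a \<in> A 2 \<and> b \<in> B 2}"
  have "subspace ?S"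
    using subspace_sums[OF subspace_A subspace_B] .
  moreover have "{a * b |a b i j. a \<in> A i \<and> b \<in> B j \<and> i + j = 2} \<subseteq> ?S"
  proof clarify
    fix a b and i j :: int assume ab: "a \<in> A i" "b \<in> B j" "i + j = 2"
    have 0: "0 \<in> A 2" "0 \<in> B 2" using subspace_0 subspace_A subspace_B by auto
    consider "i < 0" | "i = 0" | "i = 1" | "i = 2" | "i > 2" by linarith
    then show "\<exists>a' b'. a * b = a' + b' \<and> a' \<in> A 2 \<and> b' \<in> B 2"
    proof cases
      case 1
      then have "a * b = 0 + 0" using ab A_outside[of i] by simp
      then show ?thesis using 0 by blast
    next
      case 2
      then obtain z where "a = s z 1" using ab(1) A_0 by auto
      then have "a * b = 0 + s z b" by (simp add: mult_scale_left)
      moreover have "s z b \<in> B 2" using 2 ab subspace_scale[OF subspace_B] by simp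
      ultimately show ?thesis using 0 by blast
    next
      case 3
      then have "a \<in> A 1" "b \<in> B 1" using ab by simp_all
      then have "a = 0 \<or> b = 0" using A1_B1 by (elim disjE) simp_all
      then have "a * b = 0 + 0" by (elim disjE) simp_all
      then show ?thesis using 0 by blast
    next
      case 4
      then obtain z where "b = s z 1" using ab(2,3) B_0 by auto
      then have "a * b = s z a + 0" by (simp add: mult_scale_right)
      moreover have "s z a \<in> A 2" using 4 ab subspace_scale[OF subspace_A] by simp
      ultimately show ?thesis using 0 by blast
    next
      case 5
      then have "a * b = 0 + 0" using ab B_outside[of j] by simp
      then show ?thesis using 0 by blast
    qed
  qed
  ultimately have "M 2 \<subseteq> ?S" unfolding M_def by (rule span_minimal[rotated])
  from subsetD[OF this assms] show ?thesis by blast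
qed

text \<open>The projection \<open>pr i 0\<close> fixes \<open>x\<close> when it is read as
  \<open>x * 1\<close> and kills it when it is read as \<open>1 * x\<close>.\<close>

lemma A_Int_B:
  assumes "x \<in> A i" "x \<in> B j" "i \<noteq> 0"
  shows "x = 0"
  using pr_mult[OF assms(1) one_B, of i 0] pr_mult[OF one_A assms(2), of i 0] assms(3) by simp

end

text \<open>Lefschetz is assumed only for the sum \<open>wA + wB\<close> on the whole algebra. Of
  the Hodge structure there remains a degree-preserving derivation \<open>D\<close> that kills this
  sum.\<close>

locale lefschetz_bigraded_algebra = bigraded_algebra s A B dA dB pr wA wB
  for s :: "complex \<Rightarrow> 'm::ring_1 \<Rightarrow> 'm" and A B dA dB pr wA wB +
  fixes r r' :: nat and D :: "'m \<Rightarrow> 'm"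
  assumes dA: "dA = 2 * int r"
    and dB: "dB = 2 * int r'"
    and linear_D: "Vector_Spaces.linear s s D"
    and D_mult: "D (x * y) = D x * y + x * D y"
    and D_M: "x \<in> M k \<Longrightarrow> D x \<in> M k"
    and D_w: "D (wA + wB) = 0"
    and lefschetz_inj: "x \<in> M k \<Longrightarrow> 0 \<le> k \<Longrightarrow> k + int e = int (r + r') \<Longrightarrow> (wA + wB) ^ e * x = 0 \<Longrightarrow> x = 0"
    and lefschetz_surj: "y \<in> M (k + 2 * int e) \<Longrightarrow> 0 \<le> k \<Longrightarrow> k + int e = int (r + r') \<Longrightarrow>
      \<exists>x\<in>M k. y = (wA + wB) ^ e * x"
begin

lemma swap_lefschetz: "lefschetz_bigraded_algebra s B A dB dA (\<lambda>i j. pr j i) wB wA r' r D"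
proof -
  interpret sw: bigraded_algebra s B A dB dA "\<lambda>i j. pr j i" wB wA by (rule swap)
  show ?thesis
  proof unfold_locales
    show "D x \<in> sw.M k" if "x \<in> sw.M k" for x k
      using D_M that unfolding swap_M .
    show "D (wB + wA) = 0" using D_w by (simp only: add.commute)
    show "x = 0" if "x \<in> sw.M k" "0 \<le> k" "k + int e = int (r' + r)" "(wB + wA) ^ e * x = 0" for x k e
      using lefschetz_inj[of x k e] that unfolding swap_M by (simp only: add.commute)
    show "\<exists>x\<in>sw.M k. y = (wB + wA) ^ e * x"
      if "y \<in> sw.M (k + 2 * int e)" "0 \<le> k" "k + int e = int (r' + r)" for y k e
      using lefschetz_surj[of y k e] that unfolding swap_M by (simp only: add.commute)
  qed (fact linear_add[OF linear_D] linear_scale[OF linear_D] D_mult dA dB)+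
qed

lemma A_outside': "i < 0 \<or> i > 2 * int r \<Longrightarrow> A i = {0}"
  using A_outside[of i] unfolding dA .

lemma B_outside': "i < 0 \<or> i > 2 * int r' \<Longrightarrow> B i = {0}"
  using B_outside[of i] unfolding dB .

lemma power_wA_Suc: "wA ^ Suc r = 0"
  by (rule power_wA_eq_0) (simp add: dA)

lemma power_wB_Suc: "wB ^ Suc r' = 0"
  by (rule power_wB_eq_0) (simp add: dB)

lemma wA_wB: "wA * wB = wB * wA"
  by (rule wA_central)

lemma power_w: "(wA + wB) ^ (r + r') = of_nat ((r + r') choose r) * (wA ^ r * wB ^ r')"
  using binomial_mult_eq_single[OF wA_wB, of r 1 r'] power_wA_Suc power_wB_Suc by simp

lemma power_w_nonzero: "(wA + wB) ^ (r + r') \<noteq> 0"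
  using lefschetz_inj[of 1 0 "r + r'"] A_subset_M[OF one_A] by auto

lemma power_wA_nonzero: "wA ^ r \<noteq> 0"
  using power_w_nonzero unfolding power_w by auto

lemma power_wB_nonzero: "wB ^ r' \<noteq> 0"
  using power_w_nonzero unfolding power_w by auto

lemma A_top_eq:
  assumes "x \<in> A (2 * int r)"
  shows "\<exists>z. x = s z (wA ^ r)"
proof -
  obtain e where e: "A (2 * int r) = range (\<lambda>z. s z e)" using A_top unfolding dA by (elim exE)
  obtain c where c: "wA ^ r = s c e" using power_wA[of r] unfolding e by (elim rangeE)
  obtain d where d: "x = s d e" using assms unfolding e by (elim rangeE)
  have "c \<noteq> 0" using c power_wA_nonzero by (metis scale_zero_left)
  then have "x = s (d / c) (wA ^ r)" unfolding c d by simp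
  then show ?thesis ..
qed

text \<open>It suffices to treat the exact exponent \<open>f = r - k\<close>. If
  \<open>wA ^ f * a = 0\<close>, each term of \<open>(wA + wB) ^ (f + r') * a\<close> contains
  \<open>wA ^ f\<close> or \<open>wB ^ Suc r'\<close>, so the product vanishes; and
  \<open>f + r'\<close> is the Lefschetz exponent of the whole algebra in degree \<open>k\<close>.
  The inequality is tailored to \<open>pr_D_A\<close>, which works in degree
  \<open>k - j\<close>.\<close>

lemma lefschetz_A_inj:
  assumes "a \<in> A k" "k + int e \<le> int r" "wA ^ e * a = 0"
  shows "a = 0"
proof (cases "k < 0")
  case True
  then show ?thesis using assms(1) A_outside'[of k] by simp
next
  case False
  define f where "f = nat (int r - k)"
  have f: "k + int f = int r" "e \<le> f" using False assms(2) by (auto simp: f_def)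
  have a0: "wA ^ f * a = 0" by (rule power_mult_eq_0[OF assms(3) f(2)])
  show ?thesis
  proof (cases f)
    case 0
    then show ?thesis using a0 by simp
  next
    case (Suc U)
    have "wA ^ Suc U * a = 0" using a0 unfolding Suc .
    moreover have "wB ^ Suc r' * a = 0" unfolding power_wB_Suc by simp
    ultimately have "(wA + wB) ^ (f + r') * a = 0"
      using Suc by (intro binomial_mult_eq_0[OF wA_wB, of U a r']) simp_all
    then show ?thesis
      using lefschetz_inj[OF A_subset_M[OF assms(1)], of "f + r'"] f(1) False by simp
  qed
qed

lemma subspace_image_A: "subspace {wA ^ e * a * wB ^ r' | a. a \<in> A k}"
proof -
  have "Vector_Spaces.linear s s (\<lambda>a. wA ^ e * a * wB ^ r')"
    by (rule linear_compose[OF linear_mult_left linear_mult_right])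
  then interpret L: Vector_Spaces.linear s s "\<lambda>a. wA ^ e * a * wB ^ r'" .
  show ?thesis using L.subspace_image[OF subspace_A[of k]] by (simp only: image_def Bex_def) (simp only: conj_commute)
qed

lemma B_top_eq:
  assumes "x \<in> B (2 * int r')"
  shows "\<exists>z. x = s z (wB ^ r')"
proof -
  interpret sw: lefschetz_bigraded_algebra s B A dB dA "\<lambda>i j. pr j i" wB wA r' r D by (rule swap_lefschetz)
  show ?thesis by (rule sw.A_top_eq[OF assms])
qed

text \<open>The degree conditions give \<open>2 * l = 2 * e + j\<close>, hence
  \<open>l \<ge> e\<close>. The surplus power \<open>wA ^ (l - e)\<close> lifts \<open>a\<close>
  into \<open>A k\<close>, while \<open>wB ^ m * b\<close> lies in the top degree of B and is a
  multiple of \<open>wB ^ r'\<close>.\<close>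

lemma lefschetz_term:
  assumes "a \<in> A i" "b \<in> B j" "i + j = k" "k + int e = int r"
    "i + 2 * int l = 2 * int r - k" "j + 2 * int m = 2 * int r'"
  shows "(wA ^ l * wB ^ m) * (a * b) \<in> {wA ^ e * a * wB ^ r' | a. a \<in> A k}"
proof (cases "a = 0 \<or> b = 0")
  case True
  then have "(wA ^ l * wB ^ m) * (a * b) = 0" by (elim disjE) simp_all
  then show ?thesis using subspace_0[OF subspace_image_A] by simp
next
  case False
  then have "0 \<le> j" using assms(2) B_outside'[of j] by (metis not_less singletonD)
  then have l: "l = e + (l - e)" and i: "2 * int (l - e) + i = k" using assms(3-6) by linarith+
  have mb: "wB ^ m * b \<in> B (2 * int r')"
    using mult_B[OF power_wB[of m] assms(2)] assms(6) by (simp only: add.commute)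
  then obtain z where z: "wB ^ m * b = s z (wB ^ r')" using B_top_eq[OF mb] by (elim exE)
  have la: "wA ^ (l - e) * a \<in> A k"
    using mult_A[OF power_wA[of "l - e"] assms(1)] unfolding i .
  have "(wA ^ l * wB ^ m) * (a * b) = wA ^ l * a * (wB ^ m * b)"
    by (metis mult.assoc power_wB_central)
  also have "\<dots> = wA ^ e * s z (wA ^ (l - e) * a) * wB ^ r'"
    unfolding z by (subst l) (simp only: power_add mult.assoc mult_scale_left mult_scale_right)
  finally show ?thesis using subspace_scale[OF subspace_A la] by blast
qed

text \<open>
  Multiply by the top power of \<open>wB\<close>, divide by a power of \<open>wA + wB\<close>, and compare components in the
  top degree of \<open>B\<close>.
\<close>

lemma lefschetz_A_surj:
  assumes "y \<in> A (k + 2 * int e)" "0 \<le> k" "k + int e = int r"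
  shows "\<exists>x\<in>A k. y = wA ^ e * x"
proof -
  \<comment> \<open>\<open>?N\<close> is the Lefschetz exponent of the whole algebra in degree
    \<open>k\<close>. The projection \<open>?P\<close> keeps the part of top degree in B, where only
    multiples of \<open>wB ^ r'\<close> occur.\<close>
  let ?S = "{wA ^ e * a * wB ^ r' | a. a \<in> A k}" and ?N = "e + r'"
  let ?P = "pr (2 * int r - k) (2 * int r')"
  have deg: "k + 2 * int e = 2 * int r - k" "2 * int e + k = 2 * int r - k"
    "2 * int r - k + 2 * int r' = k + 2 * int ?N" "k + int ?N = int (r + r')"
    using assms(3) by simp_all
  have y: "y \<in> A (2 * int r - k)" using assms(1) unfolding deg(1) .
  have in_S: "?P ((wA + wB) ^ ?N * x) \<in> ?S" if "x \<in> M k" for x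
  proof (rule linear_image_span_subset[OF linear_compose[OF linear_mult_left linear_pr]
        subspace_image_A that[unfolded M_def]])
    fix x assume "x \<in> {a * b |a b i j. a \<in> A i \<and> b \<in> B j \<and> i + j = k}"
    then obtain a b i j where x: "x = a * b" "a \<in> A i" "b \<in> B j" "i + j = k" by blast
    have "?P (of_nat (?N choose l) * (wA ^ l * wB ^ (?N - l) * x)) \<in> ?S" for l
    proof -
      let ?m = "?N - l"
      have eq: "(wA ^ l * wB ^ ?m) * (a * b) = wA ^ l * a * (wB ^ ?m * b)"
        by (metis mult.assoc power_wB_central)
      have "wA ^ l * a \<in> A (2 * int l + i)" by (rule mult_A[OF power_wA x(2)])
      moreover have "wB ^ ?m * b \<in> B (2 * int ?m + j)" by (rule mult_B[OF power_wB x(3)])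
      ultimately have P: "?P ((wA ^ l * wB ^ ?m) * (a * b)) =
          (if 2 * int l + i = 2 * int r - k \<and> 2 * int ?m + j = 2 * int r' then (wA ^ l * wB ^ ?m) * (a * b) else 0)"
        unfolding eq by (rule pr_mult)
      have "?P ((wA ^ l * wB ^ ?m) * (a * b)) \<in> ?S"
      proof (cases "2 * int l + i = 2 * int r - k \<and> 2 * int ?m + j = 2 * int r'")
        case True
        then show ?thesis
          unfolding P using lefschetz_term[OF x(2,3,4) assms(3), of l ?m] by (simp add: add.commute)
      next
        case False
        then show ?thesis unfolding P using subspace_0[OF subspace_image_A, of e k] by (simp only: if_False)
      qed
      then show ?thesis
        unfolding of_nat_mult_eq_scale x(1) linear_scale[OF linear_pr] by (rule subspace_scale[OF subspace_image_A])
    qed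
    then have "(\<Sum>l\<le>?N. ?P (of_nat (?N choose l) * (wA ^ l * wB ^ (?N - l) * x))) \<in> ?S"
      by (rule subspace_sum[OF subspace_image_A])
    then show "?P ((wA + wB) ^ ?N * x) \<in> ?S"
      unfolding binomial_commuting[OF wA_wB] sum_distrib_right linear_sum[OF linear_pr] mult.assoc .
  qed
  have "y * wB ^ r' \<in> M (k + 2 * int ?N)"
    by (rule product_in_M[OF y power_wB deg(3)])
  from lefschetz_surj[OF this assms(2) deg(4)] obtain x
    where "x \<in> M k" "y * wB ^ r' = (wA + wB) ^ ?N * x" by (elim bexE)
  with in_S[of x] have "?P (y * wB ^ r') \<in> ?S" by simp
  then have "y * wB ^ r' \<in> ?S" by (simp add: pr_mult[OF y power_wB])
  then obtain a where a: "a \<in> A k" "y * wB ^ r' = wA ^ e * a * wB ^ r'" by blast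
  have "wA ^ e * a \<in> A (2 * int r - k)"
    using mult_A[OF power_wA[of e] a(1)] unfolding deg(2) .
  then have "y - wA ^ e * a \<in> A (2 * int r - k)" by (rule subspace_diff[OF subspace_A y])
  moreover have "(y - wA ^ e * a) * wB ^ r' = 0" using a(2) by (simp add: left_diff_distrib)
  ultimately have "y - wA ^ e * a = 0"
    using no_zero_divisors[OF _ power_wB] power_wB_nonzero by blast
  then show ?thesis using a(1) by (intro bexI[of _ a]) simp_all
qed

section \<open>The derivation preserves the first factor\<close>

text \<open>Apply \<open>D\<close> to \<open>wA ^ Suc r = 0\<close>.\<close>

lemma D_wA_B_component:
  assumes "D wA = a + b" "a \<in> A 2" "b \<in> B 2"
  shows "b = 0"
proof -
  have "D (wA ^ Suc e) = of_nat (Suc e) * (wA ^ e * D wA)" for e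
  proof (induction e)
    case (Suc e)
    have "D (wA ^ Suc (Suc e)) = D wA * wA ^ Suc e + wA * (of_nat (Suc e) * (wA ^ e * D wA))"
      unfolding power_Suc[of wA "Suc e"] D_mult Suc.IH ..
    also have "\<dots> = wA ^ Suc e * D wA + of_nat (Suc e) * (wA ^ Suc e * D wA)"
      unfolding power_wA_central[of "Suc e" "D wA", symmetric] of_nat_mult_eq_scale
      by (simp add: mult_scale_right mult.assoc)
    finally show ?case by (simp only: of_nat_Suc[of "Suc e"] distrib_right mult_1_left)
  qed simp
  from this[of r] have "of_nat (Suc r) * (wA ^ r * D wA) = 0"
    unfolding power_wA_Suc linear_0[OF linear_D] by (rule sym)
  then have "wA ^ r * D wA = 0" unfolding of_nat_mult_eq_scale by (simp del: of_nat_Suc)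
  \<comment> \<open>This product would have degree \<open>2 * r + 2\<close>, above the top degree of
    A. Only \<open>wA ^ r * b\<close> is left, and it can vanish only with \<open>b\<close> because
    \<open>wA ^ r\<close> is nonzero.\<close>
  moreover have "wA ^ r * a = 0"
    using mult_A[OF power_wA[of r] assms(2)] A_outside'[of "2 * int r + 2"] by simp
  ultimately have "wA ^ r * b = 0" unfolding assms(1) by (simp add: distrib_left)
  then show ?thesis using no_zero_divisors[OF power_wA assms(3)] power_wA_nonzero by blast
qed

lemma D_wA_in_A: "D wA \<in> A 2"
proof -
  obtain a b where "a \<in> A 2" "b \<in> B 2" "D wA = a + b"
    using M_2[OF D_M[OF A_subset_M[OF wA]]] by (elim bexE)
  with D_wA_B_component[of a b] show ?thesis by simp
qed

text \<open>By symmetry \<open>D wB\<close> lies in \<open>B 2\<close>. Since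
  \<open>D wA = - D wB\<close>, it lies in both \<open>A 2\<close> and \<open>B 2\<close>, which
  meet in zero.\<close>

lemma D_wA: "D wA = 0"
proof -
  interpret sw: lefschetz_bigraded_algebra s B A dB dA "\<lambda>i j. pr j i" wB wA r' r D by (rule swap_lefschetz)
  have "D wA = - D wB" using D_w unfolding linear_add[OF linear_D] by (rule eq_neg_iff_add_eq_0[THEN iffD2])
  then have "D wA \<in> B 2" using subspace_neg[OF subspace_B sw.D_wA_in_A] by simp
  from A_Int_B[OF D_wA_in_A this] show ?thesis by simp
qed

lemma D_power_wA: "D (wA ^ e * x) = wA ^ e * D x"
proof (induction e)
  case (Suc e)
  then show ?case by (simp add: mult.assoc D_mult[of wA] D_wA)
qed simp

text \<open>
  The components of \<open>D\<close> in \<open>A (k - j) \<otimes> B j\<close> commute with \<open>wA\<close> and lower the degree in \<open>A\<close>. By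
  hard Lefschetz they vanish on primitive elements, hence on \<open>A\<close>.
\<close>

lemma pr_D_A: "x \<in> A k \<Longrightarrow> j > 0 \<Longrightarrow> pr (k - j) j (D x) = 0"
proof (induction "nat k" arbitrary: k x rule: less_induct)
  case less
  consider "k < 0 \<or> k > 2 * int r" | "0 \<le> k" "k \<le> int r" | "int r < k" "k \<le> 2 * int r" by linarith
  then show ?case
  proof cases
    case 1
    then have "x = 0" using A_outside'[of k] less.prems(1) by simp
    then show ?thesis by (simp add: linear_0[OF linear_D] linear_0[OF linear_pr])
  next
    case 2
    define e where "e = nat (int r - k)"
    have e: "k + int e = int r" using 2 by (simp add: e_def)
    have "wA ^ Suc e * x \<in> A (2 * int (Suc e) + k)" by (rule mult_A[OF power_wA less.prems(1)])
    also have "2 * int (Suc e) + k = (k - 2) + 2 * int (Suc (Suc e))" by simp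
    finally have mem: "wA ^ Suc e * x \<in> A ((k - 2) + 2 * int (Suc (Suc e)))" .
    \<comment> \<open>Lefschetz decomposition: \<open>y\<close> is chosen so that
      \<open>x - wA * y\<close> is primitive, that is, killed by \<open>wA ^ Suc e\<close>. The
      product \<open>wA ^ Suc e * x\<close> has degree \<open>2 * r - k + 2\<close>, which is above
      the top for \<open>k < 2\<close>; then \<open>y = 0\<close> serves.\<close>
    have "\<exists>y\<in>A (k - 2). wA ^ Suc e * x = wA ^ Suc (Suc e) * y \<and> (k < 2 \<longrightarrow> y = 0)"
    proof (cases "k < 2")
      case True
      then have "wA ^ Suc e * x = 0" using mem A_outside'[of "(k - 2) + 2 * int (Suc (Suc e))"] e by simp
      then show ?thesis using subspace_0[OF subspace_A] by (intro bexI[of _ 0]) simp_all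
    next
      case False
      then have "0 \<le> k - 2" "k - 2 + int (Suc (Suc e)) = int r" using e by simp_all
      from lefschetz_A_surj[OF mem this] show ?thesis using False by simp
    qed
    then obtain y where y: "y \<in> A (k - 2)" "wA ^ Suc e * x = wA ^ Suc (Suc e) * y" "k < 2 \<Longrightarrow> y = 0"
      by (elim bexE conjE) simp
    have "pr (k - 2 - j) j (D y) = 0"
    proof (cases "k < 2")
      case True
      then show ?thesis using y(3) by (simp add: linear_0[OF linear_D] linear_0[OF linear_pr])
    next
      case False
      then show ?thesis using less.hyps[of "k - 2" y] y(1) less.prems(2) by simp
    qed
    then have "pr (k - 2 - j + 2 * int 1) j (wA ^ 1 * D y) = 0"
      unfolding pr_power_wA by simp
    then have wy: "pr (k - j) j (D (wA * y)) = 0"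
      using D_power_wA[of 1 y] by simp
    have "pr (k - j) j (D (x - wA * y)) = 0"
    \<comment> \<open>The power that kills the primitive part is one more than the Lefschetz
      exponent of degree \<open>k\<close>. Since \<open>j \<ge> 1\<close>, we have
      \<open>(k - j) + (e + 1) \<le> r\<close>, so it is still injective on
      \<open>A (k - j)\<close>, and by \<open>inj_A\<close> also after tensoring with
      \<open>B j\<close>.\<close>
    proof (rule inj_A[OF power_wA[of "Suc e"]])
      show "a = 0" if "a \<in> A (k - j)" "wA ^ Suc e * a = 0" for a
        using lefschetz_A_inj[OF that(1) _ that(2)] e less.prems(2) by simp
      show "pr (k - j) j (D (x - wA * y)) \<in> span {a * b |a b. a \<in> A (k - j) \<and> b \<in> B j}"
        using pr_in_W unfolding W_def .
      have "wA ^ Suc e * (x - wA * y) = 0"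
        unfolding right_diff_distrib y(2) power_Suc2[of wA "Suc e"] mult.assoc by (rule diff_self)
      then have "wA ^ Suc e * D (x - wA * y) = 0"
        using D_power_wA[of "Suc e" "x - wA * y"] linear_0[OF linear_D] by simp
      then show "wA ^ Suc e * pr (k - j) j (D (x - wA * y)) = 0"
        unfolding pr_power_wA[symmetric] by (simp only: linear_0[OF linear_pr])
    qed simp
    then show ?thesis using wy by (simp add: linear_diff[OF linear_D] linear_diff[OF linear_pr])
  next
    case 3
    \<comment> \<open>\<open>k'\<close> is the reflection of \<open>k\<close> in the middle degree
      \<open>r\<close>. Lefschetz writes \<open>x\<close> as a power of \<open>wA\<close> times an
      element of the smaller degree \<open>k'\<close>, to which induction applies.\<close>
    define k' e where "k' = 2 * int r - k" and "e = nat (k - int r)"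
    have k': "k = k' + 2 * int e" "0 \<le> k'" "k' + int e = int r" "nat k' < nat k"
      "k - j = k' - j + 2 * int e"
      using 3 by (auto simp: k'_def e_def)
    obtain y where y: "y \<in> A k'" "x = wA ^ e * y"
      using lefschetz_A_surj[OF less.prems(1)[unfolded k'(1)] k'(2,3)] by (elim bexE)
    have "pr (k' - j) j (D y) = 0" by (rule less.hyps[OF k'(4) y(1) less.prems(2)])
    then show ?thesis unfolding y(2) D_power_wA k'(5) pr_power_wA by simp
  qed
qed

lemma D_A: "x \<in> A k \<Longrightarrow> D x \<in> A k"
  using M_subset_A[OF D_M[OF A_subset_M]] pr_D_A by blast

section \<open>Primitive elements and the bilinear form of the first factor\<close>

lemma primitive_A:
  assumes "wA ^ Suc e * x = 0" "N > e + r'"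
  shows "(wA + wB) ^ N * x = 0"
  by (rule binomial_mult_eq_0[OF wA_wB assms(1) _ assms(2)]) (simp only: power_wB_Suc mult_zero_left)

text \<open>Both sides are multiples of \<open>wA ^ r * wB ^ r'\<close>: the Lefschetz power
  \<open>e + r'\<close> contributes the coefficient \<open>(e + r') choose e\<close>, the top power
  \<open>(r + r') choose r\<close>. On primitive elements the two forms thus differ by a positive
  rational factor, which preserves the sign in the Riemann relations.\<close>

lemma form_A:
  assumes "x \<in> A k" "y \<in> A k" "wA ^ Suc e * x = 0" "k + int e = int r"
  shows "\<exists>z. wA ^ e * x * y = s z (wA ^ r) \<and>
    (wA + wB) ^ (e + r') * x * y =
      s (z * (of_nat ((e + r') choose e) / of_nat ((r + r') choose r))) ((wA + wB) ^ (r + r'))"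
proof -
  have "2 * int e + k + k = 2 * int r" using assms(4) by simp
  then have "wA ^ e * x * y \<in> A (2 * int r)"
    using mult_A[OF mult_A[OF power_wA[of e] assms(1)] assms(2)] by simp
  then obtain z where z: "wA ^ e * x * y = s z (wA ^ r)" using A_top_eq by (elim exE[rotated])
  have "(wA + wB) ^ (e + r') * x = of_nat ((e + r') choose e) * (wA ^ e * wB ^ r' * x)"
    by (rule binomial_mult_eq_single[OF wA_wB assms(3)]) (simp only: power_wB_Suc mult_zero_left)
  then have "(wA + wB) ^ (e + r') * x * y = of_nat ((e + r') choose e) * (wA ^ e * wB ^ r' * x * y)"
    by (simp add: mult.assoc)
  also have "wA ^ e * wB ^ r' * x * y = wA ^ e * x * y * wB ^ r'"
    by (metis mult.assoc power_wB_central)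
  also have "\<dots> = s z (wA ^ r * wB ^ r')" unfolding z by (rule mult_scale_left)
  also have "of_nat ((e + r') choose e) * \<dots> =
      s (z * (of_nat ((e + r') choose e) / of_nat ((r + r') choose r))) ((wA + wB) ^ (r + r'))"
    unfolding power_w of_nat_mult_eq_scale by simp
  finally show ?thesis using z by blast
qed

end

section \<open>Hodge decompositions\<close>

text \<open>Applying \<open>D - l k\<close> to the sum removes the \<open>k\<close>-th eigenvector
  and multiplies each other one by the nonzero number \<open>l i - l k\<close>, which allows
  induction on \<open>K\<close>.\<close>

lemma eigenvector_components_in_invariant_subspace:
  assumes D: "Vector_Spaces.linear s s D" and V: "module.subspace s V" "\<And>x. x \<in> V \<Longrightarrow> D x \<in> V"
    and "finite K" "inj_on l K" "\<And>i. i \<in> K \<Longrightarrow> D (f i) = s (l i) (f i)" "(\<Sum>i\<in>K. f i) \<in> V" "j \<in> K"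
  shows "f j \<in> V"
  using assms(4-)
proof (induction K arbitrary: f j rule: finite_induct)
  case (insert k K)
  interpret vector_space s by (rule linear_dom[OF D])
  have mem: "f i \<in> V" if "i \<in> K" for i
  proof -
    let ?g = "\<lambda>i. s (l i - l k) (f i)"
    have "D (\<Sum>i\<in>insert k K. f i) - s (l k) (\<Sum>i\<in>insert k K. f i) \<in> V"
      by (intro subspace_diff[OF V(1)] subspace_scale[OF V(1)] V(2) insert.prems)
    also have "D (\<Sum>i\<in>insert k K. f i) - s (l k) (\<Sum>i\<in>insert k K. f i) = (\<Sum>i\<in>insert k K. ?g i)"
      unfolding linear_sum[OF D] scale_sum_right sum_subtractf[symmetric]
      by (rule sum.cong) (simp_all only: insert.prems(2) scale_left_diff_distrib)
    also have "\<dots> = (\<Sum>i\<in>K. ?g i)" using insert.hyps by simp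
    finally have "(\<Sum>i\<in>K. ?g i) \<in> V" .
    moreover have "D (?g i) = s (l i) (?g i)" if "i \<in> K" for i
      using insert.prems(2)[of i] that unfolding linear_scale[OF D] by (simp add: mult.commute)
    moreover have "inj_on l K" using insert.prems(1) by (rule inj_on_subset) blast
    ultimately have "?g i \<in> V" using insert.IH[of ?g i] that by blast
    then have "s (inverse (l i - l k)) (?g i) \<in> V" by (rule subspace_scale[OF V(1)])
    moreover have "l i \<noteq> l k" using insert.prems(1) insert.hyps that by (metis inj_on_contraD insertCI)
    ultimately show ?thesis by simp
  qed
  have "(\<Sum>i\<in>insert k K. f i) - (\<Sum>i\<in>K. f i) \<in> V"
    by (intro subspace_diff[OF V(1)] subspace_sum[OF V(1)] insert.prems mem)
  then have "f k \<in> V" using insert.hyps by simp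
  then show ?case using mem insert.prems(4) by blast
qed simp

section \<open>The derivation attached to a Hodge structure\<close>

locale hodge_algebra = complex_cohomology_algebra s G m sC c
  for s :: "'f::rational_or_real_field \<Rightarrow> 'a::ring_1 \<Rightarrow> 'a" and G m
    and sC :: "complex \<Rightarrow> 'ac::ring_1 \<Rightarrow> 'ac" and c +
  fixes H :: "int \<Rightarrow> int \<Rightarrow> 'ac set"
  assumes hodge: "hodge_structure sC c G H"
begin

lemma weight: "hodge_structure_of_weight sC c (G k) k H"
  using hodge unfolding hodge_structure_def by (elim conjE allE)

lemma H_mult: "x \<in> H p q \<Longrightarrow> y \<in> H p' q' \<Longrightarrow> x * y \<in> H (p + p') (q + q')"
  using hodge unfolding hodge_structure_def by simp

lemma subspace_H: "C.subspace (H p q)"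
  using weight[of "p + q"] unfolding hodge_structure_of_weight_def by simp

lemma conj_H: "\<sigma> ` H p q = H q p"
  using weight[of "p + q"] unfolding hodge_structure_of_weight_def by simp

lemma conj_mem_H: "x \<in> H p q \<Longrightarrow> \<sigma> x \<in> H q p"
  using conj_H by blast

sublocale H: direct_sum sC "\<lambda>(p, q). H p q" "{(p, q). p + q = k}" "cp (G k)" for k
proof
  show "internal_direct_sum (\<lambda>(p, q). H p q) {(p, q). p + q = k} (cp (G k))"
    using weight[of k] unfolding hodge_structure_of_weight_def by simp
qed (auto simp: subspace_H subspace_cp)

lemma H_subset: "H p q \<subseteq> cp (G (p + q))"
  using H.W_subset[of "(p, q)" "p + q"] by simp

lemma H_induct [case_names zero add mem]:
  assumes "P 0" "\<And>x y. P x \<Longrightarrow> P y \<Longrightarrow> P (x + y)" "\<And>p q x. x \<in> H p q \<Longrightarrow> P x"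
  shows "P x"
proof -
  have *: "P (proj k x)" for k
    using proj_in_cp
  proof (induction rule: H.direct_sum_induct)
    case (mem i x)
    then show ?case using assms(3) by (cases i) simp
  qed (fact assms)+
  have "P (\<Sum>k\<in>K. proj k x)" for K
    by (induction K rule: infinite_finite_induct) (simp_all add: assms(1) assms(2) *)
  from this[of "{0..m}"] show ?thesis unfolding sum_proj[of x, symmetric] .
qed

text \<open>The Hodge decomposition is given degree by degree; passing first to degree
  \<open>p + q\<close> makes the projection linear on the whole complexification.\<close>

definition hproj :: "int \<Rightarrow> int \<Rightarrow> 'ac \<Rightarrow> 'ac" where
  "hproj p q x = component (\<lambda>(p, q). H p q) {(p', q'). p' + q' = p + q} (proj (p + q) x) (p, q)"

lemma linear_hproj: "Vector_Spaces.linear sC sC (hproj p q)"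
  by (rule linearI[OF vector_space_sC vector_space_sC])
    (simp_all add: hproj_def linear_add[OF linear_proj] linear_scale[OF linear_proj]
      H.component_add[OF proj_in_cp proj_in_cp] H.component_scale[OF proj_in_cp])

lemma hproj_in_H: "hproj p q x \<in> H p q"
  unfolding hproj_def using H.component_mem[OF proj_in_cp, of "(p, q)" "p + q" x] by simp

lemma hproj_H:
  assumes "x \<in> H p' q'"
  shows "hproj p q x = (if p = p' \<and> q = q' then x else 0)"
proof (cases "p + q = p' + q'")
  case True
  then have "proj (p + q) x = x" using proj_cp[OF subsetD[OF H_subset assms], of "p + q"] by simp
  then show ?thesis
    unfolding hproj_def using H.component_of[of "(p', q')" "p + q" x "(p, q)"] True assms by auto
next
  case False
  then have "proj (p + q) x = 0" using proj_cp[OF subsetD[OF H_subset assms], of "p + q"] by simp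
  then have "hproj p q x = hproj p q 0"
    unfolding hproj_def by (simp add: linear_0[OF linear_proj])
  then show ?thesis using False by (auto simp: linear_0[OF linear_hproj])
qed

lemma component_eq_hproj:
  assumes "x \<in> cp (G k)" "p + q = k"
  shows "component (\<lambda>(p, q). H p q) {(p, q). p + q = k} x (p, q) = hproj p q x"
  unfolding hproj_def assms(2) using proj_cp[OF assms(1), of k] by simp

lemma cp_eq_sum_hproj:
  assumes "x \<in> cp (G k)"
  obtains K where "finite K" "x = (\<Sum>p\<in>K. hproj p (k - p) x)" "\<And>p. p \<notin> K \<Longrightarrow> hproj p (k - p) x = 0"
proof
  let ?f = "component (\<lambda>(p, q). H p q) {(p, q). p + q = k} x"
  let ?K = "{p. hproj p (k - p) x \<noteq> 0}"
  have f: "?f (p, q) = (if p + q = k then hproj p q x else 0)" for p q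
    using component_eq_hproj[OF assms] H.component_outside[OF assms, of "(p, q)"] by simp
  have supp: "{i. ?f i \<noteq> 0} = (\<lambda>p. (p, k - p)) ` ?K"
    by (auto simp: f image_iff split: if_splits)
  show "finite ?K"
    using H.finite_component[OF assms] unfolding supp by (rule finite_imageD) (simp add: inj_on_def)
  have "x = (\<Sum>i | ?f i \<noteq> 0. ?f i)" by (rule H.sum_component[OF assms])
  also have "\<dots> = (\<Sum>p\<in>?K. ?f (p, k - p))"
    unfolding supp by (subst sum.reindex) (simp_all add: inj_on_def)
  finally show "x = (\<Sum>p\<in>?K. hproj p (k - p) x)" unfolding f by simp
qed simp

text \<open>Guarantees that the sum defining \<open>D\<close> is a genuine finite sum.\<close>

lemma finite_hproj: "finite {(p, q). hproj p q x \<noteq> 0}"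
proof (induction x rule: H_induct)
  case zero
  show ?case by (simp add: linear_0[OF linear_hproj])
next
  case (add x y)
  have "{(p, q). hproj p q (x + y) \<noteq> 0} \<subseteq> {(p, q). hproj p q x \<noteq> 0} \<union> {(p, q). hproj p q y \<noteq> 0}"
    by (auto simp: linear_add[OF linear_hproj])
  then show ?case by (rule finite_subset) (simp add: add)
next
  case (mem p q x)
  have "{(p', q'). hproj p' q' x \<noteq> 0} \<subseteq> {(p, q)}"
    using hproj_H[OF mem] by auto
  then show ?case by (rule finite_subset) simp
qed

text \<open>The derivation whose eigenspaces in each degree are the spaces of the Hodge decomposition.\<close>

definition D :: "'ac \<Rightarrow> 'ac" where
  "D x = (\<Sum>(p, q) | hproj p q x \<noteq> 0. sC (of_int (p - q)) (hproj p q x))"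

lemma D_superset:
  assumes "finite K" "{(p, q). hproj p q x \<noteq> 0} \<subseteq> K"
  shows "D x = (\<Sum>(p, q)\<in>K. sC (of_int (p - q)) (hproj p q x))"
  unfolding D_def by (rule sum.mono_neutral_left) (use assms in auto)

lemma linear_D: "Vector_Spaces.linear sC sC D"
proof (rule linearI[OF vector_space_sC vector_space_sC])
  fix x y r
  let ?S = "\<lambda>x. {(p, q). hproj p q x \<noteq> 0}"
  have K: "finite (?S x \<union> ?S y)" using finite_hproj by simp
  have "D (x + y) = (\<Sum>(p, q)\<in>?S x \<union> ?S y. sC (of_int (p - q)) (hproj p q (x + y)))"
    by (rule D_superset[OF K]) (auto simp: linear_add[OF linear_hproj])
  then show "D (x + y) = D x + D y"
    using D_superset[OF K, of x] D_superset[OF K, of y]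
    by (simp add: linear_add[OF linear_hproj] C.scale_right_distrib sum.distrib split_beta)
  have "D (sC r x) = (\<Sum>(p, q)\<in>?S x. sC (of_int (p - q)) (hproj p q (sC r x)))"
    by (rule D_superset[OF finite_hproj]) (auto simp: linear_scale[OF linear_hproj])
  then show "D (sC r x) = sC r (D x)"
    unfolding D_def by (simp add: linear_scale[OF linear_hproj] C.scale_sum_right split_beta mult.commute)
qed

lemma D_H:
  assumes "x \<in> H p q"
  shows "D x = sC (of_int (p - q)) x"
proof -
  have "D x = (\<Sum>(p, q)\<in>{(p, q)}. sC (of_int (p - q)) (hproj p q x))"
    by (rule D_superset) (use hproj_H[OF assms] in auto)
  then show ?thesis using hproj_H[OF assms, of p q] by simp
qed

text \<open>The Leibniz rule is the additivity of the eigenvalue \<open>p - q\<close> under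
  multiplication, checked on elements of pure type.\<close>

lemma D_mult: "D (x * y) = D x * y + x * D y"
proof (induction x rule: H_induct)
  case (mem p q x)
  show ?case
  proof (induction y rule: H_induct)
    case (mem p' q' y)
    show ?case
      unfolding D_H[OF H_mult[OF \<open>x \<in> H p q\<close> mem]] D_H[OF mem] D_H[OF \<open>x \<in> H p q\<close>] mult_scale
        C.scale_left_distrib[symmetric] by (simp add: algebra_simps)
  qed (simp_all add: linear_0[OF linear_D] linear_add[OF linear_D] distrib_left)
qed (simp_all add: linear_0[OF linear_D] linear_add[OF linear_D] distrib_right)

lemma D_cp:
  assumes "x \<in> cp (G k)"
  shows "D x \<in> cp (G k)"
  using assms
proof (induction rule: H.direct_sum_induct)
  case zero
  then show ?case by (simp add: linear_0[OF linear_D] C.subspace_0[OF subspace_cp])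
next
  case (add x y)
  then show ?case by (simp add: linear_add[OF linear_D] C.subspace_add[OF subspace_cp])
next
  case (mem i x)
  then obtain p q where "x \<in> H p q" "p + q = k" by (cases i) auto
  then show ?case
    using D_H[of x p q] H_subset[of p q] C.subspace_scale[OF subspace_cp] by auto
qed

text \<open>In degree \<open>k\<close> the eigenvalue on the piece of type \<open>(p, k - p)\<close>
  is \<open>2 * p - k\<close>, which determines \<open>p\<close>; so the Hodge components of
  \<open>x\<close> are eigenvectors for distinct eigenvalues.\<close>

lemma hproj_in_invariant_subspace:
  assumes V: "C.subspace V" "\<And>x. x \<in> V \<Longrightarrow> D x \<in> V" and x: "x \<in> V" "x \<in> cp (G k)" and "p + q = k"
  shows "hproj p q x \<in> V"
proof -
  obtain K where K: "finite K" "x = (\<Sum>p\<in>K. hproj p (k - p) x)" "\<And>p. p \<notin> K \<Longrightarrow> hproj p (k - p) x = 0"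
    by (rule cp_eq_sum_hproj[OF x(2)]) (rule that)
  have q: "q = k - p" using assms(5) by simp
  show ?thesis
  proof (cases "p \<in> K")
    case True
    show ?thesis
      unfolding q
    proof (rule eigenvector_components_in_invariant_subspace[OF linear_D V K(1) _ _ _ True])
      show "inj_on (\<lambda>p. of_int (p - (k - p)) :: complex) K" by (auto simp: inj_on_def)
      show "D (hproj p (k - p) x) = sC (of_int (p - (k - p))) (hproj p (k - p) x)" for p
        by (rule D_H[OF hproj_in_H])
      show "(\<Sum>p\<in>K. hproj p (k - p) x) \<in> V" unfolding K(2)[symmetric] by (rule x(1))
    qed
  next
    case False
    then show ?thesis unfolding q using K(3) C.subspace_0[OF V(1)] by simp
  qed
qed

text \<open>\<open>D\<close> commutes with the Hodge projections, so each component of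
  \<open>x\<close> is killed by its own eigenvalue \<open>2 * p' - 2 * p\<close>, which is nonzero
  unless \<open>p' = p\<close>.\<close>

lemma D_eq_0_imp_in_H:
  assumes "x \<in> cp (G (2 * p))" "D x = 0"
  shows "x \<in> H p p"
proof -
  obtain K where K: "finite K" "x = (\<Sum>p'\<in>K. hproj p' (2 * p - p') x)"
    "\<And>p'. p' \<notin> K \<Longrightarrow> hproj p' (2 * p - p') x = 0"
    by (rule cp_eq_sum_hproj[OF assms(1)]) (rule that)
  have "hproj p' (2 * p - p') x = 0" if "p' \<noteq> p" for p'
  proof -
    have comm: "hproj p' q' (D y) = D (hproj p' q' y)" for q' y
    proof (induction y rule: H_induct)
      case (mem a b y)
      then show ?case
        by (simp add: D_H[OF mem] linear_scale[OF linear_hproj] hproj_H[OF mem] linear_0[OF linear_D])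
    qed (simp_all add: linear_0[OF linear_D] linear_0[OF linear_hproj] linear_add[OF linear_D]
        linear_add[OF linear_hproj])
    have "D (hproj p' (2 * p - p') x) = 0"
      using comm[of "2 * p - p'" x] unfolding assms(2) linear_0[OF linear_hproj] by simp
    then have "sC (of_int (p' - (2 * p - p'))) (hproj p' (2 * p - p') x) = 0"
      unfolding D_H[OF hproj_in_H] .
    then have "(of_int (p' - (2 * p - p')) :: complex) = 0 \<or> hproj p' (2 * p - p') x = 0"
      unfolding C.scale_eq_0_iff .
    then show ?thesis using that unfolding of_int_eq_0_iff by auto
  qed
  then have "(\<Sum>p'\<in>K. hproj p' (2 * p - p') x) = (\<Sum>p'\<in>K. if p' = p then hproj p p x else 0)"
    by (intro sum.cong) auto
  then have "x = (if p \<in> K then hproj p p x else 0)" using K(1,2) by simp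
  then show ?thesis using hproj_in_H[of p p x] C.subspace_0[OF subspace_H[of p p]] by (metis (full_types))
qed

end

section \<open>Hodge structures and polarizations induced on an embedded factor\<close>

locale hodge_embedding =
  X: complex_cohomology_algebra sX GX dX sXC cX +
  M: hodge_algebra sM GM dM sMC cM HM
  for sX :: "'f::rational_or_real_field \<Rightarrow> 'x::ring_1 \<Rightarrow> 'x" and GX dX
    and sXC :: "complex \<Rightarrow> 'xc::ring_1 \<Rightarrow> 'xc" and cX
    and sM :: "'f \<Rightarrow> 'm::ring_1 \<Rightarrow> 'm" and GM dM
    and sMC :: "complex \<Rightarrow> 'mc::ring_1 \<Rightarrow> 'mc" and cM HM +
  fixes \<iota> :: "'xc \<Rightarrow> 'mc"
  assumes linear_embedding: "Vector_Spaces.linear sXC sMC \<iota>"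
    and embedding_mult: "\<iota> (x * y) = \<iota> x * \<iota> y"
    and embedding_1: "\<iota> 1 = 1"
    and embedding_eq_0: "\<iota> x = 0 \<Longrightarrow> x = 0"
    and conj_embedding: "M.\<sigma> (\<iota> x) = \<iota> (X.\<sigma> x)"
    and embedding_cp: "x \<in> X.cp (GX k) \<Longrightarrow> \<iota> x \<in> M.cp (GM k)"
    and D_embedding: "x \<in> X.cp (GX k) \<Longrightarrow> M.D (\<iota> x) \<in> \<iota> ` X.cp (GX k)"
begin

definition H :: "int \<Rightarrow> int \<Rightarrow> 'xc set" where
  "H p q = {x. \<iota> x \<in> HM p q}"

lemma embedding_eq: "\<iota> x = \<iota> y \<Longrightarrow> x = y"
  using embedding_eq_0[of "x - y"] by (simp add: linear_diff[OF linear_embedding])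

lemma embedding_power: "\<iota> (x ^ n) = \<iota> x ^ n"
  by (induction n) (simp_all add: embedding_1 embedding_mult)

lemma subspace_embedding: "M.C.subspace (\<iota> ` X.cp V)"
proof -
  interpret L: Vector_Spaces.linear sXC sMC \<iota> by (rule linear_embedding)
  show ?thesis by (rule L.subspace_image[OF X.subspace_cp])
qed

lemma subspace_H: "X.C.subspace (H p q)"
proof -
  interpret L: Vector_Spaces.linear sXC sMC \<iota> by (rule linear_embedding)
  show ?thesis unfolding H_def by (rule L.subspace_linear_preimage[OF M.subspace_H])
qed

text \<open>As a preimage, \<open>H p q\<close> is defined without restricting the degree. The
  embedding commutes with the degree projections, so by injectivity the degree of
  \<open>\<iota> x\<close> is that of \<open>x\<close>.\<close>

lemma H_subset: "x \<in> H p q \<Longrightarrow> x \<in> X.cp (GX (p + q))"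
proof -
  assume "x \<in> H p q"
  then have x: "\<iota> x \<in> M.cp (GM (p + q))" using M.H_subset unfolding H_def by blast
  have "M.proj i (\<iota> x) = \<iota> (X.proj i x)" for i
  proof -
    have "M.proj i (\<iota> x) = (\<Sum>j\<in>{0..dX}. M.proj i (\<iota> (X.proj j x)))"
      by (subst X.sum_proj[of x]) (simp only: linear_sum[OF linear_embedding] linear_sum[OF M.linear_proj])
    also have "\<dots> = (\<Sum>j\<in>{0..dX}. if i = j then \<iota> (X.proj j x) else 0)"
      by (intro sum.cong refl M.proj_cp embedding_cp X.proj_in_cp)
    also have "\<dots> = \<iota> (X.proj i x)"
    proof (cases "i \<in> {0..dX}")
      case False
      then have "X.proj i x = 0" using X.proj_in_cp[of i x] X.cp_outside[of i] by auto
      then show ?thesis using False by (simp add: linear_0[OF linear_embedding])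
    qed simp
    finally show ?thesis .
  qed
  then have "\<iota> (X.proj (p + q) x) = \<iota> x" using M.proj_cp[OF x, of "p + q"] by simp
  then have "X.proj (p + q) x = x" by (rule embedding_eq)
  then show "x \<in> X.cp (GX (p + q))" using X.proj_in_cp[of "p + q" x] by simp
qed

text \<open>By \<open>D_embedding\<close> the image of each degree of X is stable under
  \<open>D\<close>, hence contains the Hodge components of its elements. They pull back to X, and
  injectivity of \<open>\<iota>\<close> transfers independence of the pieces.\<close>

lemma hodge: "hodge_structure sXC cX GX H"
  unfolding hodge_structure_def hodge_structure_of_weight_def
proof (intro conjI allI impI ballI)
  show "X.C.subspace (H p q)" for p q by (rule subspace_H)
  show "x * y \<in> H (p + p') (q + q')" if "x \<in> H p q" "y \<in> H p' q'" for p q p' q' x y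
    using M.H_mult that unfolding H_def by (simp add: embedding_mult)
  show "X.\<sigma> ` H p q = H q p" for p q
  proof -
    have *: "X.\<sigma> x \<in> H q p" if "x \<in> H p q" for p q x
      using M.conj_mem_H that unfolding H_def by (simp flip: conj_embedding)
    have "x \<in> X.\<sigma> ` H p q" if "x \<in> H q p" for x
      using *[OF that] X.conj_conj[of x] by (metis imageI)
    with * show ?thesis by blast
  qed
  fix k
  interpret F: subspace_family sXC "\<lambda>(p, q). H p q" "{(p, q). p + q = k}"
    by unfold_locales (auto simp: subspace_H)
  show "internal_direct_sum (\<lambda>(p, q). H p q) {(p, q). p + q = k} (X.cp (GX k))"
  proof (rule F.internal_direct_sumI)
    show "(case i of (p, q) \<Rightarrow> H p q) \<subseteq> X.cp (GX k)" if "i \<in> {(p, q). p + q = k}" for i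
      using that H_subset by auto
  next
    fix x assume x: "x \<in> X.cp (GX k)"
    obtain K where K: "finite K" "\<iota> x = (\<Sum>p\<in>K. M.hproj p (k - p) (\<iota> x))"
      by (rule M.cp_eq_sum_hproj[OF embedding_cp[OF x]]) (rule that)
    have "\<exists>y. M.hproj p (k - p) (\<iota> x) = \<iota> y" for p
    proof -
      have "M.hproj p (k - p) (\<iota> x) \<in> \<iota> ` X.cp (GX k)"
      proof (rule M.hproj_in_invariant_subspace[OF subspace_embedding _ imageI[OF x] embedding_cp[OF x]])
        show "M.D z \<in> \<iota> ` X.cp (GX k)" if "z \<in> \<iota> ` X.cp (GX k)" for z
          using that D_embedding by blast
      qed simp
      then show ?thesis by blast
    qed
    then obtain g where g: "\<And>p. M.hproj p (k - p) (\<iota> x) = \<iota> (g p)" by metis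
    have "\<iota> x = \<iota> (\<Sum>p\<in>K. g p)" using K(2) unfolding g linear_sum[OF linear_embedding] .
    then have "x = (\<Sum>p\<in>K. g p)" by (rule embedding_eq)
    moreover have "\<exists>f. is_decomposition (\<lambda>(p, q). H p q) {(p, q). p + q = k} f (g p)" for p
    proof -
      have "g p \<in> H p (k - p)" unfolding H_def using M.hproj_in_H[of p "k - p" "\<iota> x"] g by simp
      then show ?thesis using F.is_decomposition_single[of "(p, k - p)" "g p"] by auto
    qed
    ultimately show "\<exists>f. is_decomposition (\<lambda>(p, q). H p q) {(p, q). p + q = k} f x"
      using F.is_decomposition_exists_sum[of K g] by simp
  next
    fix f i assume f: "is_decomposition (\<lambda>(p, q). H p q) {(p, q). p + q = k} f 0"
    define K where "K = {i. f i \<noteq> 0}"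
    have K: "finite K" "0 = (\<Sum>i\<in>K. f i)" using f unfolding is_decomposition_def K_def by simp_all
    have "is_decomposition (\<lambda>(p, q). HM p q) {(p, q). p + q = k} (\<lambda>i. \<iota> (f i)) 0"
    proof (rule M.H.is_decompositionI[OF K(1)])
      show "0 = (\<Sum>i\<in>K. \<iota> (f i))"
        using K(2) by (simp flip: linear_sum[OF linear_embedding] add: linear_0[OF linear_embedding])
    qed (use f in \<open>auto simp: is_decomposition_def H_def K_def linear_0[OF linear_embedding]\<close>)
    then have "\<iota> (f i) = 0" by (rule M.H.is_decomposition_unique_zero)
    then show "f i = 0" by (rule embedding_eq_0)
  qed
qed

text \<open>The Lefschetz hypotheses are complex and one-sided, as the algebraic part delivers them;
  conjugation brings them down to real points. In \<open>pos\<close> the value of the form is given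
  by an explicit \<open>z\<close>, which \<open>nonzero\<close> identifies with the one described by
  \<open>q_form\<close>.\<close>

lemma polarization:
  assumes w: "w \<in> X.cp (GX 2)" "\<iota> w \<in> HM 1 1" "X.\<sigma> w = w"
    and central: "\<And>x e. w ^ e * x = x * w ^ e"
    and inj: "\<And>x k e. x \<in> X.cp (GX k) \<Longrightarrow> k + int e = int r \<Longrightarrow> w ^ e * x = 0 \<Longrightarrow> x = 0"
    and surj: "\<And>y k e. y \<in> X.cp (GX (k + 2 * int e)) \<Longrightarrow> 0 \<le> k \<Longrightarrow> k + int e = int r \<Longrightarrow>
      \<exists>x\<in>X.cp (GX k). y = w ^ e * x"
    and pos: "\<And>k e p q x. k + e = r \<Longrightarrow> p + q = int k \<Longrightarrow> x \<in> H p q \<Longrightarrow> x \<noteq> 0 \<Longrightarrow> w ^ Suc e * x = 0 \<Longrightarrow>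
      \<exists>z. w ^ e * x * X.\<sigma> x = sXC z (w ^ r) \<and>
        (let u = (-1) ^ (k * (k - 1) div 2) * \<i> powi (p - q - int k) * (\<i> ^ k * z) in u \<in> \<real> \<and> Re u > 0)"
    and nonzero: "w ^ r \<noteq> 0"
  shows "polarization sXC cX GX r H w"
  unfolding polarization_def X.real_part_eq
proof (intro conjI allI impI ballI)
  show "w \<in> H 1 1 \<inter> {x \<in> X.cp (GX 2). X.\<sigma> x = x}" using w by (simp add: H_def)
  have conj_w: "X.\<sigma> (w ^ e) = w ^ e" for e
  proof (induction e)
    case 0
    then show ?case using X.conj_c[of 1] by (simp add: X.c_1)
  qed (simp add: X.conj_mult w(3))
  show "bij_betw (\<lambda>x. x * w ^ (r - k)) {x \<in> X.cp (GX (int k)). X.\<sigma> x = x}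
      {x \<in> X.cp (GX (2 * int r - int k)). X.\<sigma> x = x}" if "k \<le> r" for k
  proof -
    define e where "e = r - k"
    have e: "int k + int e = int r" "2 * int r - int k = int k + 2 * int e" using that by (simp_all add: e_def)
    have w_e: "w ^ e \<in> X.cp (GX (2 * int e))"
    proof (induction e)
      case 0
      show ?case unfolding power_0 using X.c_in_cp[of 1 "GX 0"] X.graded_zero X.c_1
        by (metis mult_zero_right of_nat_0 rangeI X.scale_one)
    next
      case (Suc e)
      then show ?case using X.cp_mult[OF w(1) Suc] by (simp add: algebra_simps)
    qed
    have "inj_on (\<lambda>x. x * w ^ e) {x \<in> X.cp (GX (int k)). X.\<sigma> x = x}"
    proof (rule inj_onI)
      fix x y assume xy: "x \<in> {x \<in> X.cp (GX (int k)). X.\<sigma> x = x}" "y \<in> {x \<in> X.cp (GX (int k)). X.\<sigma> x = x}"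
        "x * w ^ e = y * w ^ e"
      have "x - y \<in> X.cp (GX (int k))" using xy X.C.subspace_diff[OF X.subspace_cp] by simp
      moreover have "w ^ e * (x - y) = 0" unfolding central left_diff_distrib xy(3) by simp
      ultimately have "x - y = 0" by (rule inj[OF _ e(1)])
      then show "x = y" by simp
    qed
    moreover have "(\<lambda>x. x * w ^ e) ` {x \<in> X.cp (GX (int k)). X.\<sigma> x = x} =
        {x \<in> X.cp (GX (int k + 2 * int e)). X.\<sigma> x = x}"
    proof (intro equalityI subsetI)
      fix y assume "y \<in> (\<lambda>x. x * w ^ e) ` {x \<in> X.cp (GX (int k)). X.\<sigma> x = x}"
      then obtain x where "x \<in> X.cp (GX (int k))" "X.\<sigma> x = x" "y = x * w ^ e" by blast
      then show "y \<in> {x \<in> X.cp (GX (int k + 2 * int e)). X.\<sigma> x = x}"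
        using X.cp_mult[OF _ w_e] by (simp add: X.conj_mult conj_w)
    next
      fix y assume y: "y \<in> {x \<in> X.cp (GX (int k + 2 * int e)). X.\<sigma> x = x}"
      then obtain x where x: "x \<in> X.cp (GX (int k))" "y = w ^ e * x"
        using surj[of y "int k" e] e(1) by auto
      \<comment> \<open>Since \<open>y\<close> and \<open>w\<close> are real,
        \<open>\<sigma> x\<close> is another preimage of \<open>y\<close>; injectivity makes
        \<open>x\<close> itself real.\<close>
      have "w ^ e * X.\<sigma> x = w ^ e * x" using y unfolding x(2) by (simp add: X.conj_mult conj_w)
      then have "w ^ e * (X.\<sigma> x - x) = 0" by (simp add: right_diff_distrib)
      then have "X.\<sigma> x - x = 0"
        by (rule inj[OF X.C.subspace_diff[OF X.subspace_cp X.conj_cp[OF x(1)] x(1)] e(1)])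
      then show "y \<in> (\<lambda>x. x * w ^ e) ` {x \<in> X.cp (GX (int k)). X.\<sigma> x = x}"
        using x central by (intro image_eqI[of _ _ x]) simp_all
    qed
    ultimately show ?thesis unfolding bij_betw_def e(2) e_def[symmetric] by blast
  qed
  show "let u = (-1) ^ (k * (k - 1) div 2) * \<i> powi (p - q - int k) * h_form sXC cX r w k x x
        in u \<in> \<real> \<and> Re u > 0"
    if "k \<le> r" "p + q = int k" "x \<in> primitive_part H r w k p q" "x \<noteq> 0" for k p q x
  proof -
    have e: "k + (r - k) = r" "r + 1 - k = Suc (r - k)" using that(1) by simp_all
    have x: "x \<in> H p q" "w ^ Suc (r - k) * x = 0"
      using that(3) unfolding primitive_part_def e(2) central by simp_all
    note pos_x = pos[OF e(1) that(2) x(1) that(4) x(2)]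
    obtain z where z: "w ^ (r - k) * x * X.\<sigma> x = sXC z (w ^ r)"
      "let u = (-1) ^ (k * (k - 1) div 2) * \<i> powi (p - q - int k) * (\<i> ^ k * z) in u \<in> \<real> \<and> Re u > 0"
      using pos_x by (elim exE conjE)
    have "q_form sXC r w k x (X.\<sigma> x) = z"
      unfolding q_form_def z(1) using nonzero by (intro the_equality) simp_all
    then show ?thesis using z(2) unfolding h_form_def by simp
  qed
qed

end

section \<open>The two factors\<close>

context complex_tensor_product
begin

text \<open>\<open>T_mult\<close> asks for homogeneous inner factors, so \<open>x'\<close> is split
  into degrees. The other inner factor is 1, of degree 0, hence there is no sign.\<close>

lemma T_left_mult: "T (x * x') 1 = T x 1 * T x' 1"
proof -
  have 1: "1 \<in> B.cp (GB 0)" unfolding B.cp_0 by (rule range_eqI[of _ _ 1]) simp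
  have "T x 1 * T (A.proj j x') 1 = T (x * A.proj j x') 1" for j
    using T_mult[OF 1 A.proj_in_cp[of j x'], of x 1] by simp
  then have "(\<Sum>j\<in>{0..dA}. T x 1 * T (A.proj j x') 1) = (\<Sum>j\<in>{0..dA}. T (x * A.proj j x') 1)" by simp
  then have "T x 1 * T (\<Sum>j\<in>{0..dA}. A.proj j x') 1 = T (x * (\<Sum>j\<in>{0..dA}. A.proj j x')) 1"
    by (simp add: sum_distrib_left linear_sum[OF T_linear_left])
  then show ?thesis unfolding A.sum_proj[of x', symmetric] by (rule sym)
qed

lemma T_right_mult: "T 1 (y * y') = T 1 y * T 1 y'"
proof -
  have 1: "1 \<in> A.cp (GA 0)" unfolding A.cp_0 by (rule range_eqI[of _ _ 1]) simp
  have "T 1 (B.proj j y) * T 1 y' = T 1 (B.proj j y * y')" for j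
    using T_mult[OF B.proj_in_cp[of j y] 1, of 1 y'] by simp
  then have "(\<Sum>j\<in>{0..dB}. T 1 (B.proj j y) * T 1 y') = (\<Sum>j\<in>{0..dB}. T 1 (B.proj j y * y'))" by simp
  then have "T 1 (\<Sum>j\<in>{0..dB}. B.proj j y) * T 1 y' = T 1 ((\<Sum>j\<in>{0..dB}. B.proj j y) * y')"
    by (simp add: sum_distrib_right linear_sum[OF T_linear_right])
  then show ?thesis unfolding B.sum_proj[of y, symmetric] by (rule sym)
qed

lemma T_eq_mult: "T x y = T x 1 * T 1 y"
proof -
  have "1 \<in> A.cp (GA 0)" unfolding A.cp_0 by (rule range_eqI[of _ _ 1]) simp
  moreover have "1 \<in> B.cp (GB 0)" unfolding B.cp_0 by (rule range_eqI[of _ _ 1]) simp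
  ultimately show ?thesis using T_mult[of 1 0 1 0 x y] by simp
qed

lemma T_left_eq_0: "T x 1 = 0 \<Longrightarrow> x = 0"
  using T_eq_0[of x 1] by simp

lemma T_right_eq_0: "T 1 y = 0 \<Longrightarrow> y = 0"
  using T_eq_0[of 1 y] by simp

definition A' :: "int \<Rightarrow> 'mc set" where "A' i = (\<lambda>x. T x 1) ` A.cp (GA i)"
definition B' :: "int \<Rightarrow> 'mc set" where "B' j = (\<lambda>y. T 1 y) ` B.cp (GB j)"

lemma A'_E: assumes "a \<in> A' i" obtains x where "a = T x 1" "x \<in> A.cp (GA i)"
  using assms unfolding A'_def by blast

lemma B'_E: assumes "b \<in> B' j" obtains y where "b = T 1 y" "y \<in> B.cp (GB j)"
  using assms unfolding B'_def by blast

lemma A'_I: "x \<in> A.cp (GA i) \<Longrightarrow> T x 1 \<in> A' i"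
  unfolding A'_def by (rule imageI)

lemma B'_I: "y \<in> B.cp (GB j) \<Longrightarrow> T 1 y \<in> B' j"
  unfolding B'_def by (rule imageI)

lemma A'_B'_commute:
  assumes "x \<in> A.cp (GA i)" "y \<in> B.cp (GB j)"
  shows "T x 1 * T 1 y = (if odd (i * j) then - (T 1 y * T x 1) else T 1 y * T x 1)"
  using T_mult[OF assms(2,1), of 1 1] T_eq_mult[of x y] by (auto simp: mult.commute)

lemma products_eq:
  "{a * b |a b. a \<in> A' i \<and> b \<in> B' j} = {T x y |x y. x \<in> A.cp (GA i) \<and> y \<in> B.cp (GB j)}"
proof (intro equalityI subsetI)
  fix z assume "z \<in> {a * b |a b. a \<in> A' i \<and> b \<in> B' j}"
  then obtain a b where ab: "z = a * b" "a \<in> A' i" "b \<in> B' j" by blast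
  then obtain x y where "a = T x 1" "x \<in> A.cp (GA i)" "b = T 1 y" "y \<in> B.cp (GB j)"
    by (elim A'_E B'_E)
  moreover from this have "z = T x y" unfolding ab(1) T_eq_mult[of x y] by simp
  ultimately show "z \<in> {T x y |x y. x \<in> A.cp (GA i) \<and> y \<in> B.cp (GB j)}" by blast
next
  fix z assume "z \<in> {T x y |x y. x \<in> A.cp (GA i) \<and> y \<in> B.cp (GB j)}"
  then obtain x y where "z = T x y" "x \<in> A.cp (GA i)" "y \<in> B.cp (GB j)" by blast
  then show "z \<in> {a * b |a b. a \<in> A' i \<and> b \<in> B' j}"
    using T_eq_mult[of x y] A'_I B'_I by blast
qed

lemma products_eq_UN:
  "{a * b |a b i j. a \<in> A' i \<and> b \<in> B' j \<and> P i j} = {T x y |x y i j. x \<in> A.cp (GA i) \<and> y \<in> B.cp (GB j) \<and> P i j}"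
proof -
  have "{a * b |a b i j. a \<in> A' i \<and> b \<in> B' j \<and> P i j} =
      (\<Union>(i, j)\<in>{(i, j). P i j}. {a * b |a b. a \<in> A' i \<and> b \<in> B' j})" by auto
  also have "\<dots> = {T x y |x y i j. x \<in> A.cp (GA i) \<and> y \<in> B.cp (GB j) \<and> P i j}"
    unfolding products_eq by auto
  finally show ?thesis .
qed

definition biproj :: "int \<Rightarrow> int \<Rightarrow> 'mc \<Rightarrow> 'mc" where
  "biproj i j = (SOME h. Vector_Spaces.linear sMC sMC h \<and> (\<forall>x y. h (T x y) = T (A.proj i x) (B.proj j y)))"

lemma linear_biproj: "Vector_Spaces.linear sMC sMC (biproj i j)"
  and biproj_T: "biproj i j (T x y) = T (A.proj i x) (B.proj j y)"
proof -
  obtain h where "Vector_Spaces.linear sMC sMC h" "\<And>x y. h (T x y) = T (A.proj i x) (B.proj j y)"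
    by (rule universal[OF bilinear_map_compose[OF A.linear_proj B.linear_proj]]) (rule that)
  then have "\<exists>h. Vector_Spaces.linear sMC sMC h \<and> (\<forall>x y. h (T x y) = T (A.proj i x) (B.proj j y))" by auto
  from someI_ex[OF this] show "Vector_Spaces.linear sMC sMC (biproj i j)"
    "biproj i j (T x y) = T (A.proj i x) (B.proj j y)" unfolding biproj_def by simp_all
qed

text \<open>A left inverse \<open>g\<close> of \<open>f\<close> on \<open>V\<close>, tensored with
  the identity, is a left inverse of \<open>h\<close> on the span of the tensors.\<close>

lemma inj_on_A_tensor:
  assumes f: "Vector_Spaces.linear sAC sAC f" and V: "A.C.subspace V" "\<And>x. x \<in> V \<Longrightarrow> f x = 0 \<Longrightarrow> x = 0"
    and h: "Vector_Spaces.linear sMC sMC h" "\<And>x y. x \<in> V \<Longrightarrow> y \<in> U \<Longrightarrow> h (T x y) = T (f x) y"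
    and v: "v \<in> M.C.span {T x y |x y. x \<in> V \<and> y \<in> U}" "h v = 0"
  shows "v = 0"
proof -
  have "inj_on f V"
  proof (rule inj_onI)
    fix x y assume "x \<in> V" "y \<in> V" "f x = f y"
    then have "x - y = 0"
      using V(2)[OF A.C.subspace_diff[OF V(1)]] by (simp add: linear_diff[OF f])
    then show "x = y" by simp
  qed
  moreover have "vector_space_pair sAC sAC"
    by (intro vector_space_pair.intro A.vector_space_sC)
  ultimately obtain g where g: "Vector_Spaces.linear sAC sAC g" "\<And>x. x \<in> V \<Longrightarrow> g (f x) = x"
    using vector_space_pair.linear_exists_left_inverse_on[OF _ f V(1)] by (metis (full_types))
  obtain k where k: "Vector_Spaces.linear sMC sMC k" "\<And>x y. k (T x y) = T (g x) y"
    by (rule universal[OF bilinear_map_compose[OF g(1) B.C.linear_ident]]) (rule that)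
  have "k (h v) = v"
  proof (rule linear_eq_on_span[OF linear_compose[OF h(1) k(1)] M.C.linear_ident v(1)])
    fix z assume "z \<in> {T x y |x y. x \<in> V \<and> y \<in> U}"
    then show "k (h z) = z" using h(2) k(2) g(2) by auto
  qed
  then show ?thesis using v(2) linear_0[OF k(1)] by simp
qed

lemma inj_on_B_tensor:
  assumes f: "Vector_Spaces.linear sBC sBC f" and V: "B.C.subspace V" "\<And>x. x \<in> V \<Longrightarrow> f x = 0 \<Longrightarrow> x = 0"
    and h: "Vector_Spaces.linear sMC sMC h" "\<And>x y. x \<in> U \<Longrightarrow> y \<in> V \<Longrightarrow> h (T x y) = T x (f y)"
    and v: "v \<in> M.C.span {T x y |x y. x \<in> U \<and> y \<in> V}" "h v = 0"
  shows "v = 0"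
proof -
  have "inj_on f V"
  proof (rule inj_onI)
    fix x y assume "x \<in> V" "y \<in> V" "f x = f y"
    then have "x - y = 0"
      using V(2)[OF B.C.subspace_diff[OF V(1)]] by (simp add: linear_diff[OF f])
    then show "x = y" by simp
  qed
  moreover have "vector_space_pair sBC sBC"
    by (intro vector_space_pair.intro B.vector_space_sC)
  ultimately obtain g where g: "Vector_Spaces.linear sBC sBC g" "\<And>x. x \<in> V \<Longrightarrow> g (f x) = x"
    using vector_space_pair.linear_exists_left_inverse_on[OF _ f V(1)] by (metis (full_types))
  obtain k where k: "Vector_Spaces.linear sMC sMC k" "\<And>x y. k (T x y) = T x (g y)"
    by (rule universal[OF bilinear_map_compose[OF A.C.linear_ident g(1)]]) (rule that)
  have "k (h v) = v"
  proof (rule linear_eq_on_span[OF linear_compose[OF h(1) k(1)] M.C.linear_ident v(1)])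
    fix z assume "z \<in> {T x y |x y. x \<in> U \<and> y \<in> V}"
    then show "k (h z) = z" using h(2) k(2) g(2) by auto
  qed
  then show ?thesis using v(2) linear_0[OF k(1)] by simp
qed

text \<open>The tensor of two nonzero top classes is nonzero in degree \<open>dA + dB\<close>. In
  larger degrees one factor of every pure tensor exceeds its top degree, whereas the degree
  \<open>dM\<close> part of M is nonzero.\<close>

lemma dim_eq: "dM = dA + dB"
proof (rule antisym)
  obtain a where a: "a \<noteq> 0" "a \<in> A.cp (GA dA)" using A.cp_top A.C.scale_one by (metis rangeI)
  obtain b where b: "b \<noteq> 0" "b \<in> B.cp (GB dB)" using B.cp_top B.C.scale_one by (metis rangeI)
  have "T a b \<in> M.cp (GM (dA + dB))" "T a b \<noteq> 0"
    using T_in_cp[OF a(2) b(2)] T_eq_0[of a b] a(1) b(1) by blast+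
  then show "dA + dB \<le> dM" using M.cp_outside[of "dA + dB"] by (metis not_less singletonD)
  show "dM \<le> dA + dB"
  proof (rule ccontr)
    assume less: "\<not> dM \<le> dA + dB"
    have "{T x y | x y i j. x \<in> A.cp (GA i) \<and> y \<in> B.cp (GB j) \<and> i + j = dM} \<subseteq> {0}"
    proof clarify
      fix x y i j assume xy: "x \<in> A.cp (GA i)" "y \<in> B.cp (GB j)" and d: "dM = i + j"
      have "i > dA \<or> j > dB" using less d by linarith
      then have "x = 0 \<or> y = 0" using xy A.cp_outside[of i] B.cp_outside[of j] by blast
      then show "T x y = 0" using linear_0[OF T_linear_left] linear_0[OF T_linear_right] by blast
    qed
    then have "M.cp (GM dM) \<subseteq> {0}"
      unfolding cp_GM by (rule M.C.span_minimal[OF _ M.C.subspace_single_0])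
    moreover obtain m where "m \<noteq> 0" "m \<in> M.cp (GM dM)" using M.cp_top M.C.scale_one by (metis rangeI)
    ultimately show False by blast
  qed
qed

lemma bigraded:
  assumes "wA \<in> A' 2" "wB \<in> B' 2" "GA 1 = {0} \<or> GB 1 = {0}"
  shows "bigraded_algebra sMC A' B' dA dB biproj wA wB"
proof (intro bigraded_algebra.intro bigraded_algebra_axioms.intro)
  interpret LA: Vector_Spaces.linear sAC sMC "\<lambda>x. T x 1" by (rule T_linear_left)
  interpret LB: Vector_Spaces.linear sBC sMC "\<lambda>y. T 1 y" by (rule T_linear_right)
  show "M.C.subspace (A' i)" for i
    unfolding A'_def by (rule LA.subspace_image[OF A.subspace_cp])
  show "M.C.subspace (B' i)" for i
    unfolding B'_def by (rule LB.subspace_image[OF B.subspace_cp])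
  show "x * y \<in> A' (i + j)" if "x \<in> A' i" "y \<in> A' j" for x y i j
    using that by (auto elim!: A'_E intro!: A'_I A.cp_mult simp flip: T_left_mult)
  show "x * y \<in> B' (i + j)" if "x \<in> B' i" "y \<in> B' j" for x y i j
    using that by (auto elim!: B'_E intro!: B'_I B.cp_mult simp flip: T_right_mult)
  have T_scale: "T (sAC z x) 1 = sMC z (T x 1)" "T 1 (sBC z y) = sMC z (T 1 y)" for z x y
    by (rule LA.scale LB.scale)+
  show "A' 0 = range (\<lambda>z. sMC z 1)"
    unfolding A'_def A.cp_0 image_image T_scale T_1 ..
  show "B' 0 = range (\<lambda>z. sMC z 1)"
    unfolding B'_def B.cp_0 image_image T_scale T_1 ..
  show "A' i = {0}" if "i < 0 \<or> i > dA" for i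
    unfolding A'_def A.cp_outside[OF that] by (simp add: LA.zero)
  show "B' i = {0}" if "i < 0 \<or> i > dB" for i
    unfolding B'_def B.cp_outside[OF that] by (simp add: LB.zero)
  obtain a where a: "A.cp (GA dA) = range (\<lambda>z. sAC z a)" using A.cp_top by blast
  have "A' dA = range (\<lambda>z. sMC z (T a 1))" unfolding A'_def a image_image T_scale ..
  then show "\<exists>e. A' dA = range (\<lambda>z. sMC z e)" ..
  obtain b where b: "B.cp (GB dB) = range (\<lambda>z. sBC z b)" using B.cp_top by blast
  have "B' dB = range (\<lambda>z. sMC z (T 1 b))" unfolding B'_def b image_image T_scale ..
  then show "\<exists>e. B' dB = range (\<lambda>z. sMC z e)" ..
  show "x * y = y * x" if "x \<in> A' i" "y \<in> A' j" "even i" for x y i j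
  proof -
    note prems = that
    obtain u v where "x = T u 1" "u \<in> A.cp (GA i)" "y = T v 1" "v \<in> A.cp (GA j)"
      using prems(1,2) by (elim A'_E)
    then show ?thesis using A.cp_commute[of u i v j] that(3) by (simp flip: T_left_mult)
  qed
  show "x * y = y * x" if "x \<in> B' i" "y \<in> B' j" "even i" for x y i j
  proof -
    note prems = that
    obtain u v where "x = T 1 u" "u \<in> B.cp (GB i)" "y = T 1 v" "v \<in> B.cp (GB j)"
      using prems(1,2) by (elim B'_E)
    then show ?thesis using B.cp_commute[of u i v j] that(3) by (simp flip: T_right_mult)
  qed
  show "x * y = (if odd (i * j) then - (y * x) else y * x)" if "x \<in> A' i" "y \<in> B' j" for x y i j
  proof -
    note prems = that
    obtain u v where "x = T u 1" "u \<in> A.cp (GA i)" "y = T 1 v" "v \<in> B.cp (GB j)"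
      using prems by (elim A'_E B'_E)
    then show ?thesis using A'_B'_commute by blast
  qed
  show "x \<in> M.C.span {a * b |a b i j. a \<in> A' i \<and> b \<in> B' j}" for x
    using span_T_homogeneous[of x] products_eq_UN[of "\<lambda>_ _. True"] by simp
  show "Vector_Spaces.linear sMC sMC (biproj i j)" for i j by (rule linear_biproj)
  show "biproj i j (a * b) = (if i' = i \<and> j' = j then a * b else 0)" if "a \<in> A' i'" "b \<in> B' j'" for a b i j i' j'
  proof -
    note prems = that
    obtain x y where xy: "a = T x 1" "x \<in> A.cp (GA i')" "b = T 1 y" "y \<in> B.cp (GB j')"
      using prems by (elim A'_E B'_E)
    show ?thesis
      unfolding xy(1,3) T_eq_mult[symmetric] biproj_T A.proj_cp[OF xy(2)] B.proj_cp[OF xy(4)]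
      by (simp add: linear_0[OF T_linear_left] linear_0[OF T_linear_right])
  qed
  show "a = 0 \<or> b = 0" if "a \<in> A' i" "b \<in> B' j" "a * b = 0" for a b i j
  proof -
    note prems = that
    obtain x y where xy: "a = T x 1" "b = T 1 y"
      using prems(1,2) by (elim A'_E B'_E)
    have "x = 0 \<or> y = 0" using that(3) unfolding xy T_eq_mult[symmetric] by (rule T_eq_0)
    then show ?thesis unfolding xy using LA.zero LB.zero by blast
  qed
  show "v = 0"
    if "u \<in> A' k" "even k" "\<And>a. a \<in> A' i \<Longrightarrow> u * a = 0 \<Longrightarrow> a = 0"
      "v \<in> M.C.span {a * b |a b. a \<in> A' i \<and> b \<in> B' j}" "u * v = 0" for u k i v j
  proof -
    note prems = that
    obtain w where w: "u = T w 1" using prems(1) by (elim A'_E)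
    show ?thesis
    proof (rule inj_on_A_tensor[OF A.linear_mult_left[of w] A.subspace_cp _ M.linear_mult_left[of u] _
          that(4)[unfolded products_eq] that(5)])
      show "x = 0" if x: "x \<in> A.cp (GA i)" "w * x = 0" for x
      proof -
        have "u * T x 1 = 0" unfolding w T_left_mult[symmetric] x(2) LA.zero ..
        then show ?thesis using \<open>\<And>a. a \<in> A' i \<Longrightarrow> u * a = 0 \<Longrightarrow> a = 0\<close>[OF A'_I[OF x(1)]] by (intro T_left_eq_0)
      qed
      show "u * T x y = T (w * x) y" for x y
        unfolding w T_eq_mult[of x y] T_eq_mult[of "w * x" y] T_left_mult mult.assoc ..
    qed
  qed
  show "v = 0"
    if "u \<in> B' k" "even k" "\<And>b. b \<in> B' j \<Longrightarrow> u * b = 0 \<Longrightarrow> b = 0"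
      "v \<in> M.C.span {a * b |a b. a \<in> A' i \<and> b \<in> B' j}" "u * v = 0" for u k i v j
  proof -
    note prems = that
    obtain w where w: "u = T 1 w" "w \<in> B.cp (GB k)" using prems(1) by (elim B'_E)
    show ?thesis
    proof (rule inj_on_B_tensor[OF B.linear_mult_left[of w] B.subspace_cp _ M.linear_mult_left[of u] _
          that(4)[unfolded products_eq] that(5)])
      show "x = 0" if x: "x \<in> B.cp (GB j)" "w * x = 0" for x
      proof -
        have "u * T 1 x = 0" unfolding w T_right_mult[symmetric] x(2) LB.zero ..
        then show ?thesis using \<open>\<And>b. b \<in> B' j \<Longrightarrow> u * b = 0 \<Longrightarrow> b = 0\<close>[OF B'_I[OF x(1)]] by (intro T_right_eq_0)
      qed
      \<comment> \<open>Moving \<open>w\<close> past \<open>x\<close> costs no sign because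
        \<open>k\<close> is even.\<close>
      show "u * T x y = T x (w * y)" if "x \<in> A.cp (GA i)" for x y
        using T_mult[OF w(2) that, of 1 y] \<open>even k\<close> unfolding w(1) by simp
    qed
  qed
  show "A' 1 = {0} \<or> B' 1 = {0}"
    using assms(3) unfolding A'_def B'_def by (elim disjE) (simp_all add: A.cp_eq_0 B.cp_eq_0 LA.zero LB.zero)
qed (fact M.vector_space_sC M.mult_scale assms)+

end

text \<open>Phrased for an abstract embedding, so that it serves for both factors, the second one
  through the exchanged bigraded algebra. Lefschetz is pulled back along \<open>\<iota>\<close>, and
  positivity comes from that of \<open>wA + wB\<close> by \<open>form_A\<close>.\<close>

lemma polarized_factor:
  assumes emb: "hodge_embedding sX GX dX sXC cX sM GM dM sMC cM HM \<iota>"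
    and L: "lefschetz_bigraded_algebra sMC A B dX dB pr wA wB r r' D"
    and A: "\<And>k. A k = \<iota> ` complex_part sXC cX (GX k)"
    and wA: "wA \<in> HM 1 1" "conjugation sMC cM wA = wA"
    and pol: "polarization sMC cM GM (r + r') HM (wA + wB)"
  shows "polarized_hodge_structure sXC cX GX dX (hodge_embedding.H HM \<iota>)"
proof -
  interpret hodge_embedding sX GX dX sXC cX sM GM dM sMC cM HM \<iota> by (rule emb)
  interpret L: lefschetz_bigraded_algebra sMC A B dX dB pr wA wB r r' D by (rule L)
  obtain w where w: "w \<in> X.cp (GX 2)" "wA = \<iota> w" using L.wA unfolding A by blast
  have wA_e: "\<iota> (w ^ e) = wA ^ e" for e unfolding w(2) by (rule embedding_power)
  have "polarization sXC cX GX r H w"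
  proof (rule polarization[OF w(1)])
    show "\<iota> w \<in> HM 1 1" using wA(1) unfolding w(2) .
    show "X.\<sigma> w = w" using wA(2) unfolding w(2) conj_embedding by (rule embedding_eq)
    show "w ^ e * x = x * w ^ e" for x e
      by (rule embedding_eq) (simp only: embedding_mult wA_e L.power_wA_central)
    show "x = 0" if x: "x \<in> X.cp (GX k)" "k + int e = int r" "w ^ e * x = 0" for x k e
    proof (rule embedding_eq_0, rule L.lefschetz_A_inj)
      show "\<iota> x \<in> A k" unfolding A using x(1) by (rule imageI)
      show "k + int e \<le> int r" using x(2) by simp
      show "wA ^ e * \<iota> x = 0"
        unfolding wA_e[symmetric] embedding_mult[symmetric] x(3) by (rule linear_0[OF linear_embedding])
    qed
    show "\<exists>x\<in>X.cp (GX k). y = w ^ e * x"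
      if y: "y \<in> X.cp (GX (k + 2 * int e))" "0 \<le> k" "k + int e = int r" for y k e
    proof -
      have "\<iota> y \<in> A (k + 2 * int e)" unfolding A using y(1) by (rule imageI)
      from L.lefschetz_A_surj[OF this y(2,3)] obtain x where x: "x \<in> X.cp (GX k)" "\<iota> y = wA ^ e * \<iota> x"
        unfolding A by blast
      have "y = w ^ e * x" by (rule embedding_eq) (simp only: x(2) embedding_mult wA_e)
      then show ?thesis using x(1) by blast
    qed
    show "w ^ r \<noteq> 0"
      using L.power_wA_nonzero linear_0[OF linear_embedding] unfolding wA_e[symmetric] by metis
    show "\<exists>z. w ^ e * x * X.\<sigma> x = sXC z (w ^ r) \<and>
        (let u = (-1) ^ (k * (k - 1) div 2) * \<i> powi (p - q - int k) * (\<i> ^ k * z) in u \<in> \<real> \<and> Re u > 0)"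
      if ke: "k + e = r" and pq: "p + q = int k" and x: "x \<in> H p q" "x \<noteq> 0" "w ^ Suc e * x = 0" for k e p q x
    proof -
      define u where "u z = (-1) ^ (k * (k - 1) div 2) * \<i> powi (p - q - int k) * (\<i> ^ k * z)" for z
      \<comment> \<open>The ratio of binomial coefficients from \<open>form_A\<close>: the form of
        \<open>wA + wB\<close> on primitive elements of the factor is \<open>\<rho>\<close> times
        that of \<open>wA\<close>.\<close>
      define \<rho> where "\<rho> = real ((e + r') choose e) / real ((r + r') choose r)"
      have \<rho>: "\<rho> > 0" unfolding \<rho>_def by (simp add: zero_less_binomial)
      have \<rho>_complex: "of_nat ((e + r') choose e) / of_nat ((r + r') choose r) = complex_of_real \<rho>"
        unfolding \<rho>_def by simp
      have xA: "\<iota> x \<in> A (int k)" "\<iota> (X.\<sigma> x) \<in> A (int k)"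
        using H_subset[OF x(1)] X.conj_cp unfolding pq A by blast+
      have prim: "wA ^ Suc e * \<iota> x = 0"
        unfolding wA_e[symmetric] embedding_mult[symmetric] x(3) by (rule linear_0[OF linear_embedding])
      have "int k + int e = int r" using ke by simp
      from L.form_A[OF xA prim this] obtain z where z: "wA ^ e * \<iota> x * \<iota> (X.\<sigma> x) = sMC z (wA ^ r)"
        "(wA + wB) ^ (e + r') * \<iota> x * \<iota> (X.\<sigma> x) = sMC (z * \<rho>) ((wA + wB) ^ (r + r'))"
        unfolding \<rho>_complex by (elim exE conjE)
      \<comment> \<open>The degree \<open>k\<close> and the type \<open>(p, q)\<close> are the same
        in the factor and in M, so the sign and the powers of \<open>\<i>\<close> agree. Only the
        Lefschetz exponent changes, from \<open>e\<close> to \<open>e + r'\<close>.\<close>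
      have nk: "r + r' - k = e + r'" "r + r' + 1 - k = Suc (e + r')" "k \<le> r + r'" using ke by simp_all
      have q: "q_form sMC (r + r') (wA + wB) k (\<iota> x) (M.\<sigma> (\<iota> x)) = z * \<rho>"
        unfolding q_form_def nk conj_embedding z(2) using L.power_w_nonzero
        by (intro the_equality) simp_all
      have "(wA + wB) * y = y * (wA + wB)" for y
        by (simp only: distrib_left distrib_right L.wA_central[of y] L.wB_central[of y])
      then have "\<iota> x * (wA + wB) ^ Suc (e + r') = (wA + wB) ^ Suc (e + r') * \<iota> x"
        by (rule power_commuting_commutes[symmetric])
      also have "\<dots> = 0" by (rule L.primitive_A[OF prim]) simp
      finally have "\<iota> x \<in> primitive_part HM (r + r') (wA + wB) k p q"
        using x(1) unfolding primitive_part_def nk H_def by blast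
      moreover have "\<iota> x \<noteq> 0" using x(2) embedding_eq_0 by blast
      ultimately have u: "u (z * \<rho>) \<in> \<real>" "Re (u (z * \<rho>)) > 0"
        using pol nk(3) pq unfolding polarization_def h_form_def q[symmetric] u_def Let_def by blast+
      have "u z = u (z * \<rho>) * complex_of_real (1 / \<rho>)" using \<rho> by (simp add: u_def)
      then have "u z \<in> \<real> \<and> Re (u z) > 0"
        using u \<rho> by (auto elim!: Reals_cases)
      moreover have "w ^ e * x * X.\<sigma> x = sXC z (w ^ r)"
        by (rule embedding_eq) (simp only: embedding_mult wA_e linear_scale[OF linear_embedding] z(1))
      ultimately show ?thesis unfolding Let_def u_def by blast
    qed
  qed
  moreover have "dX = 2 * int r" by (rule L.dA)
  ultimately show ?thesis unfolding polarized_hodge_structure_def using hodge by blast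
qed

text \<open>The tensor products of Hodge pieces are first shown to decompose the whole
  complexification of M. As each lies in the piece of M with the summed indices, the projection to
  \<open>HM p q\<close> selects exactly those with the right indices.\<close>

lemma (in complex_tensor_product) tensor_hodge_structure:
  assumes "hodge_algebra sA GA dA sAC cA HA" "hodge_algebra sB GB dB sBC cB HB"
    "hodge_algebra sM GM dM sMC cM HM"
    and HM: "\<And>x y p q p' q'. x \<in> HA p q \<Longrightarrow> y \<in> HB p' q' \<Longrightarrow> T x y \<in> HM (p + p') (q + q')"
  shows "is_tensor_hodge_structure sMC T HA HB HM"
proof -
  interpret A: hodge_algebra sA GA dA sAC cA HA by fact
  interpret B: hodge_algebra sB GB dB sBC cB HB by fact
  interpret M: hodge_algebra sM GM dM sMC cM HM by fact
  define Q where "Q = (\<lambda>(p1, q1, p2, q2). M.C.span {T x y | x y. x \<in> HA p1 q1 \<and> y \<in> HB p2 q2})"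
  have T_in_Q: "T x y \<in> Q (p1, q1, p2, q2)" if "x \<in> HA p1 q1" "y \<in> HB p2 q2" for x y p1 q1 p2 q2
    unfolding Q_def prod.case by (rule M.C.span_base) (use that in blast)
  have Q_subset: "Q (p1, q1, p2, q2) \<subseteq> HM (p1 + p2) (q1 + q2)" for p1 q1 p2 q2
    unfolding Q_def prod.case by (rule M.C.span_minimal[OF _ M.subspace_H]) (use HM in blast)
  have sub: "M.C.subspace (Q i)" for i
    unfolding Q_def by (cases i) simp
  interpret U: subspace_family sMC Q UNIV
    by unfold_locales (rule sub)
  have exists: "\<exists>f. is_decomposition Q UNIV f z" for z
    using span_T_homogeneous[of z]
  proof (induction rule: M.C.span_induct_alt)
    case base
    show ?case using U.is_decomposition_zero by blast
  next
    case (step r v z)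
    then obtain x y where v: "v = T x y" by blast
    have "\<exists>f. is_decomposition Q UNIV f (T x y)"
    proof (induction x rule: A.H_induct)
      case zero
      show ?case using U.is_decomposition_zero unfolding linear_0[OF T_linear_left] by blast
    next
      case (add x x')
      then show ?case unfolding linear_add[OF T_linear_left] using U.is_decomposition_add by blast
    next
      case (mem p q x)
      show ?case
      proof (induction y rule: B.H_induct)
        case zero
        show ?case using U.is_decomposition_zero unfolding linear_0[OF T_linear_right] by blast
      next
        case (add y y')
        then show ?case unfolding linear_add[OF T_linear_right] using U.is_decomposition_add by blast
      next
        case (mem p' q' y)
        show ?case
          using U.is_decomposition_single[OF UNIV_I T_in_Q[OF \<open>x \<in> HA p q\<close> mem]] by blast
      qed
    qed
    then show ?case using step.IH U.is_decomposition_add U.is_decomposition_scale unfolding v by blast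
  qed
  have indep: "f i = 0" if f: "is_decomposition Q UNIV f 0" for f i
  proof -
    obtain p1 q1 p2 q2 where i: "i = (p1, q1, p2, q2)" by (cases i)
    \<comment> \<open>The tensor product of two Hodge projections is the identity on the summand
      with index \<open>i\<close> and zero on all others, so it isolates \<open>f i\<close>.\<close>
    obtain h where h: "Vector_Spaces.linear sMC sMC h" "\<And>x y. h (T x y) = T (A.hproj p1 q1 x) (B.hproj p2 q2 y)"
      by (rule universal[OF bilinear_map_compose[OF A.linear_hproj B.linear_hproj]]) (rule that)
    have hQ: "h z = (if j = i then z else 0)" if "z \<in> Q j" for j z
    proof -
      obtain a b c d where j: "j = (a, b, c, d)" by (cases j)
      have L: "Vector_Spaces.linear sMC sMC (\<lambda>z. if j = i then z else 0)"
        by (rule linearI[OF M.vector_space_sC M.vector_space_sC]) simp_all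
      show ?thesis
      proof (rule linear_eq_on_span[OF h(1) L])
        show "z \<in> M.C.span {T x y | x y. x \<in> HA a b \<and> y \<in> HB c d}"
          using \<open>z \<in> Q j\<close> unfolding Q_def j by simp
        fix v assume "v \<in> {T x y | x y. x \<in> HA a b \<and> y \<in> HB c d}"
        then obtain x y where v: "v = T x y" "x \<in> HA a b" "y \<in> HB c d" by blast
        show "h v = (if j = i then v else 0)"
          unfolding v(1) h(2) A.hproj_H[OF v(2)] B.hproj_H[OF v(3)] i j
          by (auto simp: linear_0[OF T_linear_left] linear_0[OF T_linear_right])
      qed
    qed
    define K where "K = {i. f i \<noteq> 0}"
    have K: "finite K" "0 = (\<Sum>j\<in>K. f j)"
      using f unfolding is_decomposition_def K_def by simp_all
    have fQ: "f j \<in> Q j" for j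
      by (rule f[unfolded is_decomposition_def, THEN conjunct1, rule_format, OF UNIV_I])
    have "0 = h (\<Sum>j\<in>K. f j)" using K(2) linear_0[OF h(1)] by simp
    also have "\<dots> = (\<Sum>j\<in>K. if j = i then f j else 0)"
      unfolding linear_sum[OF h(1)] by (intro sum.cong refl hQ fQ)
    also have "\<dots> = (if i \<in> K then f i else 0)" using K(1) by simp
    finally show "f i = 0" unfolding K_def by (simp split: if_splits)
  qed
  show ?thesis
    unfolding is_tensor_hodge_structure_def
  proof (intro allI)
    fix p q :: int
    define I where "I = {(p1, q1, p2, q2). p1 + p2 = p \<and> q1 + q2 = q}"
    interpret F: subspace_family sMC Q I by unfold_locales (rule sub)
    have "internal_direct_sum Q I (HM p q)"
    proof (rule F.internal_direct_sumI)
      show "Q i \<subseteq> HM p q" if "i \<in> I" for i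
        using that Q_subset[of "fst i" "fst (snd i)" "fst (snd (snd i))" "snd (snd (snd i))"]
        unfolding I_def by (cases i) simp
    next
      fix z assume z: "z \<in> HM p q"
      obtain f where f: "is_decomposition Q UNIV f z" using exists by blast
      define K where "K = {i. f i \<noteq> 0}"
      have K: "finite K" "z = (\<Sum>j\<in>K. f j)"
        using f unfolding is_decomposition_def K_def by simp_all
      have fQ: "f j \<in> Q j" for j
        by (rule f[unfolded is_decomposition_def, THEN conjunct1, rule_format, OF UNIV_I])
      have *: "M.hproj p q (f j) = (if j \<in> I then f j else 0)" for j
      proof -
        obtain a b c d where j: "j = (a, b, c, d)" by (cases j)
        have "f j \<in> HM (a + c) (b + d)" using fQ[of j] Q_subset unfolding j by blast
        from M.hproj_H[OF this, of p q] show ?thesis unfolding I_def j by auto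
      qed
      \<comment> \<open>Projecting the global decomposition to type \<open>(p, q)\<close> discards
        every summand outside \<open>I\<close> and leaves \<open>z\<close> unchanged.\<close>
      have "z = M.hproj p q z" using M.hproj_H[OF z, of p q] by simp
      also have "\<dots> = (\<Sum>j\<in>K. M.hproj p q (f j))" by (subst K(2)) (rule linear_sum[OF M.linear_hproj])
      finally have sum: "z = (\<Sum>j\<in>K. if j \<in> I then f j else 0)" unfolding * .
      have "is_decomposition Q I (\<lambda>j. if j \<in> I then f j else 0) z"
        by (rule F.is_decompositionI[OF K(1) _ _ _ sum]) (simp_all add: fQ K_def)
      then show "\<exists>f. is_decomposition Q I f z" by blast
    next
      fix f i assume f: "is_decomposition Q I f 0"
      have "f j \<in> Q j" for j
        using f[unfolded is_decomposition_def, THEN conjunct1, rule_format, of j]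
          f[unfolded is_decomposition_def, THEN conjunct2, THEN conjunct1, rule_format, of j]
          M.C.subspace_0[OF sub, of j] by (cases "j \<in> I") simp_all
      then have "is_decomposition Q UNIV f 0" using f unfolding is_decomposition_def by simp
      then show "f i = 0" by (rule indep)
    qed
    then show "internal_direct_sum
        (\<lambda>(p1, q1, p2, q2). M.C.span {T x y |x y. x \<in> HA p1 q1 \<and> y \<in> HB p2 q2})
        {(p1, q1, p2, q2). p1 + p2 = p \<and> q1 + q2 = q} (HM p q)"
      unfolding Q_def I_def .
  qed
qed

section \<open>From the polarization of M to both factors\<close>

locale polarized_tensor_product =
  complex_tensor_product sA GA dA sAC cA sB GB dB sBC cB sM GM dM sMC cM t +
  M: hodge_algebra sM GM dM sMC cM HM
  for sA :: "'f::rational_or_real_field \<Rightarrow> 'a::ring_1 \<Rightarrow> 'a" and GA dA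
    and sAC :: "complex \<Rightarrow> 'ac::ring_1 \<Rightarrow> 'ac" and cA
    and sB :: "'f \<Rightarrow> 'b::ring_1 \<Rightarrow> 'b" and GB dB
    and sBC :: "complex \<Rightarrow> 'bc::ring_1 \<Rightarrow> 'bc" and cB
    and sM :: "'f \<Rightarrow> 'm::ring_1 \<Rightarrow> 'm" and GM dM
    and sMC :: "complex \<Rightarrow> 'mc::ring_1 \<Rightarrow> 'mc" and cM t HM +
  fixes n :: nat and \<omega> :: 'mc
  assumes dM: "dM = 2 * int n"
    and pol: "polarization sMC cM GM n HM \<omega>"
    and degree_1: "GA 1 = {0} \<or> GB 1 = {0}"
begin

lemma \<omega>: "\<omega> \<in> HM 1 1" "\<omega> \<in> M.cp (GM 2)" "M.\<sigma> \<omega> = \<omega>"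
  using pol unfolding polarization_def M.real_part_eq by simp_all

lemma \<omega>_central: "\<omega> ^ e * x = x * \<omega> ^ e"
proof (rule power_commuting_commutes)
  have "\<omega> * M.proj k x = M.proj k x * \<omega>" for k
    using M.cp_commute[OF \<omega>(2) M.proj_in_cp[of k x]] by simp
  then have "\<omega> * (\<Sum>k\<in>{0..dM}. M.proj k x) = (\<Sum>k\<in>{0..dM}. M.proj k x) * \<omega>"
    unfolding sum_distrib_left sum_distrib_right by simp
  then show "\<omega> * x = x * \<omega>" unfolding M.sum_proj[of x, symmetric] .
qed

lemma conj_power_\<omega>: "M.\<sigma> (\<omega> ^ e) = \<omega> ^ e"
proof (induction e)
  case 0
  then show ?case using M.conj_c[of 1] by (simp add: M.c_1)
qed (simp add: M.conj_mult \<omega>(3))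

lemma conj_i: "M.\<sigma> (sMC \<i> (x - M.\<sigma> x)) = sMC \<i> (x - M.\<sigma> x)"
proof -
  have "M.\<sigma> (x - M.\<sigma> x) = M.\<sigma> x - x"
    using M.conj_add[of "x - M.\<sigma> x" "M.\<sigma> x"] by (simp add: M.conj_conj eq_diff_eq)
  then have "M.\<sigma> (sMC \<i> (x - M.\<sigma> x)) = sMC (- \<i>) (M.\<sigma> x - x)"
    by (simp only: M.conj_scale complex_cnj_i)
  also have "\<dots> = sMC \<i> (x - M.\<sigma> x)"
    by (simp add: M.C.scale_right_diff_distrib)
  finally show ?thesis .
qed

text \<open>These are twice the real part and minus twice the imaginary part of \<open>x\<close>.
  The Lefschetz property, given on real points, is applied to them to obtain the complex
  version.\<close>

lemma conj_fixed:
  assumes "x \<in> M.cp V"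
  shows "x + M.\<sigma> x \<in> {x \<in> M.cp V. M.\<sigma> x = x}" "sMC \<i> (x - M.\<sigma> x) \<in> {x \<in> M.cp V. M.\<sigma> x = x}"
proof -
  have "M.\<sigma> (x + M.\<sigma> x) = x + M.\<sigma> x" unfolding M.conj_add M.conj_conj by (rule add.commute)
  moreover have "x + M.\<sigma> x \<in> M.cp V"
    by (rule M.C.subspace_add[OF M.subspace_cp assms M.conj_cp[OF assms]])
  ultimately show "x + M.\<sigma> x \<in> {x \<in> M.cp V. M.\<sigma> x = x}" by blast
  have "sMC \<i> (x - M.\<sigma> x) \<in> M.cp V"
    by (intro M.C.subspace_scale[OF M.subspace_cp] M.C.subspace_diff[OF M.subspace_cp] assms M.conj_cp)
  with conj_i show "sMC \<i> (x - M.\<sigma> x) \<in> {x \<in> M.cp V. M.\<sigma> x = x}" by blast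
qed

lemma real_lefschetz:
  assumes "0 \<le> k" "k + int e = int n"
  shows "bij_betw (\<lambda>x. x * \<omega> ^ e) {x \<in> M.cp (GM k). M.\<sigma> x = x} {x \<in> M.cp (GM (k + 2 * int e)). M.\<sigma> x = x}"
proof -
  have eqs: "nat k \<le> n" "n - nat k = e" "int (nat k) = k" "2 * int n - k = k + 2 * int e" using assms by auto
  from pol[unfolded polarization_def M.real_part_eq, THEN conjunct2, THEN conjunct1, rule_format, OF eqs(1)]
  show ?thesis unfolding eqs .
qed

text \<open>As \<open>\<omega>\<close> is real, \<open>\<omega> ^ e\<close> kills
  \<open>\<sigma> x\<close> together with \<open>x\<close>, hence also the real and imaginary parts,
  where injectivity is known.\<close>

lemma lefschetz_inj:
  assumes x: "x \<in> M.cp (GM k)" and k: "0 \<le> k" "k + int e = int n" and 0: "\<omega> ^ e * x = 0"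
  shows "x = 0"
proof -
  let ?R = "{x \<in> M.cp (GM k). M.\<sigma> x = x}"
  have inj: "y = 0" if "y \<in> ?R" "y * \<omega> ^ e = 0" for y
    using bij_betw_imp_inj_on[OF real_lefschetz[OF k]] that M.C.subspace_0[OF M.subspace_cp] M.conj_0
    by (auto dest: inj_onD[of _ _ y 0])
  have 0: "x * \<omega> ^ e = 0" using 0 unfolding \<omega>_central .
  have 1: "M.\<sigma> x * \<omega> ^ e = 0" using arg_cong[OF 0, of M.\<sigma>] by (simp add: M.conj_mult conj_power_\<omega> M.conj_0)
  have "x + M.\<sigma> x = 0"
    by (rule inj[OF conj_fixed(1)[OF x]]) (simp only: distrib_right 0 1 add_0)
  moreover have "sMC \<i> (x - M.\<sigma> x) = 0"
    by (rule inj[OF conj_fixed(2)[OF x]]) (simp only: M.mult_scale left_diff_distrib 0 1 diff_self M.C.scale_zero_right)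
  ultimately have "x + M.\<sigma> x = 0" "x = M.\<sigma> x" by simp_all
  then have "x + x = 0" by metis
  then have "sMC 2 x = 0" using M.C.scale_left_distrib[of 1 1 x] by simp
  then show ?thesis by simp
qed

lemma lefschetz_surj:
  assumes y: "y \<in> M.cp (GM (k + 2 * int e))" and k: "0 \<le> k" "k + int e = int n"
  shows "\<exists>x\<in>M.cp (GM k). y = \<omega> ^ e * x"
proof -
  let ?R = "{x \<in> M.cp (GM (k + 2 * int e)). M.\<sigma> x = x}"
  have surj: "\<exists>x\<in>M.cp (GM k). z = x * \<omega> ^ e" if "z \<in> ?R" for z
    using bij_betw_imp_surj_on[OF real_lefschetz[OF k]] that by blast
  obtain u where u: "u \<in> M.cp (GM k)" "y + M.\<sigma> y = u * \<omega> ^ e"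
    using surj[OF conj_fixed(1)[OF y]] by (elim bexE)
  obtain v where v: "v \<in> M.cp (GM k)" "sMC \<i> (y - M.\<sigma> y) = v * \<omega> ^ e"
    using surj[OF conj_fixed(2)[OF y]] by (elim bexE)
  \<comment> \<open>\<open>y\<close> is half of \<open>y + \<sigma> y\<close> minus
    \<open>\<i>\<close> times \<open>\<i> (y - \<sigma> y)\<close>; the same combination of the
    preimages \<open>u\<close> and \<open>v\<close> is a preimage of \<open>y\<close>.\<close>
  let ?x = "sMC (1/2) (u - sMC \<i> v)"
  have "?x * \<omega> ^ e = sMC (1/2) ((y + M.\<sigma> y) - sMC \<i> (sMC \<i> (y - M.\<sigma> y)))"
    unfolding u(2) v(2) by (simp add: M.mult_scale left_diff_distrib)
  also have "\<dots> = sMC (1/2) (y + y)" by (simp add: M.C.scale_minus_left)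
  also have "\<dots> = y" by (simp add: M.C.scale_right_distrib flip: M.C.scale_left_distrib)
  finally have "y = \<omega> ^ e * ?x" unfolding \<omega>_central ..
  moreover have "?x \<in> M.cp (GM k)"
    by (intro M.C.subspace_scale[OF M.subspace_cp] M.C.subspace_diff[OF M.subspace_cp] u(1) v(1))
  ultimately show ?thesis by blast
qed

lemma bigraded_M:
  assumes "wA \<in> A' 2" "wB \<in> B' 2"
  shows "bigraded_algebra.M sMC A' B' k = M.cp (GM k)"
  unfolding bigraded_algebra.M_def[OF bigraded[OF assms degree_1]] cp_GM
    products_eq_UN[of "\<lambda>i j. i + j = k"] ..

lemma \<omega>_split: obtains wA wB where "wA \<in> A' 2" "wB \<in> B' 2" "\<omega> = wA + wB"
proof -
  have 0: "0 \<in> A' 2" "0 \<in> B' 2"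
    unfolding A'_def B'_def
    by (auto intro!: image_eqI[of _ _ 0] simp: linear_0[OF T_linear_left] linear_0[OF T_linear_right]
        A.C.subspace_0[OF A.subspace_cp] B.C.subspace_0[OF B.subspace_cp])
  \<comment> \<open>The zero classes are placeholders for \<open>wA\<close> and \<open>wB\<close>,
    which only come out of \<open>M_2\<close> here.\<close>
  interpret bigraded_algebra sMC A' B' dA dB biproj 0 0 by (rule bigraded[OF 0 degree_1])
  show ?thesis using M_2[of \<omega>] \<omega>(2) that unfolding bigraded_M[OF 0] by blast
qed

lemma A'_conj: "x \<in> A' k \<Longrightarrow> M.\<sigma> x \<in> A' k"
proof -
  assume "x \<in> A' k"
  then obtain a where "x = T a 1" "a \<in> A.cp (GA k)" by (rule A'_E)
  then show ?thesis using A'_I[OF A.conj_cp] B.conj_c[of 1] by (simp add: conj_T B.c_1)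
qed

lemma B'_conj: "x \<in> B' k \<Longrightarrow> M.\<sigma> x \<in> B' k"
proof -
  assume "x \<in> B' k"
  then obtain b where "x = T 1 b" "b \<in> B.cp (GB k)" by (rule B'_E)
  then show ?thesis using B'_I[OF B.conj_cp] A.conj_c[of 1] by (simp add: conj_T A.c_1)
qed

lemma factors:
  "even dA \<and> even dB \<and>
    (\<exists>HA HB. polarized_hodge_structure sAC cA GA dA HA \<and> polarized_hodge_structure sBC cB GB dB HB \<and>
      is_tensor_hodge_structure sMC T HA HB HM)"
proof -
  obtain wA wB where w: "wA \<in> A' 2" "wB \<in> B' 2" "\<omega> = wA + wB" by (rule \<omega>_split)
  interpret L0: bigraded_algebra sMC A' B' dA dB biproj wA wB by (rule bigraded[OF w(1,2) degree_1])
  have L0_M: "L0.M k = M.cp (GM k)" for k by (rule bigraded_M[OF w(1,2)])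
  have "1 \<in> M.cp (GM 0)" unfolding M.cp_0 by (rule range_eqI[of _ _ 1]) simp
  then have "\<omega> ^ n \<noteq> 0" using lefschetz_inj[of 1 0 n] by auto
  then have even: "even dA \<and> even dB"
    unfolding w(3) using dM dim_eq by (intro L0.even_dimensions[of n]) simp_all
  define r r' where "r = nat (dA div 2)" and "r' = nat (dB div 2)"
  have d: "dA = 2 * int r" "dB = 2 * int r'" "n = r + r'"
    using even A.dim_nonneg B.dim_nonneg dM dim_eq unfolding r_def r'_def by auto
  have L: "lefschetz_bigraded_algebra sMC A' B' dA dB biproj wA wB r r' M.D"
  proof unfold_locales
    \<comment> \<open>The eigenvalue of \<open>D\<close> on type (1,1) is
      \<open>1 - 1 = 0\<close>.\<close>
    show "M.D (wA + wB) = 0" using M.D_H[OF \<omega>(1)] unfolding w(3) by simp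
    show "x = 0" if "x \<in> L0.M k" "0 \<le> k" "k + int e = int (r + r')" "(wA + wB) ^ e * x = 0" for x k e
      using lefschetz_inj[of x k e] that unfolding L0_M w(3) d(3) by blast
    show "\<exists>x\<in>L0.M k. y = (wA + wB) ^ e * x"
      if "y \<in> L0.M (k + 2 * int e)" "0 \<le> k" "k + int e = int (r + r')" for y k e
      using lefschetz_surj[of y k e] that unfolding L0_M w(3) d(3) by blast
    show "M.D x \<in> L0.M k" if "x \<in> L0.M k" for x k
      using M.D_cp that unfolding L0_M by blast
  qed (fact d linear_add[OF M.linear_D] linear_scale[OF M.linear_D] M.D_mult)+
  interpret L: lefschetz_bigraded_algebra sMC A' B' dA dB biproj wA wB r r' M.D by (rule L)
  note L' = L.swap_lefschetz
  interpret L': lefschetz_bigraded_algebra sMC B' A' dB dA "\<lambda>i j. biproj j i" wB wA r' r M.D by (rule L')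
  \<comment> \<open>Conjugation preserves both factors, so
    \<open>\<sigma> wA - wA = wB - \<sigma> wB\<close> lies in \<open>A' 2\<close> and in
    \<open>B' 2\<close>, hence vanishes: both summands of \<open>\<omega>\<close> are real.\<close>
  have "M.\<sigma> wA + M.\<sigma> wB = wA + wB" using \<omega>(3) unfolding w(3) M.conj_add .
  then have eq: "M.\<sigma> wA - wA = wB - M.\<sigma> wB" by (simp add: algebra_simps)
  have "M.\<sigma> wA - wA \<in> A' 2" by (rule M.C.subspace_diff[OF L0.subspace_A A'_conj[OF w(1)] w(1)])
  moreover have "M.\<sigma> wA - wA \<in> B' 2"
    unfolding eq by (rule M.C.subspace_diff[OF L0.subspace_B w(2) B'_conj[OF w(2)]])
  ultimately have "M.\<sigma> wA - wA = 0" by (rule L0.A_Int_B) simp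
  then have conj: "M.\<sigma> wA = wA" "M.\<sigma> wB = wB" using eq by simp_all
  have "wA \<in> M.cp (GM (2 * 1))" "wB \<in> M.cp (GM (2 * 1))"
    using L0.A_subset_M[OF w(1)] L'.A_subset_M[OF w(2)] unfolding L0.swap_M L0_M by simp_all
  \<comment> \<open>\<open>D\<close> kills each summand by \<open>D_wA\<close> and its mirror image,
    and in degree 2 the kernel of \<open>D\<close> is the piece of type (1,1).\<close>
  then have H: "wA \<in> HM 1 1" "wB \<in> HM 1 1"
    using M.D_eq_0_imp_in_H L.D_wA L'.D_wA by blast+
  have embA: "hodge_embedding sA GA dA sAC cA sM GM dM sMC cM HM (\<lambda>x. T x 1)"
  proof unfold_locales
    show "M.\<sigma> (T x 1) = T (A.\<sigma> x) 1" for x using B.conj_c[of 1] by (simp add: conj_T B.c_1)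
    show "T x 1 \<in> M.cp (GM k)" if "x \<in> A.cp (GA k)" for x k
      using L0.A_subset_M[OF A'_I[OF that]] unfolding L0_M .
    show "M.D (T x 1) \<in> (\<lambda>x. T x 1) ` A.cp (GA k)" if "x \<in> A.cp (GA k)" for x k
      using L.D_A[OF A'_I[OF that]] unfolding A'_def .
  qed (fact linear_add[OF T_linear_left] linear_scale[OF T_linear_left] T_left_mult T_1 T_left_eq_0)+
  have embB: "hodge_embedding sB GB dB sBC cB sM GM dM sMC cM HM (\<lambda>y. T 1 y)"
  proof unfold_locales
    show "M.\<sigma> (T 1 y) = T 1 (B.\<sigma> y)" for y using A.conj_c[of 1] by (simp add: conj_T A.c_1)
    show "T 1 y \<in> M.cp (GM k)" if "y \<in> B.cp (GB k)" for y k
      using L'.A_subset_M[OF B'_I[OF that]] unfolding L0.swap_M L0_M .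
    show "M.D (T 1 y) \<in> (\<lambda>y. T 1 y) ` B.cp (GB k)" if "y \<in> B.cp (GB k)" for y k
      using L'.D_A[OF B'_I[OF that]] unfolding B'_def .
  qed (fact linear_add[OF T_linear_right] linear_scale[OF T_linear_right] T_right_mult T_1 T_right_eq_0)+
  interpret embA: hodge_embedding sA GA dA sAC cA sM GM dM sMC cM HM "\<lambda>x. T x 1" by (rule embA)
  interpret embB: hodge_embedding sB GB dB sBC cB sM GM dM sMC cM HM "\<lambda>y. T 1 y" by (rule embB)
  have "polarized_hodge_structure sAC cA GA dA embA.H"
    by (rule polarized_factor[OF embA L A'_def H(1) conj(1)]) (use pol w(3) d(3) in simp)
  moreover have "polarized_hodge_structure sBC cB GB dB embB.H"
    by (rule polarized_factor[OF embB L' B'_def H(2) conj(2)]) (use pol w(3) d(3) in \<open>simp add: add.commute\<close>)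
  moreover have "is_tensor_hodge_structure sMC T embA.H embB.H HM"
  proof (rule tensor_hodge_structure)
    show "hodge_algebra sA GA dA sAC cA embA.H" by unfold_locales (rule embA.hodge)
    show "hodge_algebra sB GB dB sBC cB embB.H" by unfold_locales (rule embB.hodge)
    show "hodge_algebra sM GM dM sMC cM HM" by (rule M.hodge_algebra_axioms)
    show "T x y \<in> HM (p + p') (q + q')" if "x \<in> embA.H p q" "y \<in> embB.H p' q'" for x y p q p' q'
      using that unfolding embA.H_def embB.H_def T_eq_mult[of x y] by (auto intro: M.H_mult)
  qed
  ultimately show ?thesis using even by blast
qed

end

theorem theorem0p1:
  fixes sM :: "'f::rational_or_real_field \<Rightarrow> 'm::ring_1 \<Rightarrow> 'm" and GM :: "int \<Rightarrow> 'm set" and dM :: int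
    and sA :: "'f \<Rightarrow> 'a::ring_1 \<Rightarrow> 'a" and GA :: "int \<Rightarrow> 'a set" and dA :: int
    and sB :: "'f \<Rightarrow> 'b::ring_1 \<Rightarrow> 'b" and GB :: "int \<Rightarrow> 'b set" and dB :: int
    and sMC :: "complex \<Rightarrow> 'mc::ring_1 \<Rightarrow> 'mc" and cM :: "'m \<Rightarrow> 'mc"
    and sAC :: "complex \<Rightarrow> 'ac::ring_1 \<Rightarrow> 'ac" and cA :: "'a \<Rightarrow> 'ac"
    and sBC :: "complex \<Rightarrow> 'bc::ring_1 \<Rightarrow> 'bc" and cB :: "'b \<Rightarrow> 'bc"
    and HM :: "int \<Rightarrow> int \<Rightarrow> 'mc set"
    and t :: "'a \<Rightarrow> 'b \<Rightarrow> 'm"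
  assumes "cohomology_algebra sM GM dM"
    and "cohomology_algebra sA GA dA"
    and "cohomology_algebra sB GB dB"
    and "is_complexification sM sMC cM"
    and "is_complexification sA sAC cA"
    and "is_complexification sB sBC cB"
    and "polarized_hodge_structure sMC cM GM dM HM"
    and "is_graded_tensor_product sA GA sB GB sM GM t"
    and "GA 1 = {0} \<or> GB 1 = {0}"
  shows "even dA \<and> even dB \<and>
    (\<exists>HA HB. polarized_hodge_structure sAC cA GA dA HA \<and>
             polarized_hodge_structure sBC cB GB dB HB \<and>
             is_tensor_hodge_structure sMC (complexified_bilinear sAC cA sBC cB sMC cM t) HA HB HM)"
proof -
  interpret M: cohomology_algebra sM GM dM by fact
  interpret A: cohomology_algebra sA GA dA by fact
  interpret B: cohomology_algebra sB GB dB by fact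
  obtain n \<omega> where "hodge_structure sMC cM GM HM" "dM = 2 * int n" "polarization sMC cM GM n HM \<omega>"
    using assms(7) unfolding polarized_hodge_structure_def by blast
  then interpret polarized_tensor_product sA GA dA sAC cA sB GB dB sBC cB sM GM dM sMC cM t HM n \<omega>
    by unfold_locales (use assms in auto)
  show ?thesis by (rule factors)
qed

end
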